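(* Let $m>0$ be fixed. Then there exists a constant $C(m)>0$ ensuring the following. For all $V\in L^1(\mathbb{R},\mathbb{C}^{2\times2};d\nu_1)$ such that $\|V\|_{L^1(d\nu_1)}<C(m)$, we have $$\mathrm{Spec}_{\mathrm p}(\mathscr{L}_{m,V})\subseteq\left\{z\in\mathbb{C}:|\mathrm{Im}\,z|\le1,\ |\mathrm{Re}\,z|>\frac{C(m)}{\|V\|_{L^1}^{1/2}}\right\}$$ (the right-hand set being read as empty when $V=0$).
   Context: $d\nu_1(x)=\sqrt{1+x^2}\,dx$; $\|V\|_{L^1(d\nu_1)}=\int_{\mathbb{R}}|V(x)|_{\mathbb{C}^{2\times2}}\sqrt{1+x^2}\,dx$ and $\|V\|_{L^1}=\int_{\mathbb{R}}|V(x)|_{\mathbb{C}^{2\times2}}\,dx$ (Lebesgue measure), with $|\cdot|_{\mathbb{C}^{2\times2}}$ the operator norm induced by the Euclidean norm. $\mathrm{Spec}_{\mathrm p}$ is the set of eigenvalues. $\mathscr{L}_m:H^1(\mathbb{R},\mathbb{C}^2)\to L^2(\mathbb{R},\mathbb{C}^2)$ is $(\mathscr{L}_m f)(x)=\begin{pmatrix} m & -\partial_x\\ \partial_x & -m\end{pmatrix}f(x)+i\,\mathrm{sgn}(x)f(x)$. $\mathscr{L}_{m,V}$ is the following closed densely defined extension of $\mathscr{L}_m+V$ (defined on $H^1(\mathbb{R},\mathbb{C}^2)\cap\mathrm{Dom}(V)$), which exists for instance if $\|V\|_{L^1}<1$: write $V(x)=U(x)|V(x)|$ (polar decomposition), $A(x)=|V(x)|^{1/2}$,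 $B(x)=U(x)|V(x)|^{1/2}$ (maximal multiplication operators), $R_0(z)=(\mathscr{L}_m-z)^{-1}$, $Q(z)=\overline{AR_0(z)B}$ for $z\in\rho(\mathscr{L}_m)$; $\mathscr{L}_{m,V}$ is the closed operator whose resolvent is $R_0(z)-\overline{R_0(z)B}\,(I+Q(z))^{-1}AR_0(z)$ for every $z\in\rho(\mathscr{L}_m)$ with $-1\in\rho(Q(z))$ (a non-empty set). *)

theory Defs
  imports "HOL-Analysis.Analysis"
begin

section \<open>The space of square-integrable two-component functions\<close>

text \<open>Functions are Borel measurable and identified when they agree almost everywhere;
  restricting to Borel representatives loses no Lebesgue class. The norm on
  \<^typ>\<open>complex^2\<close> is the Euclidean one.\<close>

definition sq_integrable :: "(real \<Rightarrow> complex^2) \<Rightarrow> bool" where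
  "sq_integrable f \<longleftrightarrow> f \<in> borel_measurable lborel \<and> integrable lborel (\<lambda>x. (norm (f x))\<^sup>2)"

definition L2_rel :: "(real \<Rightarrow> complex^2) \<Rightarrow> (real \<Rightarrow> complex^2) \<Rightarrow> bool" where
  "L2_rel f g \<longleftrightarrow> sq_integrable f \<and> sq_integrable g \<and> (AE x in lborel. f x = g x)"

lemma sq_integrable_zero: "sq_integrable (\<lambda>x. 0)"
  by (simp add: sq_integrable_def)

lemma L2_rel_refl_iff: "L2_rel f f \<longleftrightarrow> sq_integrable f"
  by (simp add: L2_rel_def)

quotient_type L2 = "real \<Rightarrow> complex^2" / partial: L2_rel
  morphisms fun_of class_of
proof (rule part_equivpI)
  show "\<exists>f. L2_rel f f"
    using sq_integrable_zero by (auto simp: L2_rel_refl_iff)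
  show "symp L2_rel"
    by (auto simp: symp_def L2_rel_def elim: AE_mp)
  show "transp L2_rel"
  proof (rule transpI)
    fix f g h assume "L2_rel f g" "L2_rel g h"
    then show "L2_rel f h"
      unfolding L2_rel_def by (auto elim: AE_mp)
  qed
qed

lemma sq_integrable_add:
  assumes "sq_integrable f" "sq_integrable g"
  shows "sq_integrable (\<lambda>x. f x + g x)"
proof -
  have [measurable]: "f \<in> borel_measurable lborel" "g \<in> borel_measurable lborel"
    using assms by (auto simp: sq_integrable_def)
  have bd: "(norm (a + b))\<^sup>2 \<le> 2 * (norm a)\<^sup>2 + 2 * (norm b)\<^sup>2" for a b :: "complex^2"
  proof -
    have "(norm (a + b))\<^sup>2 \<le> (norm a + norm b)\<^sup>2"
      by (intro power_mono norm_triangle_ineq) auto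
    also have "\<dots> \<le> 2 * (norm a)\<^sup>2 + 2 * (norm b)\<^sup>2"
      using zero_le_power2[of "norm a - norm b"] by (simp add: power2_eq_square algebra_simps)
    finally show ?thesis .
  qed
  have "integrable lborel (\<lambda>x. 2 * (norm (f x))\<^sup>2 + 2 * (norm (g x))\<^sup>2)"
    using assms by (auto simp: sq_integrable_def)
  then have "integrable lborel (\<lambda>x. (norm (f x + g x))\<^sup>2)"
    by (rule Bochner_Integration.integrable_bound) (auto intro!: AE_I2 simp: bd)
  then show ?thesis by (simp add: sq_integrable_def)
qed

lemma norm_vector_scalar_mult: "norm (c *s v) = norm c * norm (v :: complex^2)"
  by (simp add: norm_vec_def norm_mult L2_set_right_distrib)

lemma measurable_vector_scalar_mult:
  assumes "f \<in> borel_measurable borel"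
  shows "(\<lambda>x. c *s f x :: complex^2) \<in> borel_measurable borel"
proof -
  have "continuous_on UNIV (\<lambda>v :: complex^2. c *s v)"
    unfolding vector_scalar_mult_def by (intro continuous_intros)
  then show ?thesis
    using assms borel_measurable_continuous_onI measurable_compose by blast
qed

lemma sq_integrable_scale:
  "sq_integrable f \<Longrightarrow> sq_integrable (\<lambda>x. c *s f x)"
  unfolding sq_integrable_def
  by (auto simp: norm_vector_scalar_mult power_mult_distrib intro: measurable_vector_scalar_mult)

lemma sq_integrable_scaleR:
  "sq_integrable f \<Longrightarrow> sq_integrable (\<lambda>x. r *\<^sub>R f x)"
  unfolding sq_integrable_def by (auto simp: power_mult_distrib)

lemma sq_integrable_uminus:
  "sq_integrable f \<Longrightarrow> sq_integrable (\<lambda>x. - f x)"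
  unfolding sq_integrable_def by auto

lemma sq_integrable_diff:
  "sq_integrable f \<Longrightarrow> sq_integrable g \<Longrightarrow> sq_integrable (\<lambda>x. f x - g x)"
  using sq_integrable_add[OF _ sq_integrable_uminus, of f g] by simp

lemma integrable_inner_sq:
  assumes "sq_integrable f" "sq_integrable g"
  shows "integrable lborel (\<lambda>x. f x \<bullet> g x)"
proof -
  have [measurable]: "f \<in> borel_measurable lborel" "g \<in> borel_measurable lborel"
    using assms by (auto simp: sq_integrable_def)
  have bd: "\<bar>a \<bullet> b\<bar> \<le> (norm a)\<^sup>2 + (norm b)\<^sup>2" for a b :: "complex^2"
  proof -
    have "\<bar>a \<bullet> b\<bar> \<le> norm a * norm b" by (rule Cauchy_Schwarz_ineq2)
    moreover have "2 * (norm a * norm b) \<le> (norm a)\<^sup>2 + (norm b)\<^sup>2"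
      using zero_le_power2[of "norm a - norm b"] by (simp add: power2_eq_square algebra_simps)
    moreover have "0 \<le> norm a * norm b" by simp
    ultimately show ?thesis by linarith
  qed
  have "integrable lborel (\<lambda>x. (norm (f x))\<^sup>2 + (norm (g x))\<^sup>2)"
    using assms by (auto simp: sq_integrable_def)
  then show ?thesis
    by (rule Bochner_Integration.integrable_bound) (auto intro!: AE_I2 simp: bd)
qed

text \<open>The real inner product is the real part of the complex one, hence induces the same norm.\<close>

instantiation L2 :: real_inner
begin

lift_definition zero_L2 :: L2 is "\<lambda>x. 0"
  by (simp add: L2_rel_refl_iff sq_integrable_zero)

lift_definition plus_L2 :: "L2 \<Rightarrow> L2 \<Rightarrow> L2" is "\<lambda>f g x. f x + g x"
  unfolding L2_rel_def by (auto intro: sq_integrable_add)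

lift_definition uminus_L2 :: "L2 \<Rightarrow> L2" is "\<lambda>f x. - f x"
  unfolding L2_rel_def by (auto intro: sq_integrable_uminus)

lift_definition minus_L2 :: "L2 \<Rightarrow> L2 \<Rightarrow> L2" is "\<lambda>f g x. f x - g x"
  unfolding L2_rel_def by (auto intro: sq_integrable_diff)

lift_definition scaleR_L2 :: "real \<Rightarrow> L2 \<Rightarrow> L2" is "\<lambda>r f x. r *\<^sub>R f x"
  unfolding L2_rel_def by (auto intro: sq_integrable_scaleR)

lift_definition inner_L2 :: "L2 \<Rightarrow> L2 \<Rightarrow> real" is "\<lambda>f g. LINT x|lborel. f x \<bullet> g x"
  unfolding L2_rel_def sq_integrable_def by (intro integral_cong_AE) auto

definition norm_L2 :: "L2 \<Rightarrow> real" where "norm_L2 u = sqrt (u \<bullet> u)"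

definition dist_L2 :: "L2 \<Rightarrow> L2 \<Rightarrow> real" where "dist_L2 u v = norm (u - v)"

definition sgn_L2 :: "L2 \<Rightarrow> L2" where "sgn_L2 u = inverse (norm u) *\<^sub>R u"

definition uniformity_L2 :: "(L2 \<times> L2) filter" where
  "uniformity_L2 = (INF e\<in>{0<..}. principal {(u, v). dist u v < e})"

definition open_L2 :: "L2 set \<Rightarrow> bool" where
  "open_L2 U \<longleftrightarrow> (\<forall>u\<in>U. eventually (\<lambda>(u', v). u' = u \<longrightarrow> v \<in> U) uniformity)"

instance
proof
  fix u v w :: L2 and r s :: real
  show "u + v + w = u + (v + w)"
    by transfer (auto simp: L2_rel_def add.assoc intro!: sq_integrable_add)
  show "u + v = v + u"
    by transfer (auto simp: L2_rel_def add.commute intro!: sq_integrable_add)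
  show "0 + u = u" by transfer (auto simp: L2_rel_def)
  show "- u + u = 0" by transfer (auto simp: L2_rel_def sq_integrable_zero)
  show "u - v = u + - v"
    by transfer (auto simp: L2_rel_def intro!: sq_integrable_diff)
  show "r *\<^sub>R (u + v) = r *\<^sub>R u + r *\<^sub>R v"
    by transfer (auto simp: L2_rel_def scaleR_add_right
        intro!: sq_integrable_add sq_integrable_scaleR)
  show "(r + s) *\<^sub>R u = r *\<^sub>R u + s *\<^sub>R u"
    by transfer (auto simp: L2_rel_def scaleR_add_left
        intro!: sq_integrable_add sq_integrable_scaleR)
  show "r *\<^sub>R s *\<^sub>R u = (r * s) *\<^sub>R u"
    by transfer (auto simp: L2_rel_def intro!: sq_integrable_scaleR)
  show "1 *\<^sub>R u = u" by transfer (auto simp: L2_rel_def)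
  show "dist u v = norm (u - v)" by (rule dist_L2_def)
  show "sgn u = inverse (norm u) *\<^sub>R u" by (simp add: sgn_L2_def)
  show "(uniformity :: (L2 \<times> L2) filter) = (INF e\<in>{0<..}. principal {(u, v). dist u v < e})"
    by (rule uniformity_L2_def)
  show "open U \<longleftrightarrow> (\<forall>u\<in>U. eventually (\<lambda>(u', v). u' = u \<longrightarrow> v \<in> U) uniformity)" for U :: "L2 set"
    by (rule open_L2_def)
  show "u \<bullet> v = v \<bullet> u" by transfer (simp add: inner_commute)
  show "(u + v) \<bullet> w = u \<bullet> w + v \<bullet> w"
    by transfer (simp add: L2_rel_refl_iff inner_add_left integrable_inner_sq)
  show "r *\<^sub>R u \<bullet> v = r * (u \<bullet> v)"
    by transfer simp
  show "0 \<le> u \<bullet> u" by transfer simp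
  show "u \<bullet> u = 0 \<longleftrightarrow> u = 0"
  proof transfer
    fix f assume "L2_rel f f"
    then have sq: "sq_integrable f" by (simp add: L2_rel_refl_iff)
    have "(LINT x|lborel. f x \<bullet> f x) = 0 \<longleftrightarrow> (AE x in lborel. f x \<bullet> f x = 0)"
      by (intro integral_nonneg_eq_0_iff_AE integrable_inner_sq sq) auto
    then show "(LINT x|lborel. f x \<bullet> f x) = 0 \<longleftrightarrow> L2_rel f (\<lambda>x. 0)"
      using sq by (simp add: L2_rel_def sq_integrable_zero)
  qed
  show "norm u = sqrt (u \<bullet> u)" by (rule norm_L2_def)
qed

end

lift_definition scaleC :: "complex \<Rightarrow> L2 \<Rightarrow> L2" (infixr "*\<^sub>C" 75) is "\<lambda>c f x. c *s f x"
  unfolding L2_rel_def by (auto intro: sq_integrable_scale)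


section \<open>Unbounded operators, represented by their graphs\<close>

type_synonym L2_op = "(L2 \<times> L2) set"

definition linear_op :: "L2_op \<Rightarrow> bool" where
  "linear_op T \<longleftrightarrow> (0, 0) \<in> T \<and>
     (\<forall>u v u' v'. (u, v) \<in> T \<and> (u', v') \<in> T \<longrightarrow> (u + u', v + v') \<in> T) \<and>
     (\<forall>c u v. (u, v) \<in> T \<longrightarrow> (c *\<^sub>C u, c *\<^sub>C v) \<in> T) \<and>
     single_valued T"

definition closed_op :: "L2_op \<Rightarrow> bool" where
  "closed_op T \<longleftrightarrow> linear_op T \<and> closed T"

definition bounded_op :: "L2_op \<Rightarrow> bool" where
  "bounded_op T \<longleftrightarrow> linear_op T \<and> Domain T = UNIV \<and> (\<exists>K. \<forall>(u, v)\<in>T. norm v \<le> K * norm u)"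

definition shift_op :: "L2_op \<Rightarrow> complex \<Rightarrow> L2_op" where
  "shift_op T z = {(u, v - z *\<^sub>C u) | u v. (u, v) \<in> T}"

definition diff_op :: "L2_op \<Rightarrow> L2_op \<Rightarrow> L2_op" where
  "diff_op S T = {(u, v - w) | u v w. (u, v) \<in> S \<and> (u, w) \<in> T}"

text \<open>On graphs, \<^const>\<open>relcomp\<close> is composition in the opposite order.\<close>

definition comp_op :: "L2_op \<Rightarrow> L2_op \<Rightarrow> L2_op" (infixr "\<circ>\<^sub>o" 75) where
  "S \<circ>\<^sub>o T = T O S"

definition resolvent :: "L2_op \<Rightarrow> complex \<Rightarrow> L2_op" where
  "resolvent T z = (shift_op T z)\<inverse>"

definition resolvent_set :: "L2_op \<Rightarrow> complex set" where
  "resolvent_set T = {z. closed_op T \<and> bounded_op (resolvent T z)}"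

definition point_spectrum :: "L2_op \<Rightarrow> complex set" where
  "point_spectrum T = {z. \<exists>u. u \<noteq> 0 \<and> (u, z *\<^sub>C u) \<in> T}"

text \<open>Maximal multiplication operator: the domain consists of all \<open>u\<close> for which the pointwise
  product \<open>M u\<close> is again square-integrable.\<close>

definition mult_op :: "(real \<Rightarrow> complex^2^2) \<Rightarrow> L2_op" where
  "mult_op M = {(u, v). AE x in lborel. fun_of v x = M x *v fun_of u x}"


section \<open>The unperturbed operator\<close>

text \<open>\<open>w\<close> is the weak derivative of \<open>u\<close>, tested against continuously differentiable functions
  of compact support. The Sobolev space of order one is the set of those \<open>u\<close> that have a weak
  derivative in \<^typ>\<open>L2\<close>.\<close>

definition weak_deriv :: "L2 \<Rightarrow> L2 \<Rightarrow> bool" where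
  "weak_deriv u w \<longleftrightarrow>
     (\<forall>\<phi> \<phi>' :: real \<Rightarrow> real.
        (\<forall>x. (\<phi> has_real_derivative \<phi>' x) (at x)) \<and> continuous_on UNIV \<phi>' \<and>
        compact (closure {x. \<phi> x \<noteq> 0}) \<longrightarrow>
        (LINT x|lborel. \<phi>' x *\<^sub>R fun_of u x) = - (LINT x|lborel. \<phi> x *\<^sub>R fun_of w x))"

definition op_L0 :: "real \<Rightarrow> L2_op" where
  "op_L0 m = {(f, g). \<exists>f'. weak_deriv f f' \<and>
     (AE x in lborel. fun_of g x =
        vector [of_real m * fun_of f x $ 1 - fun_of f' x $ 2,
                fun_of f' x $ 1 - of_real m * fun_of f x $ 2]
        + (\<i> * of_real (sgn x)) *s fun_of f x)}"


section \<open>Polar decomposition of matrices\<close>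

definition ctranspose :: "complex^2^2 \<Rightarrow> complex^2^2" where
  "ctranspose M = (\<chi> i j. cnj (M $ j $ i))"

text \<open>For Hermitian \<open>P\<close> the real inner product of \<open>v\<close> with \<open>P v\<close> equals the complex one.\<close>

definition psd :: "complex^2^2 \<Rightarrow> bool" where
  "psd P \<longleftrightarrow> ctranspose P = P \<and> (\<forall>v. 0 \<le> v \<bullet> (P *v v))"

definition mat_sqrt :: "complex^2^2 \<Rightarrow> complex^2^2" where
  "mat_sqrt P = (THE S. psd S \<and> S ** S = P)"

definition mat_abs :: "complex^2^2 \<Rightarrow> complex^2^2" where
  "mat_abs M = mat_sqrt (ctranspose M ** M)"

text \<open>The partial isometry of the polar decomposition, normalised to vanish on the kernel.\<close>

definition polar_isometry :: "complex^2^2 \<Rightarrow> complex^2^2" where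
  "polar_isometry M =
     (THE U. M = U ** mat_abs M \<and> (\<forall>v. mat_abs M *v v = 0 \<longrightarrow> U *v v = 0))"


section \<open>The perturbed operator\<close>

definition op_A :: "(real \<Rightarrow> complex^2^2) \<Rightarrow> L2_op" where
  "op_A V = mult_op (\<lambda>x. mat_sqrt (mat_abs (V x)))"

definition op_B :: "(real \<Rightarrow> complex^2^2) \<Rightarrow> L2_op" where
  "op_B V = mult_op (\<lambda>x. polar_isometry (V x) ** mat_sqrt (mat_abs (V x)))"

definition op_R0 :: "real \<Rightarrow> complex \<Rightarrow> L2_op" where
  "op_R0 m z = resolvent (op_L0 m) z"

definition op_Q :: "real \<Rightarrow> (real \<Rightarrow> complex^2^2) \<Rightarrow> complex \<Rightarrow> L2_op" where
  "op_Q m V z = closure (op_A V \<circ>\<^sub>o op_R0 m z \<circ>\<^sub>o op_B V)"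

definition good_points :: "real \<Rightarrow> (real \<Rightarrow> complex^2^2) \<Rightarrow> complex set" where
  "good_points m V = {z \<in> resolvent_set (op_L0 m). -1 \<in> resolvent_set (op_Q m V z)}"

text \<open>Note that \<^term>\<open>resolvent (op_Q m V z) (-1)\<close> is the inverse of \<open>I + Q(z)\<close>. Non-emptiness
  of the set of good points makes the operator unique.\<close>

definition is_op_LV :: "real \<Rightarrow> (real \<Rightarrow> complex^2^2) \<Rightarrow> L2_op \<Rightarrow> bool" where
  "is_op_LV m V T \<longleftrightarrow> closed_op T \<and> good_points m V \<noteq> {} \<and>
     (\<forall>z\<in>good_points m V. z \<in> resolvent_set T \<and>
        resolvent T z = diff_op (op_R0 m z)
          (closure (op_R0 m z \<circ>\<^sub>o op_B V) \<circ>\<^sub>o resolvent (op_Q m V z) (-1) \<circ>\<^sub>o op_A V \<circ>\<^sub>o op_R0 m z))"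

definition op_LV :: "real \<Rightarrow> (real \<Rightarrow> complex^2^2) \<Rightarrow> L2_op" where
  "op_LV m V = (THE T. is_op_LV m V T)"


section \<open>Norms of the potential\<close>

definition nu1 :: "real measure" where
  "nu1 = density lborel (\<lambda>x. ennreal (sqrt (1 + x\<^sup>2)))"

text \<open>The pointwise norm is the operator norm induced by the Euclidean norm.\<close>

definition L1_norm :: "real measure \<Rightarrow> (real \<Rightarrow> complex^2^2) \<Rightarrow> real" where
  "L1_norm M V = (LINT x|M. onorm (\<lambda>v. V x *v v))"

end

theory Submission
  imports Defs
begin

text \<open>The eigenvalue equation is an ordinary differential equation, and the theorem is an a priori estimate
for it. On each half line the equation \<open>L f - z f = g\<close> reads \<open>f1' = p\<^sup>2 f2 + g2\<close>, \<open>f2' = q\<^sup>2 f1 - g1\<close> with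
\<open>p\<^sup>2 = m + \<zeta>\<close> and \<open>q\<^sup>2 = m - \<zeta>\<close>, where \<open>\<zeta>\<close> is \<open>z - \<i>\<close> on the right and \<open>z + \<i>\<close> on the left. The roots can be chosen
such that \<open>Re (p q) \<ge> 0\<close>; then \<open>q f1 + p f2\<close> is a growing mode, which in a square integrable solution is
determined by the source. Each half line thus yields one linear equation for \<open>f\<close> at the origin, and the
determinant of the two equations is the Wronskian \<open>W\<close>. The difference of the squares of its two summands
is the constant \<open>- 4 m \<i>\<close>, whence \<open>norm W\<close> is at least of order \<open>1 / (1 + norm z)\<close> for every \<open>z\<close>, also on the
essential spectrum (\<open>wronskian_lower_bound\<close>). The supremum of \<open>f\<close> is therefore at most of order
\<open>(norm z)\<^sup>2\<close> times the integral of the source for large \<open>z\<close> (\<open>far_apriori\<close>, \<open>origin_bound_general\<close>); outside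
the strip \<open>\<bar>Im z\<bar> \<le> 1\<close> the Wronskian is of order \<open>norm z\<close> and nothing is lost
(\<open>wronskian_outside_strip\<close>); and for bounded \<open>z\<close> the estimate is uniform up to the thresholds
\<open>\<plusminus> m \<plusminus> \<i>\<close> if the source has a first moment (\<open>weighted_apriori\<close>). An eigenfunction of the perturbed operator
solves the system with source \<open>- V f\<close>, so its supremum is bounded by itself times the norm of \<open>V\<close> times one
of these constants (\<open>eigenvalue_necessary\<close>). If the product is less than 1 there is no eigenfunction.

It remains to know the perturbed operator, which is given only through its resolvents. At the base
point \<open>z = 0\<close> the free operator has an explicit inverse \<open>G\<close> with kernel dominated by \<open>exp (- \<bar>x - y\<bar>)\<close>. It maps
integrable and square integrable sources to bounded, square integrable functions; as \<open>A\<close> and \<open>B\<close> are of the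
size of the square root of the potential, \<open>G B\<close>, \<open>A G\<close> and \<open>A G B\<close> are bounded. The operator
\<open>f = G g - G B h\<close>, \<open>h = A f\<close>, that is \<open>g = L f + V f\<close>, has the prescribed resolvent at every good point by the resolvent
identity, and it is the only such operator since 0 is a good point for small \<open>V\<close> (\<open>op_LV_eq\<close>). Its
eigenfunctions satisfy \<open>f = G (z f - V f)\<close>, hence the differential equation (\<open>eigenfunction_system\<close>).

Two ingredients connect this with the definitions: a function with a weak derivative is absolutely
continuous, by the lemma of du Bois-Reymond, and for two-by-two matrices the Cayley-Hamilton theorem
makes the square roots and partial isometries explicit, hence measurable.\<close>

section \<open>Absolutely continuous functions on intervals\<close>

text \<open>Locally absolutely continuous functions, described by the fundamental theorem of calculus. The
statement is confined to intervals inside a set because the coefficients of the system jump at the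
origin: each half line, including the origin, is treated by itself, and the halves are glued.\<close>

definition primitive_on :: "real set \<Rightarrow> (real \<Rightarrow> complex) \<Rightarrow> (real \<Rightarrow> complex) \<Rightarrow> bool" where
  "primitive_on S F \<phi> \<longleftrightarrow> (\<forall>a b. a \<le> b \<and> {a..b} \<subseteq> S \<longrightarrow>
     set_integrable lborel {a..b} \<phi> \<and> F b - F a = (LINT x:{a..b}|lborel. \<phi> x))"

lemma primitive_onD:
  assumes "primitive_on S F \<phi>" "a \<le> b" "{a..b} \<subseteq> S"
  shows "set_integrable lborel {a..b} \<phi>" "F b - F a = (LINT x:{a..b}|lborel. \<phi> x)"
  using assms by (auto simp: primitive_on_def)

lemma primitive_on_subset: "primitive_on S F \<phi> \<Longrightarrow> T \<subseteq> S \<Longrightarrow> primitive_on T F \<phi>"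
  unfolding primitive_on_def by blast

lemma primitive_on_add:
  "primitive_on S F \<phi> \<Longrightarrow> primitive_on S G \<psi> \<Longrightarrow> primitive_on S (\<lambda>x. F x + G x) (\<lambda>x. \<phi> x + \<psi> x)"
  unfolding primitive_on_def by (simp add: set_integral_add algebra_simps)

lemma primitive_on_cmult:
  "primitive_on S F \<phi> \<Longrightarrow> primitive_on S (\<lambda>x. c * F x) (\<lambda>x. c * \<phi> x)"
  unfolding primitive_on_def by (simp flip: right_diff_distrib)

lemma primitive_on_diff:
  "primitive_on S F \<phi> \<Longrightarrow> primitive_on S G \<psi> \<Longrightarrow> primitive_on S (\<lambda>x. F x - G x) (\<lambda>x. \<phi> x - \<psi> x)"
  unfolding primitive_on_def by (simp add: set_integral_diff algebra_simps)

lemma primitive_on_cong_AE: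
  assumes "primitive_on S F \<phi>" "AE x in lborel. x \<in> S \<longrightarrow> \<phi> x = \<psi> x"
    and [measurable]: "\<psi> \<in> borel_measurable lborel"
    and FG: "\<And>x. x \<in> S \<Longrightarrow> F x = G x"
  shows "primitive_on S G \<psi>"
  unfolding primitive_on_def
proof (intro allI impI, elim conjE)
  fix a b :: real assume ab: "a \<le> b" "{a..b} \<subseteq> S"
  have I: "integrable lborel (\<lambda>x. indicator {a..b} x *\<^sub>R \<phi> x)"
    using primitive_onD(1)[OF assms(1) ab] by (simp add: set_integrable_def)
  have eq: "AE x in lborel. indicator {a..b} x *\<^sub>R \<phi> x = indicator {a..b} x *\<^sub>R \<psi> x"
    using assms(2) by eventually_elim (use ab in \<open>auto split: split_indicator\<close>)
  have m: "(\<lambda>x. indicator {a..b} x *\<^sub>R \<psi> x) \<in> borel_measurable lborel" by measurable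
  have "a \<in> S" "b \<in> S" using ab by auto
  moreover have "integrable lborel (\<lambda>x. indicator {a..b} x *\<^sub>R \<psi> x)"
    by (rule integrable_cong_AE_imp[OF I m]) (use eq in \<open>auto elim: eventually_mono\<close>)
  moreover have "(LINT x|lborel. indicator {a..b} x *\<^sub>R \<phi> x) = (LINT x|lborel. indicator {a..b} x *\<^sub>R \<psi> x)"
    by (rule integral_cong_AE[OF _ m eq]) (use I in auto)
  ultimately show "set_integrable lborel {a..b} \<psi> \<and> G b - G a = (LINT x:{a..b}|lborel. \<psi> x)"
    using primitive_onD(2)[OF assms(1) ab] FG
    by (simp add: set_integrable_def set_lebesgue_integral_def)
qed

lemma primitive_on_cong:
  assumes "primitive_on S F \<phi>" "\<And>x. x \<in> S \<Longrightarrow> \<phi> x = \<psi> x" "\<And>x. x \<in> S \<Longrightarrow> F x = G x"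
  shows "primitive_on S G \<psi>"
  unfolding primitive_on_def
proof (intro allI impI, elim conjE)
  fix a b :: real assume ab: "a \<le> b" "{a..b} \<subseteq> S"
  then have "a \<in> S" "b \<in> S" by auto
  moreover have "(\<lambda>x. indicator {a..b} x *\<^sub>R \<phi> x) = (\<lambda>x. indicator {a..b} x *\<^sub>R \<psi> x)"
    using ab assms(2) by (intro ext) (auto split: split_indicator)
  ultimately show "set_integrable lborel {a..b} \<psi> \<and> G b - G a = (LINT x:{a..b}|lborel. \<psi> x)"
    using primitive_onD[OF assms(1) ab] assms(3)
    by (simp add: set_integrable_def set_lebesgue_integral_def)
qed

lemma primitive_on_glue:
  assumes "primitive_on {..c} F \<phi>" "primitive_on {c..} F \<phi>"
  shows "primitive_on UNIV F \<phi>"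
  unfolding primitive_on_def
proof (intro allI impI, elim conjE)
  fix a b :: real assume ab: "a \<le> b"
  consider "b \<le> c" | "c \<le> a" | "a < c" "c < b" by linarith
  then show "set_integrable lborel {a..b} \<phi> \<and> F b - F a = (LINT x:{a..b}|lborel. \<phi> x)"
  proof cases
    case 1 then show ?thesis using primitive_onD[OF assms(1) ab] by auto
  next
    case 2 then show ?thesis using primitive_onD[OF assms(2) ab] by auto
  next
    case 3
    then have 1: "set_integrable lborel {a..c} \<phi>" "F c - F a = (LINT x:{a..c}|lborel. \<phi> x)"
      using primitive_onD[OF assms(1), of a c] by auto
    have 2: "set_integrable lborel {c..b} \<phi>" "F b - F c = (LINT x:{c..b}|lborel. \<phi> x)"
      using primitive_onD[OF assms(2), of c b] 3 by auto
    have un: "{a..b} = {a..c} \<union> {c..b}" using 3 by auto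
    have "(LINT x:{a..c} \<union> {c..b}|lborel. \<phi> x) = (LINT x:{a..c}|lborel. \<phi> x) + (LINT x:{c..b}|lborel. \<phi> x)"
    proof (rule set_integral_Un_AE[OF _ _ _ 1(1) 2(1)])
      have "AE x in lborel. x \<noteq> c" by (rule AE_lborel_singleton)
      then show "AE x in lborel. \<not> (x \<in> {a..c} \<and> x \<in> {c..b})" by eventually_elim auto
    qed auto
    then show ?thesis using 1 2 un set_integrable_Un[OF 1(1) 2(1)] by (simp add: algebra_simps)
  qed
qed

lemma primitive_on_continuous:
  assumes "primitive_on {a..b} F \<phi>" "a \<le> b"
  shows "continuous_on {a..b} F"
proof -
  have I: "set_integrable lborel {a..b} \<phi>" using primitive_onD[OF assms(1,2)] by auto
  have "\<phi> integrable_on {a..b}" using set_borel_integral_eq_integral(1)[OF I] .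
  then have "continuous_on {a..b} (\<lambda>x. integral {a..x} \<phi>)"
    by (rule indefinite_integral_continuous_1)
  then have "continuous_on {a..b} (\<lambda>x. F a + integral {a..x} \<phi>)"
    by (intro continuous_intros)
  moreover have "F x = F a + integral {a..x} \<phi>" if "x \<in> {a..b}" for x
    using primitive_onD[OF assms(1), of a x] that set_borel_integral_eq_integral(2)[of "{a..x}" \<phi>]
    by (auto simp: algebra_simps)
  ultimately show ?thesis by (metis (no_types, lifting) continuous_on_eq)
qed

lemma primitive_on_UNIV_continuous:
  assumes "primitive_on UNIV F \<phi>"
  shows "continuous_on UNIV F"
proof -
  have "continuous (at x) F" for x
  proof -
    have "continuous_on {x-1..x+1} F"
      by (rule primitive_on_continuous[OF primitive_on_subset[OF assms]]) auto
    then have "continuous_on {x-1<..<x+1} F" by (rule continuous_on_subset) auto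
    then show ?thesis by (simp add: continuous_on_eq_continuous_at)
  qed
  then show ?thesis by (simp add: continuous_at_imp_continuous_on)
qed

lemma integrable_lborel_continuous:
  fixes g :: "real \<Rightarrow> 'a :: {banach, second_countable_topology}"
  assumes "continuous_on {a..b} g"
  shows "set_integrable lborel {a..b} g"
  unfolding set_integrable_def
  by (rule borel_integrable_atLeastAtMost'[OF assms, unfolded set_integrable_def])

text \<open>The factor \<open>E\<close> is an exponential or a test function. After writing \<open>F\<close> as an integral, the product
rule is an exchange of the order of integration over a triangle.\<close>

lemma primitive_on_product:
  assumes F: "primitive_on S F \<phi>"
    and E: "\<And>t. (E has_vector_derivative E' t) (at t)" and E': "continuous_on UNIV E'"
  shows "primitive_on S (\<lambda>t. E t * F t) (\<lambda>t. E t * \<phi> t + E' t * F t)"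
  unfolding primitive_on_def
proof (intro allI impI, elim conjE)
  fix a b :: real assume ab: "a \<le> b" "{a..b} \<subseteq> S"
  define \<phi>0 where "\<phi>0 = (\<lambda>u. indicator {a..b} u *\<^sub>R \<phi> u)"
  have I0[measurable]: "integrable lborel \<phi>0"
    using primitive_onD(1)[OF F ab] by (simp add: \<phi>0_def set_integrable_def)
  have [measurable]: "\<phi>0 \<in> borel_measurable borel" using I0 borel_measurable_integrable[OF I0] by simp
  have [measurable]: "E' \<in> borel_measurable borel"
    using E' by (rule borel_measurable_continuous_onI)
  have contE: "continuous_on UNIV E"
    using E by (metis continuous_at_imp_continuous_on has_vector_derivative_continuous)
  have contE_ab: "continuous_on {a..b} E" "continuous_on {a..b} E'" for a b
    using contE E' continuous_on_subset by blast+
  have "primitive_on {a..b} F \<phi>" using F ab(2) by (rule primitive_on_subset)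
  then have contF: "continuous_on {a..b} F" using primitive_on_continuous ab by blast
  obtain C where C: "\<And>t. t \<in> {a..b} \<Longrightarrow> norm (E' t) \<le> C"
  proof -
    have "compact (E' ` {a..b})" by (rule compact_continuous_image[OF contE_ab(2)]) auto
    then obtain C where "\<forall>x\<in>E' ` {a..b}. norm x \<le> C" using compact_imp_bounded bounded_iff by blast
    then show ?thesis by (intro that[of C]) auto
  qed
  define K where "K = (\<lambda>t u. (indicator {a..b} t * (if u \<le> t then 1 else 0)) *\<^sub>R (E' t * \<phi>0 u))"
  have [measurable]: "case_prod K \<in> borel_measurable (lborel \<Otimes>\<^sub>M lborel)"
    unfolding K_def by measurable
  have IH: "integrable (lborel \<Otimes>\<^sub>M lborel) (\<lambda>(t,u). indicator {a..b} t * (C * norm (\<phi>0 u)))"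
  proof (rule lborel_pair.Fubini_integrable)
    show "(\<lambda>(t,u). indicator {a..b} t * (C * norm (\<phi>0 u))) \<in> borel_measurable (lborel \<Otimes>\<^sub>M lborel)"
      by measurable
    have "(LINT y|lborel. norm (case (x, y) of (t, u) \<Rightarrow> indicator {a..b} t * (C * norm (\<phi>0 u))))
       = indicator {a..b} x * (\<bar>C\<bar> * (LINT u|lborel. norm (\<phi>0 u)))" for x :: real
      by (simp add: abs_mult)
    moreover have "integrable lborel (indicat_real {a..b})"
      by (rule integrable_real_indicator) (auto simp: emeasure_lborel_Icc_eq)
    ultimately show "integrable lborel (\<lambda>x. LINT y|lborel. norm (case (x, y) of (t, u) \<Rightarrow> indicator {a..b} t * (C * norm (\<phi>0 u))))"
      by simp
    show "AE x in lborel. integrable lborel (\<lambda>y. case (x, y) of (t, u) \<Rightarrow> indicator {a..b} t * (C * norm (\<phi>0 u)))"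
      using I0 by (auto intro!: AE_I2)
  qed
  have IK: "integrable (lborel \<Otimes>\<^sub>M lborel) (case_prod K)"
  proof (rule Bochner_Integration.integrable_bound[OF IH])
    show "AE x in lborel \<Otimes>\<^sub>M lborel. norm (case x of (t, u) \<Rightarrow> K t u) \<le> norm (case x of (t, u) \<Rightarrow> indicator {a..b} t * (C * norm (\<phi>0 u)))"
    proof (rule AE_I2)
      have "cmod (K t u) \<le> norm (indicat_real {a..b} t * (C * cmod (\<phi>0 u)))" for t u
        using C[of t] by (auto simp: K_def norm_mult abs_mult intro!: mult_right_mono split: split_indicator)
      then show "norm (case p of (t, u) \<Rightarrow> K t u) \<le> norm (case p of (t, u) \<Rightarrow> indicat_real {a..b} t * (C * norm (\<phi>0 u)))" for p
        by (cases p) simp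
    qed
  qed simp
  have inner_u: "(LINT u|lborel. K t u) = indicator {a..b} t *\<^sub>R (E' t * (F t - F a))" for t
  proof (cases "t \<in> {a..b}")
    case True
    have "(LINT u|lborel. K t u) = E' t * (LINT u|lborel. indicator {a..t} u *\<^sub>R \<phi> u)"
      unfolding K_def \<phi>0_def using True
      by (subst integral_mult_right_zero[symmetric], intro Bochner_Integration.integral_cong) (auto split: split_indicator)
    also have "\<dots> = E' t * (F t - F a)"
    proof -
      have "{a..t} \<subseteq> S" using True ab by auto
      then show ?thesis using primitive_onD(2)[OF F, of a t] True by (simp add: set_lebesgue_integral_def)
    qed
    finally show ?thesis using True by simp
  qed (simp add: K_def)
  have inner_t: "(LINT t|lborel. K t u) = \<phi>0 u * (E b - E u)" for u
  proof (cases "u \<in> {a..b}")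
    case True
    have "(LINT t|lborel. K t u) = \<phi>0 u * (LINT t|lborel. indicator {u..b} t *\<^sub>R E' t)"
      unfolding K_def using True
      by (subst integral_mult_right_zero[symmetric], intro Bochner_Integration.integral_cong) (auto split: split_indicator)
    also have "(LINT t|lborel. indicator {u..b} t *\<^sub>R E' t) = E b - E u"
      by (rule integral_FTC_atLeastAtMost)
         (use True contE_ab E in \<open>auto intro: has_vector_derivative_at_within\<close>)
    finally show ?thesis .
  qed (simp add: K_def \<phi>0_def)
  \<comment> \<open>Both sides are the integral of \<open>E' t * \<phi> u\<close> over the triangle \<open>a \<le> u \<le> t \<le> b\<close>.\<close>
  have fub: "(LINT t|lborel. indicator {a..b} t *\<^sub>R (E' t * (F t - F a))) = (LINT u|lborel. \<phi>0 u * (E b - E u))"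
    using lborel_pair.Fubini_integral[OF IK] by (simp add: inner_u inner_t)
  have IE': "integrable lborel (\<lambda>t. indicator {a..b} t *\<^sub>R E' t)"
    using integrable_lborel_continuous[OF contE_ab(2)] by (simp add: set_integrable_def)
  have IEF: "integrable lborel (\<lambda>t. indicator {a..b} t *\<^sub>R (E' t * F t))"
    using integrable_lborel_continuous[OF continuous_on_mult[OF contE_ab(2) contF]] by (simp add: set_integrable_def)
  have IEphi: "integrable lborel (\<lambda>t. indicator {a..b} t *\<^sub>R (E t * \<phi> t))"
  proof -
    have "compact (E ` {a..b})" by (rule compact_continuous_image[OF contE_ab(1)]) auto
    then obtain D where D: "\<forall>x\<in>E ` {a..b}. norm x \<le> D" using compact_imp_bounded bounded_iff by blast
    have [measurable]: "E \<in> borel_measurable borel" using contE by (rule borel_measurable_continuous_onI)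
    have eq: "indicator {a..b} t *\<^sub>R (E t * \<phi> t) = E t * \<phi>0 t" for t by (simp add: \<phi>0_def)
    have "integrable lborel (\<lambda>t. D *\<^sub>R \<phi>0 t)" using I0 by simp
    then have "integrable lborel (\<lambda>t. E t * \<phi>0 t)"
    proof (rule Bochner_Integration.integrable_bound)
      have "norm (E t * \<phi>0 t) \<le> norm (D *\<^sub>R \<phi>0 t)" for t
      proof (cases "t \<in> {a..b}")
        case True
        then have "norm (E t) \<le> \<bar>D\<bar>" using D by force
        then show ?thesis by (simp add: norm_mult mult_right_mono)
      qed (simp add: \<phi>0_def)
      then show "AE x in lborel. norm (E x * \<phi>0 x) \<le> norm (D *\<^sub>R \<phi>0 x)" by simp
    qed measurable
    then show ?thesis by (simp add: eq)
  qed
  have FTC: "(LINT t|lborel. indicator {a..b} t *\<^sub>R E' t) = E b - E a"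
    by (rule integral_FTC_atLeastAtMost) (use ab contE_ab E in \<open>auto intro: has_vector_derivative_at_within\<close>)
  have Fab: "(LINT u|lborel. \<phi>0 u) = F b - F a"
    using primitive_onD(2)[OF F ab] by (simp add: \<phi>0_def set_lebesgue_integral_def)
  have "(LINT t|lborel. indicator {a..b} t *\<^sub>R (E' t * (F t - F a)))
      = (LINT t|lborel. indicator {a..b} t *\<^sub>R (E' t * F t) - F a * (indicator {a..b} t *\<^sub>R E' t))"
    by (intro Bochner_Integration.integral_cong) (auto simp: algebra_simps split: split_indicator)
  also have "\<dots> = (LINT t|lborel. indicator {a..b} t *\<^sub>R (E' t * F t)) - F a * (E b - E a)"
    unfolding Bochner_Integration.integral_diff[OF IEF integrable_mult_right[OF IE']]
      integral_mult_right_zero FTC ..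
  finally have l: "(LINT t|lborel. indicator {a..b} t *\<^sub>R (E' t * F t)) - F a * (E b - E a)
       = (LINT t|lborel. indicator {a..b} t *\<^sub>R (E' t * (F t - F a)))" by simp
  have "(LINT u|lborel. \<phi>0 u * (E b - E u)) = (LINT u|lborel. E b * \<phi>0 u - indicator {a..b} u *\<^sub>R (E u * \<phi> u))"
    by (intro Bochner_Integration.integral_cong) (auto simp: algebra_simps \<phi>0_def)
  also have "\<dots> = E b * (F b - F a) - (LINT u|lborel. indicator {a..b} u *\<^sub>R (E u * \<phi> u))"
    using I0 IEphi Fab by (subst Bochner_Integration.integral_diff) auto
  finally have r: "(LINT u|lborel. \<phi>0 u * (E b - E u)) = E b * (F b - F a) - (LINT u|lborel. indicator {a..b} u *\<^sub>R (E u * \<phi> u))" .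
  have "E b * F b - E a * F a = (LINT u|lborel. indicator {a..b} u *\<^sub>R (E u * \<phi> u)) + (LINT t|lborel. indicator {a..b} t *\<^sub>R (E' t * F t))"
    using l[unfolded fub r] by algebra
  then show "set_integrable lborel {a..b} (\<lambda>t. E t * \<phi> t + E' t * F t) \<and>
          E b * F b - E a * F a = (LINT t:{a..b}|lborel. E t * \<phi> t + E' t * F t)"
    using IEF IEphi by (simp add: set_integrable_def set_lebesgue_integral_def scaleR_add_right)
qed

section \<open>Du Bois-Reymond lemma for weak derivatives\<close>

text \<open>The sets over which the integral vanishes form a Dynkin system containing the intervals, hence
contain all Borel sets.\<close>

lemma AE_zero_if_interval_integrals_zero:
  fixes d :: "real \<Rightarrow> 'a :: {banach, second_countable_topology}"
  assumes I: "\<And>a b. a \<le> b \<Longrightarrow> set_integrable lborel {a..b} d"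
    and Z: "\<And>a b. a \<le> b \<Longrightarrow> (LINT x:{a..b}|lborel. d x) = 0"
  shows "AE x in lborel. d x = 0"
proof -
  have loc: "AE x in lborel. indicator {-real n..real n} x *\<^sub>R d x = 0" for n
  proof (rule sigma_finite_measure.density_zero[OF sigma_finite_lborel])
    let ?I = "{-real n..real n}"
    let ?f = "\<lambda>x. indicator ?I x *\<^sub>R d x"
    show int: "integrable lborel ?f"
      using I[of "-real n" "real n"] by (simp add: set_integrable_def)
    fix A :: "real set" assume A: "A \<in> sets lborel"
    let ?G = "range (\<lambda>(a, b). {a..b :: real})"
    have borel_eq: "sets borel = sigma_sets UNIV ?G"
      by (simp add: borel_eq_atLeastAtMost sets_measure_of)
    have total: "(LINT x|lborel. ?f x) = 0"
      using Z[of "-real n" "real n"] by (simp add: set_lebesgue_integral_def)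
    have meas: "B \<in> sets borel" if "B \<in> sigma_sets UNIV ?G" for B using that borel_eq by simp
    have intB: "integrable lborel (\<lambda>x. indicator B x *\<^sub>R ?f x)" if "B \<in> sigma_sets UNIV ?G" for B
      using integrable_mult_indicator[OF _ int, of B] meas[OF that] by simp
    have "(LINT x|lborel. indicator A x *\<^sub>R ?f x) = 0"
    proof (rule sigma_sets_induct_disjoint[of ?G UNIV A])
      show "Int_stable ?G" by (auto simp: Int_stable_def image_iff)
      show "?G \<subseteq> Pow UNIV" by simp
      show "A \<in> sigma_sets UNIV ?G" using A borel_eq by simp
    next
      fix B assume "B \<in> ?G"
      then obtain a b where B: "B = {a..b}" by auto
      have eq: "(\<lambda>x. indicator B x *\<^sub>R ?f x) = (\<lambda>x. indicator {max a (-real n)..min b (real n)} x *\<^sub>R d x)"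
        by (auto simp: B split: split_indicator)
      show "(LINT x|lborel. indicator B x *\<^sub>R ?f x) = 0"
      proof (cases "max a (-real n) \<le> min b (real n)")
        case True
        then show ?thesis using Z[OF True] unfolding eq by (simp only: set_lebesgue_integral_def)
      next
        case False
        then have "{max a (-real n)..min b (real n)} = {}" by auto
        then show ?thesis unfolding eq by simp
      qed
    next
      show "(LINT x|lborel. indicator {} x *\<^sub>R ?f x) = 0" by simp
    next
      fix B assume B: "B \<in> sigma_sets UNIV ?G" and 0: "(LINT x|lborel. indicator B x *\<^sub>R ?f x) = 0"
      have "(LINT x|lborel. indicator (UNIV - B) x *\<^sub>R ?f x)
         = (LINT x|lborel. ?f x - indicator B x *\<^sub>R ?f x)"
        by (intro Bochner_Integration.integral_cong) (auto split: split_indicator)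
      also have "\<dots> = 0" using total 0 int intB[OF B] by (subst Bochner_Integration.integral_diff) auto
      finally show "(LINT x|lborel. indicator (UNIV - B) x *\<^sub>R ?f x) = 0" .
    next
      fix B :: "nat \<Rightarrow> real set"
      assume dis: "disjoint_family B" and B: "range B \<subseteq> sigma_sets UNIV ?G"
        and 0: "\<And>i. (LINT x|lborel. indicator (B i) x *\<^sub>R ?f x) = 0"
      have U: "(\<Union>i. B i) \<in> sigma_sets UNIV ?G" using B by (intro sigma_sets.Union) auto
      have "(LINT x:(\<Union>i. B i)|lborel. ?f x) = (\<Sum>i. (LINT x:(B i)|lborel. ?f x))"
      proof (rule lebesgue_integral_countable_add)
        show "\<And>i. B i \<in> sets lborel" using B meas by auto
        show "\<And>i j. i \<noteq> j \<Longrightarrow> B i \<inter> B j = {}" using dis by (auto simp: disjoint_family_on_def)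
        show "set_integrable lborel (\<Union>i. B i) ?f" using intB[OF U] by (simp add: set_integrable_def)
      qed
      then show "(LINT x|lborel. indicator (\<Union>i. B i) x *\<^sub>R ?f x) = 0"
        using 0 by (simp add: set_lebesgue_integral_def)
    qed
    then show "set_lebesgue_integral lborel A ?f = 0" by (simp add: set_lebesgue_integral_def)
  qed
  then have "AE x in lborel. \<forall>n. indicator {-real n..real n} x *\<^sub>R d x = 0"
    unfolding AE_all_countable by blast
  then show ?thesis
  proof eventually_elim
    fix x assume a: "\<forall>n. indicator {-real n..real n} x *\<^sub>R d x = 0"
    obtain n where "\<bar>x\<bar> \<le> real n" using real_arch_simple by blast
    then show "d x = 0" using spec[OF a, of n] by (auto simp: indicator_def split: if_splits)
  qed
qed

text \<open>The test functions of \<^const>\<open>weak_deriv\<close>, together with their derivatives.\<close>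

definition test_fun :: "(real \<Rightarrow> real) \<Rightarrow> (real \<Rightarrow> real) \<Rightarrow> bool" where
  "test_fun \<phi> \<phi>' \<longleftrightarrow> (\<forall>x. (\<phi> has_real_derivative \<phi>' x) (at x)) \<and> continuous_on UNIV \<phi>' \<and>
     compact (closure {x. \<phi> x \<noteq> 0})"

lemma test_fun_support:
  assumes "test_fun \<phi> \<phi>'"
  obtains R where "R > 0" "\<And>x. \<bar>x\<bar> \<ge> R \<Longrightarrow> \<phi> x = 0" "\<And>x. \<bar>x\<bar> \<ge> R \<Longrightarrow> \<phi>' x = 0"
proof -
  have "bounded {x. \<phi> x \<noteq> 0}"
    using assms bounded_subset[OF compact_imp_bounded closure_subset] unfolding test_fun_def by blast
  then obtain R0 where R0: "\<And>x. \<phi> x \<noteq> 0 \<Longrightarrow> \<bar>x\<bar> \<le> R0" by (auto simp: bounded_iff)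
  define R where "R = \<bar>R0\<bar> + 1"
  have z: "\<phi> x = 0" if "\<bar>x\<bar> \<ge> R" for x using R0[of x] that by (force simp: R_def)
  have z': "\<phi>' x = 0" if "\<bar>x\<bar> \<ge> R" for x
  proof -
    have "(\<phi> has_real_derivative 0) (at x)"
    proof (rule DERIV_cong_ev[THEN iffD2])
      show "x = x" "(0::real) = 0" by auto
      have "\<forall>\<^sub>F y in nhds x. y \<in> {y. \<bar>R0\<bar> < \<bar>y\<bar>}"
        using that by (intro eventually_nhds_in_open open_Collect_less continuous_intros) (auto simp: R_def)
      then show "\<forall>\<^sub>F y in nhds x. \<phi> y = 0"
        by eventually_elim (use R0 in force)
      show "((\<lambda>y. 0) has_real_derivative 0) (at x)" by simp
    qed
    then show ?thesis using assms DERIV_unique unfolding test_fun_def by blast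
  qed
  show ?thesis by (rule that[of R]) (use z z' in \<open>auto simp: R_def\<close>)
qed

lemma test_funI:
  assumes "\<And>x. (\<phi> has_real_derivative \<phi>' x) (at x)" "continuous_on UNIV \<phi>'"
    and "\<And>x. \<bar>x\<bar> > R \<Longrightarrow> \<phi> x = 0"
  shows "test_fun \<phi> \<phi>'"
proof -
  have "{x. \<phi> x \<noteq> 0} \<subseteq> {-R..R}" using assms(3) by force
  then have "closure {x. \<phi> x \<noteq> 0} \<subseteq> {-R..R}" by (rule closure_minimal) simp
  then have "compact (closure {x. \<phi> x \<noteq> 0})"
    by (meson bounded_closed_interval bounded_subset closed_closure compact_eq_bounded_closed)
  then show ?thesis using assms(1,2) by (auto simp: test_fun_def)
qed

lemma primitive_test_by_parts:
  assumes F: "primitive_on UNIV F w" and t: "test_fun \<phi> \<phi>'"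
  shows "integrable lborel (\<lambda>x. \<phi>' x *\<^sub>R F x)" "integrable lborel (\<lambda>x. \<phi> x *\<^sub>R w x)"
    "(LINT x|lborel. \<phi>' x *\<^sub>R F x) = - (LINT x|lborel. \<phi> x *\<^sub>R w x)"
proof -
  obtain R where R: "R > 0" "\<And>x. \<bar>x\<bar> \<ge> R \<Longrightarrow> \<phi> x = 0" "\<And>x. \<bar>x\<bar> \<ge> R \<Longrightarrow> \<phi>' x = 0"
    using test_fun_support[OF t] by blast
  have d: "(\<phi> has_real_derivative \<phi>' x) (at x)" for x using t by (simp add: test_fun_def)
  have c': "continuous_on UNIV \<phi>'" using t by (simp add: test_fun_def)
  have [measurable]: "\<phi>' \<in> borel_measurable borel" using c' by (rule borel_measurable_continuous_onI)
  have cF: "continuous_on UNIV F" using F by (rule primitive_on_UNIV_continuous)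
  have P: "primitive_on UNIV (\<lambda>t. of_real (\<phi> t) * F t) (\<lambda>t. of_real (\<phi> t) * w t + of_real (\<phi>' t) * F t)"
    by (rule primitive_on_product[OF F])
       (use d c' in \<open>auto intro!: continuous_intros has_vector_derivative_of_real simp: has_real_derivative_iff_has_vector_derivative\<close>)
  note PD = primitive_onD[OF P, of "-R" R]
  have i1: "set_integrable lborel {-R..R} (\<lambda>x. \<phi>' x *\<^sub>R F x)"
    by (rule integrable_lborel_continuous) (intro continuous_intros continuous_on_subset[OF c'] continuous_on_subset[OF cF]; simp)
  have e1: "(\<lambda>x. indicator {-R..R} x *\<^sub>R (\<phi>' x *\<^sub>R F x)) = (\<lambda>x. \<phi>' x *\<^sub>R F x)"
    using R(3) by (intro ext) (auto split: split_indicator)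
  show I1: "integrable lborel (\<lambda>x. \<phi>' x *\<^sub>R F x)" using i1 unfolding set_integrable_def e1 .
  have e2: "(\<lambda>x. indicator {-R..R} x *\<^sub>R (of_real (\<phi> x) * w x + of_real (\<phi>' x) * F x))
     = (\<lambda>x. \<phi> x *\<^sub>R w x + \<phi>' x *\<^sub>R F x)"
    using R(2,3) by (intro ext) (auto simp: scaleR_conv_of_real split: split_indicator)
  have I2: "integrable lborel (\<lambda>x. \<phi> x *\<^sub>R w x + \<phi>' x *\<^sub>R F x)"
    using PD(1) R(1) by (simp add: set_integrable_def e2)
  show I3: "integrable lborel (\<lambda>x. \<phi> x *\<^sub>R w x)"
    using Bochner_Integration.integrable_diff[OF I2 I1] by simp
  have "(LINT x|lborel. \<phi> x *\<^sub>R w x + \<phi>' x *\<^sub>R F x) = 0"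
    using PD(2) R by (simp add: set_lebesgue_integral_def e2)
  then show "(LINT x|lborel. \<phi>' x *\<^sub>R F x) = - (LINT x|lborel. \<phi> x *\<^sub>R w x)"
    using I1 I3 by (simp add: eq_neg_iff_add_eq_0 add.commute)
qed

text \<open>A compactly supported continuous function is the derivative of a test function as soon as its
integral vanishes; its primitive is then constant outside the support, and that constant is zero on
both sides.\<close>

lemma test_fun_of_mean_zero:
  fixes \<psi> :: "real \<Rightarrow> real"
  assumes c: "continuous_on UNIV \<psi>" and z: "\<And>x. \<bar>x\<bar> > R \<Longrightarrow> \<psi> x = 0"
    and i: "(LINT x|lborel. \<psi> x) = 0" and R: "R > 0"
  shows "\<exists>\<phi>. test_fun \<phi> \<psi>"
proof -
  have ab: "continuous_on {a..b} \<psi>" for a b using c continuous_on_subset by blast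
  have int: "\<psi> integrable_on {a..b}" for a b by (rule integrable_continuous_interval[OF ab])
  have z0: "integral {a..b} \<psi> = 0" if "(b \<le> -R \<or> R \<le> a)" for a b
  proof -
    have "integral {a..b} \<psi> = integral {a..b} (\<lambda>_. 0)"
    proof (rule integral_spike[of "{-R,R}"])
      fix x assume "x \<in> {a..b} - {-R,R}"
      then show "0 = \<psi> x" using z[of x] that R by force
    qed auto
    then show ?thesis by simp
  qed
  have "(LINT x|lborel. \<psi> x) = (LINT x:{-R..R}|lborel. \<psi> x)"
  proof -
    have "\<psi> x = indicator {-R..R} x *\<^sub>R \<psi> x" for x
      using z[of x] by (cases "\<bar>x\<bar> > R") (auto simp: indicator_def)
    then show ?thesis unfolding set_lebesgue_integral_def
      by (intro Bochner_Integration.integral_cong refl)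
  qed
  also have "\<dots> = integral {-R..R} \<psi>"
    by (rule set_borel_integral_eq_integral(2)[OF integrable_lborel_continuous[OF ab]])
  finally have tot: "integral {-R..R} \<psi> = 0" using i by simp
  define \<phi> where "\<phi> = (\<lambda>x. integral {-R..x} \<psi> - integral {x..-R} \<psi>)"
  have \<phi>: "\<phi> x = integral {-S..x} \<psi>" if "S \<ge> R" "-S \<le> x" for x S
  proof (cases "-R \<le> x")
    case True
    have "integral {x..-R} \<psi> = 0" by (rule z0) auto
    moreover have "integral {-S..-R} \<psi> + integral {-R..x} \<psi> = integral {-S..x} \<psi>"
      by (rule Henstock_Kurzweil_Integration.integral_combine[OF _ _ int]) (use True that in auto)
    moreover have "integral {-S..-R} \<psi> = 0" by (rule z0) auto
    ultimately show ?thesis by (simp add: \<phi>_def)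
  next
    case False
    then show ?thesis using z0[of x "-S"] z0[of "-R" x] z0[of "-R" x] z0[where a = x and b = "-R"]
      by (simp add: \<phi>_def z0)
  qed
  have "(\<phi> has_real_derivative \<psi> x) (at x)" for x
  proof -
    define S where "S = max R (\<bar>x\<bar> + 1)"
    have "((\<lambda>u. integral {-S..u} \<psi>) has_real_derivative \<psi> x) (at x within {-S..x+1})"
      by (rule integral_has_real_derivative[OF ab]) (auto simp: S_def)
    then have "((\<lambda>u. integral {-S..u} \<psi>) has_real_derivative \<psi> x) (at x within {-S<..<x+1})"
      by (rule DERIV_subset) auto
    moreover have "at x within {-S<..<x+1} = at x" by (rule at_within_open) (auto simp: S_def)
    ultimately have D: "((\<lambda>u. integral {-S..u} \<psi>) has_real_derivative \<psi> x) (at x)" by simp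
    show ?thesis
    proof (rule DERIV_cong_ev[THEN iffD2, OF refl _ refl D])
      have "\<forall>\<^sub>F y in nhds x. y \<in> {-S<..}"
        by (rule eventually_nhds_in_open) (auto simp: S_def)
      then show "\<forall>\<^sub>F y in nhds x. \<phi> y = integral {-S..y} \<psi>"
        by eventually_elim (rule \<phi>, auto simp: S_def)
    qed
  qed
  moreover have "\<phi> x = 0" if "\<bar>x\<bar> > R" for x
  proof (cases "x > R")
    case True
    then have "integral {-R..R} \<psi> + integral {R..x} \<psi> = integral {-R..x} \<psi>"
      using R by (intro Henstock_Kurzweil_Integration.integral_combine[OF _ _ int]) auto
    then show ?thesis using True \<phi>[of R x] tot z0[of x R] z0[where a=R and b=x] R by simp
  next
    case False
    then have "x < -R" using that by auto
    then show ?thesis by (simp add: \<phi>_def z0)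
  qed
  ultimately have "test_fun \<phi> \<psi>" using c by (intro test_funI[of _ _ R]) auto
  then show ?thesis by blast
qed

text \<open>The continuous piecewise linear function that is 1 on \<open>[a, b]\<close> and descends to 0 with slope \<open>n\<close>. It
approximates the indicator of the interval; for \<open>n \<ge> 1\<close> the supports stay in \<open>[a - 1, b + 1]\<close>.\<close>

definition trapezoid :: "real \<Rightarrow> real \<Rightarrow> nat \<Rightarrow> real \<Rightarrow> real" where
  "trapezoid a b n x = max 0 (min 1 (1 + real n * min (x - a) (b - x)))"

lemma trapezoid_bounds: "0 \<le> trapezoid a b n x" "trapezoid a b n x \<le> 1"
  by (auto simp: trapezoid_def)

lemma trapezoid_outside: "x < a - 1 \<or> x > b + 1 \<Longrightarrow> n \<ge> 1 \<Longrightarrow> trapezoid a b n x = 0"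
proof -
  assume x: "x < a - 1 \<or> x > b + 1" and n: "n \<ge> 1"
  then have "min (x - a) (b - x) \<le> -1" by auto
  then have "real n * min (x - a) (b - x) \<le> real n * (-1)" by (intro mult_left_mono) auto
  then show ?thesis using n by (simp add: trapezoid_def)
qed

lemma trapezoid_inside: "a \<le> x \<Longrightarrow> x \<le> b \<Longrightarrow> trapezoid a b n x = 1"
  by (simp add: trapezoid_def min_def)

lemma trapezoid_tendsto: "(\<lambda>n. trapezoid a b n x) \<longlonglongrightarrow> indicator {a..b} x"
proof (cases "x \<in> {a..b}")
  case True
  then show ?thesis by (simp add: trapezoid_inside)
next
  case False
  define \<delta> where "\<delta> = - min (x - a) (b - x)"
  have d: "\<delta> > 0" using False by (auto simp: \<delta>_def)
  obtain N where N: "1 < real N * \<delta>" using d reals_Archimedean3 by blast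
  have "trapezoid a b n x = 0" if "n \<ge> N" for n
  proof -
    have "real N * \<delta> \<le> real n * \<delta>" using that d by (intro mult_right_mono) auto
    then show ?thesis using N by (simp add: trapezoid_def \<delta>_def)
  qed
  then have "\<forall>\<^sub>F n in sequentially. trapezoid a b n x = indicator {a..b} x"
    using False unfolding eventually_sequentially by auto
  then show ?thesis by (rule tendsto_eventually)
qed

lemma trapezoid_continuous: "continuous_on UNIV (trapezoid a b n)"
  unfolding trapezoid_def by (intro continuous_intros)

text \<open>Testing against trapezoids of mean zero and passing to the limit shows that the integral of \<open>d\<close> over
an interval is proportional to its length, so \<open>d\<close> minus the factor has vanishing interval integrals.\<close>

lemma du_Bois_Reymond:
  fixes d :: "real \<Rightarrow> complex"
  assumes loc: "\<And>a b. a \<le> b \<Longrightarrow> set_integrable lborel {a..b} d"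
    and test: "\<And>\<phi> \<phi>'. test_fun \<phi> \<phi>' \<Longrightarrow> (LINT x|lborel. \<phi>' x *\<^sub>R d x) = 0"
  shows "\<exists>K. AE x in lborel. d x = K"
proof -
  have bint: "integrable lborel (\<lambda>x. g x *\<^sub>R d x)"
    if g: "\<And>x. \<bar>g x\<bar> \<le> 1" "\<And>x. x \<notin> {p..q} \<Longrightarrow> g x = 0" "g \<in> borel_measurable borel" "p \<le> q"
    for g :: "real \<Rightarrow> real" and p q
  proof -
    have L: "integrable lborel (\<lambda>x. indicator {p..q} x *\<^sub>R d x)" using loc[OF g(4)] by (simp add: set_integrable_def)
    have e: "g x *\<^sub>R d x = g x *\<^sub>R (indicator {p..q} x *\<^sub>R d x)" for x using g(2)[of x] by (auto split: split_indicator)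
    show ?thesis unfolding e
    proof (rule Bochner_Integration.integrable_bound[OF L])
      show "(\<lambda>x. g x *\<^sub>R (indicator {p..q} x *\<^sub>R d x)) \<in> borel_measurable lborel"
        using g(3) by (intro borel_measurable_scaleR[OF _ borel_measurable_integrable[OF L]]) simp
      have "\<bar>g x\<bar> * norm (indicator {p..q} x *\<^sub>R d x) \<le> 1 * norm (indicator {p..q} x *\<^sub>R d x)" for x
        using g(1) by (intro mult_right_mono) auto
      then show "AE x in lborel. cmod (g x *\<^sub>R indicat_real {p..q} x *\<^sub>R d x) \<le> cmod (indicat_real {p..q} x *\<^sub>R d x)"
        by (intro AE_I2) (simp only: norm_scaleR[of "g _"] real_norm_def mult_1)
    qed
  qed
  have tm[measurable]: "trapezoid a b n \<in> borel_measurable borel" for a b n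
    by (rule borel_measurable_continuous_onI[OF trapezoid_continuous])
  \<comment> \<open>A fixed bump; subtracting a multiple of it gives a trapezoid mean zero, as a derivative of a test function must have.\<close>
  define T0 where "T0 = trapezoid 0 0 1"
  have T0b: "\<bar>T0 x\<bar> \<le> 1" for x using trapezoid_bounds[of 0 0 1 x] by (auto simp: T0_def)
  have T00: "T0 x = 0" if "x \<notin> {-1..1}" for x using that trapezoid_outside[of x 0 0 1] by (auto simp: T0_def)
  have T0m[measurable]: "T0 \<in> borel_measurable borel" by (simp add: T0_def)
  have ctsupp: "integrable lborel g" if "continuous_on UNIV g" "\<And>x. x \<notin> {p..q} \<Longrightarrow> g x = 0" for g :: "real \<Rightarrow> real" and p q
  proof -
    have "set_integrable lborel {p..q} g" by (rule integrable_lborel_continuous[OF continuous_on_subset[OF that(1)]]) simp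
    moreover have "(\<lambda>x. indicator {p..q} x *\<^sub>R g x) = g" using that(2) by (intro ext) (auto split: split_indicator)
    ultimately show ?thesis by (simp add: set_integrable_def)
  qed
  have IT0: "integrable lborel T0" by (rule ctsupp[of _ "-1" 1]) (use T00 trapezoid_continuous in \<open>auto simp: T0_def\<close>)
  define c0 where "c0 = (LINT x|lborel. T0 x)"
  have c0: "c0 > 0"
  proof -
    have "c0 \<ge> (LINT x|lborel. indicator {-1/2..1/2::real} x * (1/2))"
      unfolding c0_def
    proof (rule integral_mono[OF _ IT0])
      show "integrable lborel (\<lambda>x. indicator {-1/2..1/2::real} x * (1/2::real))"
        using integrable_real_indicator[of "{-1/2..1/2::real}" lborel] by (simp add: emeasure_lborel_Icc_eq)
      show "indicator {-1/2..1/2::real} x * (1/2) \<le> T0 x" for x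
        by (auto simp: T0_def trapezoid_def indicator_def)
    qed
    then show ?thesis by simp
  qed
  define K where "K = (LINT x|lborel. T0 x *\<^sub>R d x) /\<^sub>R c0"
  have key: "(LINT x|lborel. trapezoid a b n x *\<^sub>R d x) = (LINT x|lborel. trapezoid a b n x) *\<^sub>R K"
    if ab: "a \<le> b" and n: "n \<ge> 1" for a b n
  proof -
    define c where "c = (LINT x|lborel. trapezoid a b n x) / c0"
    define \<psi> where "\<psi> = (\<lambda>x. trapezoid a b n x - c * T0 x)"
    have Itr: "integrable lborel (trapezoid a b n)"
      by (rule ctsupp[of _ "a-1" "b+1"]) (use trapezoid_continuous trapezoid_outside n in auto)
    have "\<exists>\<phi>. test_fun \<phi> \<psi>"
    proof (rule test_fun_of_mean_zero)
      show "continuous_on UNIV \<psi>" unfolding \<psi>_def T0_def by (intro continuous_intros trapezoid_continuous)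
      show "0 < \<bar>a\<bar> + \<bar>b\<bar> + 1" by simp
      show "\<psi> x = 0" if "\<bar>a\<bar> + \<bar>b\<bar> + 1 < \<bar>x\<bar>" for x
      proof -
        have "x \<notin> {-1..1}" "x < a - 1 \<or> x > b + 1" using that by auto
        then show ?thesis using T00 trapezoid_outside n by (simp add: \<psi>_def)
      qed
      show "(LINT x|lborel. \<psi> x) = 0" using Itr IT0 c0 by (simp add: \<psi>_def c_def c0_def)
    qed
    then have "(LINT x|lborel. \<psi> x *\<^sub>R d x) = 0" using test by blast
    moreover have "integrable lborel (\<lambda>x. trapezoid a b n x *\<^sub>R d x)"
      by (rule bint[of _ "a-1" "b+1"]) (use trapezoid_bounds[of a b n] trapezoid_outside n ab in \<open>auto\<close>)
    moreover have "integrable lborel (\<lambda>x. T0 x *\<^sub>R d x)"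
      by (rule bint[of _ "-1" "1"]) (use T0b T00 in \<open>auto\<close>)
    ultimately have "(LINT x|lborel. trapezoid a b n x *\<^sub>R d x) = c *\<^sub>R (LINT x|lborel. T0 x *\<^sub>R d x)"
      unfolding \<psi>_def by (simp add: scaleR_diff_left flip: scaleR_scaleR)
    then show ?thesis by (simp add: K_def c_def divide_inverse)
  qed
  have "AE x in lborel. d x - K = 0"
  proof (rule AE_zero_if_interval_integrals_zero)
    fix a b :: real assume ab: "a \<le> b"
    have IKab: "set_integrable lborel {a..b} (\<lambda>x. K)" by (rule integrable_lborel_continuous) simp
    show "set_integrable lborel {a..b} (\<lambda>x. d x - K)" using loc[OF ab] IKab by (rule set_integral_diff)
    have w: "integrable lborel (\<lambda>x. indicator {a-1..b+1} x *\<^sub>R norm (d x))"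
      using set_integrable_norm[OF loc[of "a-1" "b+1"]] ab by (simp add: set_integrable_def)
    have "(\<lambda>n. LINT x|lborel. trapezoid a b (Suc n) x *\<^sub>R d x) \<longlonglongrightarrow> (LINT x|lborel. indicator {a..b} x *\<^sub>R d x)"
    proof (rule integral_dominated_convergence[OF _ _ w])
      show "(\<lambda>x. indicator {a..b} x *\<^sub>R d x) \<in> borel_measurable lborel"
        using loc[OF ab] by (simp add: set_integrable_def)
      show "(\<lambda>x. trapezoid a b (Suc n) x *\<^sub>R d x) \<in> borel_measurable lborel" for n
        by (rule borel_measurable_integrable, rule bint[of _ "a-1" "b+1"]) (use trapezoid_bounds[of a b "Suc n"] trapezoid_outside ab in \<open>auto\<close>)
      show "AE x in lborel. (\<lambda>n. trapezoid a b (Suc n) x *\<^sub>R d x) \<longlonglongrightarrow> indicat_real {a..b} x *\<^sub>R d x"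
        by (intro AE_I2 tendsto_intros LIMSEQ_Suc[OF trapezoid_tendsto])
      show "AE x in lborel. cmod (trapezoid a b (Suc n) x *\<^sub>R d x) \<le> indicat_real {a - 1..b + 1} x *\<^sub>R cmod (d x)" for n
        using trapezoid_bounds[of a b "Suc n"] trapezoid_outside[of _ a b "Suc n"]
        by (intro AE_I2) (auto simp: indicator_def intro!: mult_left_le_one_le)
    qed
    moreover have "(\<lambda>n. LINT x|lborel. trapezoid a b (Suc n) x) \<longlonglongrightarrow> (LINT x|lborel. indicator {a..b} x)"
    proof (rule integral_dominated_convergence[where w = "indicator {a-1..b+1}"])
      show "integrable lborel (indicat_real {a-1..b+1})"
        using integrable_real_indicator[of "{a-1..b+1}" lborel] by (simp add: emeasure_lborel_Icc_eq)
      show "AE x in lborel. (\<lambda>n. trapezoid a b (Suc n) x) \<longlonglongrightarrow> indicat_real {a..b} x"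
        by (intro AE_I2 LIMSEQ_Suc[OF trapezoid_tendsto])
      show "AE x in lborel. norm (trapezoid a b (Suc n) x) \<le> indicat_real {a - 1..b + 1} x" for n
        using trapezoid_bounds[of a b "Suc n"] trapezoid_outside[of _ a b "Suc n"]
        by (intro AE_I2) (auto simp: indicator_def)
    qed auto
    then have "(\<lambda>n. (LINT x|lborel. trapezoid a b (Suc n) x) *\<^sub>R K) \<longlonglongrightarrow> (LINT x|lborel. indicator {a..b} x) *\<^sub>R K"
      by (intro tendsto_intros)
    ultimately have "(LINT x|lborel. indicator {a..b} x *\<^sub>R d x) = (LINT x|lborel. indicator {a..b} x) *\<^sub>R K"
      using key[OF ab] by (simp add: LIMSEQ_unique)
    moreover have "(LINT x:{a..b}|lborel. d x - K) = (LINT x:{a..b}|lborel. d x) - (LINT x:{a..b}|lborel. K)"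
      by (rule set_integral_diff(2)[OF loc[OF ab] IKab])
    ultimately show "(LINT x:{a..b}|lborel. d x - K) = 0"
      by (simp add: set_lebesgue_integral_def)
  qed
  then have "AE x in lborel. d x = K" by simp
  then show ?thesis by blast
qed

section \<open>The Dirac system on a half line\<close>

text \<open>Variation of constants: the integrating factor removes the homogeneous term.\<close>

lemma primitive_on_exp:
  assumes "primitive_on S u (\<lambda>t. c * u t + r t)"
  shows "primitive_on S (\<lambda>t. exp (- c * of_real t) * u t) (\<lambda>t. exp (- c * of_real t) * r t)"
proof -
  have d: "((\<lambda>t. exp (- c * of_real t)) has_vector_derivative - c * exp (- c * of_real t)) (at t)" for t
  proof -
    have "((\<lambda>t. exp (- c * t)) has_field_derivative - c * exp (- c * of_real t)) (at (of_real t))"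
      by (auto intro!: derivative_eq_intros)
    from has_vector_derivative_real_field[OF this] show ?thesis .
  qed
  have "primitive_on S (\<lambda>t. exp (- c * of_real t) * u t)
      (\<lambda>t. exp (- c * of_real t) * (c * u t + r t) + - c * exp (- c * of_real t) * u t)"
    by (rule primitive_on_product[OF assms d]) (intro continuous_intros)
  then show ?thesis by (rule primitive_on_cong) (auto simp: algebra_simps)
qed

lemma set_integrable_exp_mult:
  fixes r :: "real \<Rightarrow> complex"
  assumes r: "set_integrable lborel {a..b} r"
  shows "set_integrable lborel {a..b} (\<lambda>t. exp (c * of_real t) * r t)"
proof -
  have "compact ((\<lambda>t. exp (c * of_real t)) ` {a..b})"
    by (rule compact_continuous_image) (auto intro!: continuous_intros)
  then obtain D where D: "\<And>t. t \<in> {a..b} \<Longrightarrow> norm (exp (c * of_real t)) \<le> D"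
    using compact_imp_bounded bounded_iff by (metis image_eqI)
  have I: "integrable lborel (\<lambda>t. D *\<^sub>R (indicator {a..b} t *\<^sub>R r t))"
    using r unfolding set_integrable_def by (intro integrable_scaleR_right)
  have [measurable]: "(\<lambda>t::real. exp (c * of_real t)) \<in> borel_measurable borel"
    by (intro borel_measurable_continuous_onI continuous_intros)
  have [measurable]: "(\<lambda>t. indicator {a..b} t *\<^sub>R r t) \<in> borel_measurable borel"
    using borel_measurable_integrable[OF r[unfolded set_integrable_def]] by simp
  have eq: "indicator {a..b} t *\<^sub>R (exp (c * of_real t) * r t) = exp (c * of_real t) * (indicator {a..b} t *\<^sub>R r t)" for t
    by simp
  show ?thesis
    unfolding set_integrable_def eq
  proof (rule Bochner_Integration.integrable_bound[OF I])
    have "norm (exp (c * of_real t) * (indicator {a..b} t *\<^sub>R r t)) \<le> norm (D *\<^sub>R (indicator {a..b} t *\<^sub>R r t))" for t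
    proof (cases "t \<in> {a..b}")
      case True
      then have "norm (exp (c * of_real t)) \<le> \<bar>D\<bar>" using D by force
      then show ?thesis using True by (simp add: norm_mult mult_right_mono abs_mult del: norm_exp_eq_Re)
    qed simp
    then show "AE x in lborel. norm (exp (c * of_real x) * (indicator {a..b} x *\<^sub>R r x)) \<le> norm (D *\<^sub>R (indicator {a..b} x *\<^sub>R r x))"
      by (intro AE_I2)
  qed measurable
qed

lemma norm_set_integral_exp_le:
  fixes r :: "real \<Rightarrow> complex"
  assumes r: "set_integrable lborel {a..b} r" and le: "\<And>t. t \<in> {a..b} \<Longrightarrow> Re (k + c * of_real t) \<le> 0"
  shows "norm (exp k * (LINT t:{a..b}|lborel. exp (c * of_real t) * r t)) \<le> (LINT t:{a..b}|lborel. norm (r t))"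
proof -
  have I: "set_integrable lborel {a..b} (\<lambda>t. exp k * (exp (c * of_real t) * r t))"
    using set_integrable_exp_mult[OF r] by (rule set_integrable_mult_right)
  have "exp k * (LINT t:{a..b}|lborel. exp (c * of_real t) * r t)
       = (LINT t:{a..b}|lborel. exp k * (exp (c * of_real t) * r t))" by simp
  also have "norm \<dots> \<le> (LINT t:{a..b}|lborel. norm (exp k * (exp (c * of_real t) * r t)))"
    by (rule set_integral_norm_bound[OF I])
  also have "\<dots> \<le> (LINT t:{a..b}|lborel. norm (r t))"
  proof (rule set_integral_mono[OF set_integrable_norm[OF I] set_integrable_norm[OF r]])
    fix t assume t: "t \<in> {a..b}"
    have "norm (exp k * (exp (c * of_real t) * r t)) = exp (Re (k + c * of_real t)) * norm (r t)"
      by (simp add: norm_mult exp_add)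
    also have "\<dots> \<le> 1 * norm (r t)" using le[OF t] by (intro mult_right_mono) auto
    finally show "norm (exp k * (exp (c * of_real t) * r t)) \<le> norm (r t)" by simp
  qed
  finally show ?thesis .
qed

text \<open>A mode that decays to the right is controlled by its value on the left, one that grows to the right
by its value on the right; neither bound loses anything when the real part of the rate is zero.\<close>

lemma decaying_bound:
  assumes u: "primitive_on {a..b} u (\<lambda>t. c * u t + r t)" and ab: "a \<le> b"
    and r: "set_integrable lborel {a..b} r" and c: "Re c \<le> 0"
  shows "norm (u b) \<le> norm (u a) + (LINT t:{a..b}|lborel. norm (r t))"
proof -
  have e: "exp (- c * of_real b) * u b - exp (- c * of_real a) * u a = (LINT t:{a..b}|lborel. exp (- c * of_real t) * r t)"
    using primitive_onD(2)[OF primitive_on_exp[OF u] ab] by simp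
  have "u b = exp (c * of_real b) * (exp (- c * of_real b) * u b)" by (simp flip: mult.assoc exp_add)
  also have "\<dots> = exp (c * of_real b) * (exp (- c * of_real a) * u a) + exp (c * of_real b) * (LINT t:{a..b}|lborel. exp (- c * of_real t) * r t)"
    unfolding e[symmetric] by (simp add: algebra_simps)
  also have "norm \<dots> \<le> norm (exp (c * of_real b) * (exp (- c * of_real a) * u a)) + (LINT t:{a..b}|lborel. norm (r t))"
  proof (intro norm_triangle_mono order_refl norm_set_integral_exp_le[OF r])
    fix t assume "t \<in> {a..b}"
    then have "Re c * (b - t) \<le> 0" using c by (intro mult_nonpos_nonneg) auto
    then show "Re (c * of_real b + - c * of_real t) \<le> 0" by (simp add: algebra_simps)
  qed
  also have "norm (exp (c * of_real b) * (exp (- c * of_real a) * u a)) = exp (Re c * (b - a)) * norm (u a)"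
    unfolding norm_mult norm_exp_eq_Re mult.assoc[symmetric] exp_add[symmetric] by (simp add: algebra_simps)
  also have "\<dots> \<le> 1 * norm (u a)" using c ab by (intro mult_right_mono) (auto intro: mult_nonpos_nonneg)
  finally show ?thesis by simp
qed

lemma growing_bound:
  assumes u: "primitive_on {a..b} u (\<lambda>t. c * u t + r t)" and ab: "a \<le> b"
    and r: "set_integrable lborel {a..b} r" and c: "Re c \<ge> 0"
  shows "norm (u a) \<le> norm (u b) + (LINT t:{a..b}|lborel. norm (r t))"
proof -
  have e: "exp (- c * of_real b) * u b - exp (- c * of_real a) * u a = (LINT t:{a..b}|lborel. exp (- c * of_real t) * r t)"
    using primitive_onD(2)[OF primitive_on_exp[OF u] ab] by simp
  have "u a = exp (c * of_real a) * (exp (- c * of_real a) * u a)" by (simp flip: mult.assoc exp_add)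
  also have "\<dots> = exp (c * of_real a) * (exp (- c * of_real b) * u b) - exp (c * of_real a) * (LINT t:{a..b}|lborel. exp (- c * of_real t) * r t)"
    unfolding e[symmetric] by (simp add: algebra_simps)
  also have "norm \<dots> \<le> norm (exp (c * of_real a) * (exp (- c * of_real b) * u b)) + (LINT t:{a..b}|lborel. norm (r t))"
  proof (rule order_trans[OF norm_triangle_ineq4 add_left_mono], rule norm_set_integral_exp_le[OF r])
    fix t assume "t \<in> {a..b}"
    then have "Re c * (t - a) \<ge> 0" using c by (intro mult_nonneg_nonneg) auto
    then show "Re (c * of_real a + - c * of_real t) \<le> 0" by (simp add: algebra_simps)
  qed
  also have "norm (exp (c * of_real a) * (exp (- c * of_real b) * u b)) = exp (- (Re c * (b - a))) * norm (u b)"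
    unfolding norm_mult norm_exp_eq_Re mult.assoc[symmetric] exp_add[symmetric] by (simp add: algebra_simps)
  also have "\<dots> \<le> 1 * norm (u b)" using c ab by (intro mult_right_mono) auto
  finally show ?thesis by simp
qed

text \<open>An integrable function need not tend to zero, but it cannot stay above \<open>e\<close> on a half line. Sequences
of such points replace limits at infinity below.\<close>

lemma integrable_recurs_small:
  fixes g :: "real \<Rightarrow> real"
  assumes g: "integrable lborel g" and e: "e > 0"
  shows "\<exists>x\<ge>X. g x < e"
proof (rule ccontr)
  assume "\<not> ?thesis"
  then have ge: "g x \<ge> e" if "x \<ge> X" for x using that by force
  define I where "I = (LINT x|lborel. \<bar>g x\<bar>)"
  obtain n where n: "real n * e > I" using e reals_Archimedean3 by blast
  have "real n * e = (LINT x|lborel. e * indicator {X..X+real n} x)" by simp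
  also have "\<dots> \<le> I" unfolding I_def
  proof (rule integral_mono)
    show "integrable lborel (\<lambda>x. e * indicat_real {X..X + real n} x)"
      using integrable_real_indicator[of "{X..X+real n}" lborel] by (simp add: emeasure_lborel_Icc_eq)
    show "integrable lborel (\<lambda>x. \<bar>g x\<bar>)" using g by simp
    show "e * indicat_real {X..X + real n} x \<le> \<bar>g x\<bar>" for x
      using ge[of x] e by (auto split: split_indicator)
  qed
  finally show False using n by simp
qed

lemma integrable_reflect:
  fixes f :: "real \<Rightarrow> 'a::{banach, second_countable_topology}"
  shows "integrable lborel (\<lambda>x. f (- x)) \<longleftrightarrow> integrable lborel f"
  using lborel_integrable_real_affine_iff[of "-1" f 0] by simp

lemma integral_reflect:
  fixes f :: "real \<Rightarrow> 'a::{banach, second_countable_topology}"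
  shows "(LINT x|lborel. f (- x)) = (LINT x|lborel. f x)"
  using lborel_integral_real_affine[of "-1" f 0] by simp

lemma primitive_on_reflect:
  assumes "primitive_on S F \<phi>"
  shows "primitive_on {x. - x \<in> S} (\<lambda>x. F (- x)) (\<lambda>x. - \<phi> (- x))"
  unfolding primitive_on_def
proof (intro allI impI, elim conjE)
  fix a b :: real assume ab: "a \<le> b" "{a..b} \<subseteq> {x. - x \<in> S}"
  have "{-b..-a} \<subseteq> S"
  proof
    fix y assume "y \<in> {-b..-a}"
    then have "- y \<in> {a..b}" by auto
    then show "y \<in> S" using ab(2) by force
  qed
  then have P: "set_integrable lborel {-b..-a} \<phi>" "F (-a) - F (-b) = (LINT x:{-b..-a}|lborel. \<phi> x)"
    using primitive_onD[OF assms, of "-b" "-a"] ab(1) by auto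
  have e: "indicator {a..b} x *\<^sub>R \<phi> (- x) = (\<lambda>x. indicator {-b..-a} x *\<^sub>R \<phi> x) (- x)" for x
    by (auto split: split_indicator)
  have "integrable lborel (\<lambda>x. indicator {a..b} x *\<^sub>R \<phi> (- x))"
    unfolding e using P(1) by (subst integrable_reflect) (simp add: set_integrable_def)
  moreover have "(LINT x|lborel. indicator {a..b} x *\<^sub>R \<phi> (- x)) = F (-a) - F (-b)"
    unfolding e using P(2) by (subst integral_reflect) (simp add: set_lebesgue_integral_def)
  ultimately show "set_integrable lborel {a..b} (\<lambda>x. - \<phi> (- x)) \<and> F (- b) - F (- a) = (LINT x:{a..b}|lborel. - \<phi> (- x))"
    by (simp add: set_integrable_def set_lebesgue_integral_def)
qed

text \<open>The Dirac system on a half line. The product \<open>p * q\<close> is the exponential rate: \<open>q * f1 + p * f2\<close> grows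
and \<open>p * f2 - q * f1\<close> decays with it. Parametrising by the square roots \<open>p\<close>, \<open>q\<close> of the coefficients
keeps these two modes meaningful when one coefficient vanishes, that is, at the thresholds of the
essential spectrum. Smallness is required only along a sequence, which is what square integrability
gives, also when the rate is imaginary.\<close>

locale halfline_system =
  fixes p q :: complex and f1 f2 s1 s2 :: "real \<Rightarrow> complex" and \<sigma> :: "real \<Rightarrow> real"
  assumes prim1: "primitive_on {0..} f1 (\<lambda>x. p\<^sup>2 * f2 x + s1 x)"
    and prim2: "primitive_on {0..} f2 (\<lambda>x. q\<^sup>2 * f1 x + s2 x)"
    and Re_pq: "Re (p * q) \<ge> 0"
    and small: "\<And>X e. e > 0 \<Longrightarrow> \<exists>x\<ge>X. norm (f1 x) < e \<and> norm (f2 x) < e"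
    and meas[measurable]: "s1 \<in> borel_measurable borel" "s2 \<in> borel_measurable borel"
    and s1: "\<And>x. norm (s1 x) \<le> \<sigma> x" and s2: "\<And>x. norm (s2 x) \<le> \<sigma> x"
    and \<sigma>: "integrable lborel \<sigma>"
begin

text \<open>The system is symmetric in its two components, so every estimate of \<open>f1\<close> yields one of \<open>f2\<close>.\<close>

lemma swap: "halfline_system q p f2 f1 s2 s1 \<sigma>"
  using prim1 prim2 Re_pq small meas s1 s2 \<sigma> by unfold_locales (auto simp: mult.commute, blast)

lemma \<sigma>_nonneg: "0 \<le> \<sigma> x" using s1[of x] norm_ge_zero order_trans by blast

lemma \<sigma>_set: "A \<in> sets borel \<Longrightarrow> set_integrable lborel A \<sigma>"
  using \<sigma> by (intro integrable_mult_indicator set_integrable_def[THEN meta_eq_to_obj_eq, THEN iffD2]) auto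

definition tail :: "real \<Rightarrow> real" where "tail x = (LINT y:{x..}|lborel. \<sigma> y)"
definition total :: real where "total = (LINT y|lborel. \<sigma> y)"

lemma set_integral_le_total: "A \<in> sets borel \<Longrightarrow> (LINT y:A|lborel. \<sigma> y) \<le> total"
  using \<sigma>_set \<sigma> \<sigma>_nonneg unfolding total_def set_lebesgue_integral_def set_integrable_def
  by (intro integral_mono) (auto split: split_indicator)

lemma tail_le_total: "tail x \<le> total"
  unfolding tail_def by (rule set_integral_le_total) simp

lemma total_nonneg: "0 \<le> total" unfolding total_def using \<sigma>_nonneg by simp

lemma set_integrable_source:
  fixes r :: "real \<Rightarrow> complex"
  assumes [measurable]: "r \<in> borel_measurable borel" and r: "\<And>x. norm (r x) \<le> C * \<sigma> x" and A: "A \<in> sets borel"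
  shows "set_integrable lborel A r"
proof -
  have "integrable lborel r"
  proof (rule Bochner_Integration.integrable_bound)
    show "integrable lborel (\<lambda>x. C * \<sigma> x)" using \<sigma> by simp
    show "AE x in lborel. norm (r x) \<le> norm (C * \<sigma> x)"
      using r by (intro AE_I2) (metis abs_ge_self order_trans real_norm_def)
  qed simp
  then show ?thesis using A unfolding set_integrable_def by (intro integrable_mult_indicator) auto
qed

lemma set_integral_source_le:
  fixes r :: "real \<Rightarrow> complex"
  assumes [measurable]: "r \<in> borel_measurable borel" and r: "\<And>x. norm (r x) \<le> C * \<sigma> x" and A: "A \<in> sets borel"
  shows "(LINT t:A|lborel. norm (r t)) \<le> C * (LINT t:A|lborel. \<sigma> t)"
proof -
  have "(LINT t:A|lborel. norm (r t)) \<le> (LINT t:A|lborel. C * \<sigma> t)"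
    by (rule set_integral_mono[OF set_integrable_norm[OF set_integrable_source[OF assms]]])
       (use r \<sigma>_set[OF A] in auto)
  then show ?thesis by simp
qed

text \<open>Since the growing mode must not be excited at infinity, it is determined by the source to the right
of \<open>x\<close>. This is the boundary condition that square integrability imposes.\<close>

lemma growing_component:
  assumes x: "x \<ge> 0"
  shows "norm (q * f1 x + p * f2 x) \<le> (norm p + norm q) * tail x"
proof (rule field_le_epsilon)
  fix e :: real assume e: "e > 0"
  define \<delta> where "\<delta> = e / (norm p + norm q + 1)"
  have pos: "norm p + norm q + 1 > 0" by (smt (verit) norm_ge_zero)
  have \<delta>: "\<delta> > 0" using e pos by (simp add: \<delta>_def)
  \<comment> \<open>The growing mode is integrated backwards from a far point at which the solution is small.\<close>
  obtain y where y: "y \<ge> x" "norm (f1 y) < \<delta>" "norm (f2 y) < \<delta>" using small[OF \<delta>] by blast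
  define r where "r = (\<lambda>t. q * s1 t + p * s2 t)"
  have [measurable]: "r \<in> borel_measurable borel" by (simp add: r_def)
  have rb: "norm (r t) \<le> (norm p + norm q) * \<sigma> t" for t
  proof -
    have "norm (r t) \<le> norm q * norm (s1 t) + norm p * norm (s2 t)"
      unfolding r_def by (rule order_trans[OF norm_triangle_ineq]) (simp add: norm_mult)
    also have "\<dots> \<le> norm q * \<sigma> t + norm p * \<sigma> t" using s1 s2 by (intro add_mono mult_left_mono) auto
    finally show ?thesis by (simp add: algebra_simps)
  qed
  have sub: "{x..y} \<subseteq> {0..}" using x by auto
  have "primitive_on {0..} (\<lambda>t. q * f1 t + p * f2 t) (\<lambda>t. q * (p\<^sup>2 * f2 t + s1 t) + p * (q\<^sup>2 * f1 t + s2 t))"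
    by (intro primitive_on_add primitive_on_cmult prim1 prim2)
  then have "primitive_on {x..y} (\<lambda>t. q * f1 t + p * f2 t) (\<lambda>t. (p * q) * (q * f1 t + p * f2 t) + r t)"
    by (rule primitive_on_cong[OF primitive_on_subset[OF _ sub]]) (auto simp: r_def algebra_simps power2_eq_square)
  from growing_bound[OF this y(1) set_integrable_source[OF _ rb] Re_pq]
  have "norm (q * f1 x + p * f2 x) \<le> norm (q * f1 y + p * f2 y) + (LINT t:{x..y}|lborel. norm (r t))" by simp
  also have "norm (q * f1 y + p * f2 y) \<le> norm q * norm (f1 y) + norm p * norm (f2 y)"
    by (rule order_trans[OF norm_triangle_ineq]) (simp add: norm_mult)
  also have "\<dots> \<le> norm q * \<delta> + norm p * \<delta>" using y by (intro add_mono mult_left_mono) auto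
  also have "\<dots> \<le> (norm p + norm q + 1) * \<delta>" using \<delta> by (simp add: algebra_simps)
  also have "\<dots> = e" using pos by (simp add: \<delta>_def)
  also have "(LINT t:{x..y}|lborel. norm (r t)) \<le> (norm p + norm q) * (LINT t:{x..y}|lborel. \<sigma> t)"
    by (rule set_integral_source_le) (use rb in auto)
  also have "\<dots> \<le> (norm p + norm q) * tail x"
  proof (intro mult_left_mono)
    show "(LINT t:{x..y}|lborel. \<sigma> t) \<le> tail x"
      using \<sigma>_set[of "{x..y}"] \<sigma>_set[of "{x..}"] \<sigma>_nonneg unfolding tail_def set_lebesgue_integral_def set_integrable_def
      by (intro integral_mono) (auto split: split_indicator)
  qed auto
  finally show "norm (q * f1 x + p * f2 x) \<le> (norm p + norm q) * tail x + e" by simp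
qed

lemma boundary_bound: "norm (q * f1 0 + p * f2 0) \<le> (norm p + norm q) * total"
  using growing_component[of 0] mult_left_mono[OF tail_le_total[of 0], of "norm p + norm q"] by simp

text \<open>Here \<open>f1\<close> is recovered by subtracting the decaying from the growing mode, at the price of the factor
\<open>q\<close> on the left-hand side: useful away from the thresholds.\<close>

lemma unweighted_bound:
  assumes x: "x \<ge> 0"
  shows "2 * norm q * norm (f1 x) \<le> 2 * (norm p + norm q) * total + norm p * norm (f2 0) + norm q * norm (f1 0)"
proof -
  define r where "r = (\<lambda>t. p * s2 t - q * s1 t)"
  have [measurable]: "r \<in> borel_measurable borel" by (simp add: r_def)
  have rb: "norm (r t) \<le> (norm p + norm q) * \<sigma> t" for t
  proof -
    have "norm (r t) \<le> norm p * norm (s2 t) + norm q * norm (s1 t)"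
      unfolding r_def by (rule order_trans[OF norm_triangle_ineq4]) (simp add: norm_mult)
    also have "\<dots> \<le> norm p * \<sigma> t + norm q * \<sigma> t" using s1 s2 by (intro add_mono mult_left_mono) auto
    finally show ?thesis by (simp add: algebra_simps)
  qed
  have "primitive_on {0..} (\<lambda>t. p * f2 t - q * f1 t) (\<lambda>t. p * (q\<^sup>2 * f1 t + s2 t) - q * (p\<^sup>2 * f2 t + s1 t))"
    by (intro primitive_on_diff primitive_on_cmult prim1 prim2)
  then have "primitive_on {0..x} (\<lambda>t. p * f2 t - q * f1 t) (\<lambda>t. - (p * q) * (p * f2 t - q * f1 t) + r t)"
    by (rule primitive_on_cong[OF primitive_on_subset]) (auto simp: r_def algebra_simps power2_eq_square)
  from decaying_bound[OF this x set_integrable_source[OF _ rb]] Re_pq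
  have "norm (p * f2 x - q * f1 x) \<le> norm (p * f2 0 - q * f1 0) + (LINT t:{0..x}|lborel. norm (r t))" by simp
  also have "(LINT t:{0..x}|lborel. norm (r t)) \<le> (norm p + norm q) * (LINT t:{0..x}|lborel. \<sigma> t)"
    by (rule set_integral_source_le) (use rb in auto)
  also have "\<dots> \<le> (norm p + norm q) * total" by (intro mult_left_mono set_integral_le_total) auto
  also have "norm (p * f2 0 - q * f1 0) \<le> norm p * norm (f2 0) + norm q * norm (f1 0)"
    by (rule order_trans[OF norm_triangle_ineq4]) (simp add: norm_mult)
  finally have v: "norm (p * f2 x - q * f1 x) \<le> norm p * norm (f2 0) + norm q * norm (f1 0) + (norm p + norm q) * total" by simp
  have h: "norm (q * f1 x + p * f2 x) \<le> (norm p + norm q) * total"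
    using growing_component[OF x] mult_left_mono[OF tail_le_total[of x], of "norm p + norm q"] by simp
  have "2 * norm q * norm (f1 x) = norm ((q * f1 x + p * f2 x) - (p * f2 x - q * f1 x))"
    by (simp add: norm_mult)
  also have "\<dots> \<le> norm (q * f1 x + p * f2 x) + norm (p * f2 x - q * f1 x)" by (rule norm_triangle_ineq4)
  finally show ?thesis using v h by (simp add: algebra_simps)
qed

text \<open>The layer-cake identity for the first moment of \<open>\<sigma>\<close>, obtained by differentiating \<open>t * tail t\<close>.\<close>

lemma tail_integral_le:
  assumes w: "integrable lborel (\<lambda>y. \<bar>y\<bar> * \<sigma> y)" and x: "x \<ge> 0"
  shows "set_integrable lborel {0..x} tail" "(LINT t:{0..x}|lborel. tail t) \<le> (LINT y|lborel. \<bar>y\<bar> * \<sigma> y)"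
proof -
  have comb: "tail a = (LINT y:{a..b}|lborel. \<sigma> y) + tail b" if "a \<le> b" for a b
  proof -
    have un: "{a..} = {a..b} \<union> {b..}" using that by auto
    have "AE y in lborel. \<not> (y \<in> {a..b} \<and> y \<in> {b..})"
      using AE_lborel_singleton[of b] by eventually_elim auto
    from set_integral_Un_AE[OF this _ _ \<sigma>_set \<sigma>_set] show ?thesis by (simp add: tail_def un)
  qed
  have P: "primitive_on {0..x} (\<lambda>t. of_real (tail t)) (\<lambda>t. - of_real (\<sigma> t))"
    unfolding primitive_on_def
  proof (intro allI impI, elim conjE)
    fix a b :: real assume ab: "a \<le> b"
    have "set_integrable lborel {a..b} (\<lambda>t. complex_of_real (\<sigma> t))"
      using integrable_of_real[OF \<sigma>_set[of "{a..b}", unfolded set_integrable_def], where 'a = complex]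
      by (simp add: set_integrable_def scaleR_conv_of_real)
    then show "set_integrable lborel {a..b} (\<lambda>t. - complex_of_real (\<sigma> t)) \<and> complex_of_real (tail b) - complex_of_real (tail a) = (CLBINT t:{a..b}. - complex_of_real (\<sigma> t))"
      using comb[OF ab] set_integral_complex_of_real[of lborel "{a..b}" \<sigma>]
      by (simp add: set_integrable_def set_lebesgue_integral_def)
  qed
  have "continuous_on {0..x} (\<lambda>t. complex_of_real (tail t))" by (rule primitive_on_continuous[OF P x])
  then have "continuous_on {0..x} (\<lambda>t. Re (complex_of_real (tail t)))" by (rule continuous_on_Re)
  then have ct: "continuous_on {0..x} tail" by simp
  show It: "set_integrable lborel {0..x} tail" by (rule integrable_lborel_continuous[OF ct])
  have "primitive_on {0..x} (\<lambda>t. of_real t * of_real (tail t)) (\<lambda>t. of_real t * (- of_real (\<sigma> t)) + 1 * of_real (tail t))"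
    by (rule primitive_on_product[OF P]) (auto intro!: derivative_eq_intros)
  from primitive_onD(2)[OF this x order_refl]
  have "of_real (x * tail x) = (CLBINT t:{0..x}. complex_of_real (tail t - t * \<sigma> t))" by simp
  then have e: "x * tail x = (LINT t:{0..x}|lborel. tail t - t * \<sigma> t)"
    by (simp only: set_integral_complex_of_real of_real_eq_iff)
  have ws: "set_integrable lborel A (\<lambda>y. \<bar>y\<bar> * \<sigma> y)" if "A \<in> sets borel" for A
    using w that by (intro integrable_mult_indicator set_integrable_def[THEN meta_eq_to_obj_eq, THEN iffD2]) auto
  have wsx: "set_integrable lborel {0..x} (\<lambda>y. y * \<sigma> y)"
  proof -
    have eq: "(\<lambda>y. indicator {0..x} y *\<^sub>R (\<bar>y\<bar> * \<sigma> y)) = (\<lambda>y. indicator {0..x} y *\<^sub>R (y * \<sigma> y))"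
      by (intro ext) (auto split: split_indicator)
    show ?thesis using ws[of "{0..x}", unfolded set_integrable_def eq] by (simp add: set_integrable_def)
  qed
  have "(LINT t:{0..x}|lborel. tail t) = x * tail x + (LINT t:{0..x}|lborel. t * \<sigma> t)"
    using e set_integral_diff(2)[OF It wsx] by simp
  also have "(LINT t:{0..x}|lborel. t * \<sigma> t) = (LINT t:{0..x}|lborel. \<bar>t\<bar> * \<sigma> t)"
    unfolding set_lebesgue_integral_def by (intro Bochner_Integration.integral_cong) (auto split: split_indicator)
  also have "x * tail x = (LINT t:{x..}|lborel. x * \<sigma> t)" by (simp add: tail_def)
  also have "\<dots> \<le> (LINT t:{x..}|lborel. \<bar>t\<bar> * \<sigma> t)"
    by (rule set_integral_mono) (use \<sigma>_set[of "{x..}"] ws[of "{x..}"] x \<sigma>_nonneg in \<open>auto intro!: mult_right_mono\<close>)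
  also have "(LINT t:{x..}|lborel. \<bar>t\<bar> * \<sigma> t) + (LINT t:{0..x}|lborel. \<bar>t\<bar> * \<sigma> t)
      = (LINT t:{0..x} \<union> {x..}|lborel. \<bar>t\<bar> * \<sigma> t)"
  proof -
    have "AE y in lborel. \<not> (y \<in> {0..x} \<and> y \<in> {x..})"
      using AE_lborel_singleton[of x] by eventually_elim auto
    from set_integral_Un_AE[OF this _ _ ws ws] show ?thesis by simp
  qed
  also have "\<dots> \<le> (LINT y|lborel. \<bar>y\<bar> * \<sigma> y)"
    using ws[of "{0..x} \<union> {x..}"] w \<sigma>_nonneg unfolding set_lebesgue_integral_def set_integrable_def
    by (intro integral_mono) (auto split: split_indicator)
  finally show "(LINT t:{0..x}|lborel. tail t) \<le> (LINT y|lborel. \<bar>y\<bar> * \<sigma> y)" by simp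
qed

text \<open>This bound does not divide by \<open>p\<close> or \<open>q\<close> and is uniform up to the thresholds. The price is the first
moment of the source, which reflects the linear growth of one solution at a threshold.\<close>

lemma weighted_bound:
  assumes w: "integrable lborel (\<lambda>y. \<bar>y\<bar> * \<sigma> y)" and x: "x \<ge> 0"
  shows "norm (f1 x) \<le> norm (f1 0) + total + norm p * (norm p + norm q) * (LINT y|lborel. \<bar>y\<bar> * \<sigma> y)"
proof -
  define C where "C = norm p * (norm p + norm q)"
  have C: "C \<ge> 0" by (simp add: C_def)
  \<comment> \<open>Adding \<open>p * q * f1\<close> to the equation of \<open>f1\<close> leaves a multiple of the growing component, already bounded by the tail of \<open>\<sigma>\<close>.\<close>
  define r where "r = (\<lambda>t. p * (q * f1 t + p * f2 t) + s1 t)"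
  have "primitive_on {0..x} f1 (\<lambda>t. - (p * q) * f1 t + r t)"
    by (rule primitive_on_cong[OF primitive_on_subset[OF prim1]]) (auto simp: r_def algebra_simps power2_eq_square)
  moreover have Ir: "set_integrable lborel {0..x} r"
  proof -
    have c: "continuous_on {0..x} f1" "continuous_on {0..x} f2"
      using primitive_on_continuous[OF primitive_on_subset[OF prim1] x] primitive_on_continuous[OF primitive_on_subset[OF prim2] x] by auto
    show ?thesis unfolding r_def
      by (intro set_integral_add integrable_lborel_continuous continuous_intros c set_integrable_source[where C = 1]) (use s1 in auto)
  qed
  ultimately have "norm (f1 x) \<le> norm (f1 0) + (LINT t:{0..x}|lborel. norm (r t))"
    using decaying_bound[OF _ x] Re_pq by (metis minus_complex.simps(1) neg_le_0_iff_le uminus_complex.simps(1))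
  also have "(LINT t:{0..x}|lborel. norm (r t)) \<le> (LINT t:{0..x}|lborel. C * tail t + \<sigma> t)"
  proof (rule set_integral_mono[OF set_integrable_norm[OF Ir]])
    show "set_integrable lborel {0..x} (\<lambda>t. C * tail t + \<sigma> t)"
      using tail_integral_le(1)[OF w x] \<sigma>_set[of "{0..x}"] by (intro set_integral_add) auto
    fix t assume t: "t \<in> {0..x}"
    have "norm (r t) \<le> norm p * norm (q * f1 t + p * f2 t) + norm (s1 t)"
      unfolding r_def by (rule order_trans[OF norm_triangle_ineq]) (simp add: norm_mult)
    also have "\<dots> \<le> norm p * ((norm p + norm q) * tail t) + \<sigma> t"
      using growing_component[of t] t s1 by (intro add_mono mult_left_mono) auto
    finally show "norm (r t) \<le> C * tail t + \<sigma> t" by (simp add: C_def mult.assoc)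
  qed
  also have "\<dots> = C * (LINT t:{0..x}|lborel. tail t) + (LINT t:{0..x}|lborel. \<sigma> t)"
    using tail_integral_le(1)[OF w x] \<sigma>_set[of "{0..x}"] by (subst set_integral_add(2)) auto
  also have "\<dots> \<le> C * (LINT y|lborel. \<bar>y\<bar> * \<sigma> y) + total"
    by (intro add_mono mult_left_mono tail_integral_le(2)[OF w x] set_integral_le_total C) auto
  finally show ?thesis by (simp add: C_def)
qed

end

section \<open>A priori estimates on the line\<close>

lemma Im_csqrt_sgn: "Im z > 0 \<Longrightarrow> Im (csqrt z) > 0" "Im z < 0 \<Longrightarrow> Im (csqrt z) < 0"
proof -
  have "cmod z > \<bar>Re z\<bar>" if "Im z \<noteq> 0"
  proof -
    have "(Re z)\<^sup>2 < (cmod z)\<^sup>2" using that by (simp add: cmod_power2)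
    then show ?thesis by (metis abs_norm_cancel abs_le_square_iff linorder_not_less)
  qed
  then have "Im z \<noteq> 0 \<Longrightarrow> cmod z - Re z > 0 \<and> cmod z + Re z > 0" by (smt (verit))
  then show "Im z > 0 \<Longrightarrow> Im (csqrt z) > 0" "Im z < 0 \<Longrightarrow> Im (csqrt z) < 0"
    by (auto simp: mult_neg_pos)
qed

lemma norm_csqrt: "norm (csqrt z) = sqrt (norm z)"
proof -
  have "(norm (csqrt z))\<^sup>2 = norm z" by (simp only: norm_power[symmetric] power2_csqrt)
  then show ?thesis by (metis norm_ge_zero real_sqrt_unique)
qed

text \<open>The principal roots of \<open>m + \<zeta>\<close> and \<open>m - \<zeta>\<close> lie in the right half plane, on opposite sides of the real
axis, so their product is again in the right half plane.\<close>

lemma Re_csqrt_mult_nonneg: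
  assumes m: "m > 0"
  shows "Re (csqrt (of_real m + \<zeta>) * csqrt (of_real m - \<zeta>)) \<ge> 0"
proof -
  have "Im (csqrt (of_real m + \<zeta>)) * Im (csqrt (of_real m - \<zeta>)) \<le> 0"
  proof (cases "Im \<zeta> = 0")
    case True
    then have "Re (of_real m + \<zeta>) \<ge> 0 \<or> Re (of_real m - \<zeta>) \<ge> 0" using m by auto
    then have "Im (csqrt (of_real m + \<zeta>)) = 0 \<or> Im (csqrt (of_real m - \<zeta>)) = 0"
      using True by (auto simp del: csqrt.simps)
    then show ?thesis by auto
  next
    case False
    then consider "Im \<zeta> > 0" | "Im \<zeta> < 0" by linarith
    then show ?thesis
    proof cases
      case 1 then show ?thesis
        using Im_csqrt_sgn(1)[of "of_real m + \<zeta>"] Im_csqrt_sgn(2)[of "of_real m - \<zeta>"]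
        by (simp add: mult_nonneg_nonpos del: csqrt.simps)
    next
      case 2 then show ?thesis
        using Im_csqrt_sgn(2)[of "of_real m + \<zeta>"] Im_csqrt_sgn(1)[of "of_real m - \<zeta>"]
        by (simp add: mult_nonpos_nonneg del: csqrt.simps)
    qed
  qed
  then show ?thesis using mult_nonneg_nonneg[OF Re_csqrt Re_csqrt] by (smt (verit) times_complex.simps(1))
qed

text \<open>The determinant, at the origin, of the decaying solution on the right and the decaying solution on
the left. On the right the spectral parameter is shifted to \<open>z - \<i>\<close>, on the left to \<open>z + \<i>\<close>.\<close>

definition wronskian :: "real \<Rightarrow> complex \<Rightarrow> complex" where
  "wronskian m z = csqrt (of_real m + (z - \<i>)) * csqrt (of_real m - (z + \<i>))
     + csqrt (of_real m - (z - \<i>)) * csqrt (of_real m + (z + \<i>))"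

lemma norm_csqrt_le:
  assumes "norm w \<le> norm z + 1" "m > 0"
  shows "norm (csqrt (of_real m + w)) \<le> sqrt (m + 1 + norm z)" "norm (csqrt (of_real m - w)) \<le> sqrt (m + 1 + norm z)"
proof -
  have "norm (of_real m + w) \<le> m + norm w" "norm (of_real m - w) \<le> m + norm w"
    using norm_triangle_ineq[of "of_real m" w] norm_triangle_ineq4[of "of_real m" w] assms(2) by auto
  then show "norm (csqrt (of_real m + w)) \<le> sqrt (m + 1 + norm z)" "norm (csqrt (of_real m - w)) \<le> sqrt (m + 1 + norm z)"
    using assms(1) by (auto simp: norm_csqrt)
qed

lemma norm_shift_le: "norm (z - \<i>) \<le> norm z + 1" "norm (z + \<i>) \<le> norm z + 1"
  using norm_triangle_ineq4[of z \<i>] norm_triangle_ineq[of z \<i>] by auto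

text \<open>With \<open>x\<close> and \<open>y\<close> the two summands, \<open>x\<^sup>2 - y\<^sup>2 = - 4 m \<i>\<close> does not depend on \<open>z\<close>, and \<open>x - y\<close> is at
most of order \<open>1 + norm z\<close>; so \<open>x + y\<close> is at least of order \<open>1 / (1 + norm z)\<close>. It is here that \<open>m > 0\<close> rules out
eigenvalues of the free operator, and that the square root in the theorem originates.\<close>

lemma wronskian_lower_bound:
  assumes m: "m > 0"
  shows "2 * m \<le> norm (wronskian m z) * (m + 1 + norm z)"
proof -
  define \<rho> where "\<rho> = sqrt (m + 1 + norm z)"
  have \<rho>: "\<rho> \<ge> 0" "\<rho> * \<rho> = m + 1 + norm z" using m by (auto simp: \<rho>_def add_nonneg_nonneg)
  define x y where "x = csqrt (of_real m + (z - \<i>)) * csqrt (of_real m - (z + \<i>))"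
    and "y = csqrt (of_real m - (z - \<i>)) * csqrt (of_real m + (z + \<i>))"
  have "x\<^sup>2 - y\<^sup>2 = - 4 * of_real m * \<i>"
    by (simp add: x_def y_def power_mult_distrib algebra_simps)
  then have "(x + y) * (x - y) = - 4 * of_real m * \<i>" by (simp add: power2_eq_square algebra_simps)
  then have "norm ((x + y) * (x - y)) = norm (- 4 * of_real m * \<i>)" by (rule arg_cong)
  then have e: "norm (x + y) * norm (x - y) = 4 * m" using m by (simp add: norm_mult)
  have "norm x \<le> \<rho> * \<rho>" "norm y \<le> \<rho> * \<rho>"
    unfolding x_def y_def norm_mult \<rho>_def
    by (intro mult_mono norm_csqrt_le[OF norm_shift_le(1) m] norm_csqrt_le[OF norm_shift_le(2) m]; use m in simp)+
  then have "norm (x - y) \<le> 2 * (m + 1 + norm z)"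
    using norm_triangle_ineq4[of x y] unfolding \<rho>(2)[symmetric] by linarith
  then have "norm (x + y) * norm (x - y) \<le> norm (x + y) * (2 * (m + 1 + norm z))"
    by (rule mult_left_mono) simp
  moreover define k where "k = norm (x + y) * (m + 1 + norm z)"
  ultimately have "4 * m \<le> 2 * k" unfolding e mult.left_commute[of "norm (x + y)" 2] by simp
  then have "2 * m \<le> k" by simp
  then show ?thesis by (simp only: k_def wronskian_def x_def y_def)
qed

lemma norm_csqrt_far:
  assumes z: "norm z \<ge> 12 * (m + 1)" and m: "m > 0" and w: "w = z - \<i> \<or> w = z + \<i>" and r: "r = of_real m + w \<or> r = of_real m - w"
  shows "11/12 * norm z \<le> (norm (csqrt r))\<^sup>2" "(norm (csqrt r))\<^sup>2 \<le> 13/12 * norm z" "norm (csqrt r) > 0"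
proof -
  have "norm z - 1 \<le> norm w" "norm w \<le> norm z + 1"
    using w norm_triangle_ineq2[of z \<i>] norm_triangle_ineq2[of z "-\<i>"] norm_shift_le[of z] by auto
  moreover have "norm w - m \<le> norm r" "norm r \<le> norm w + m"
    using r m norm_triangle_ineq2[of w "- of_real m"] norm_triangle_ineq2[of w "of_real m"]
      norm_triangle_ineq[of w "of_real m"] norm_triangle_ineq4[of w "of_real m"]
    by (auto simp: add.commute norm_minus_commute)
  ultimately have b: "11/12 * norm z \<le> norm r" "norm r \<le> 13/12 * norm z" using z by auto
  then show "11/12 * norm z \<le> (norm (csqrt r))\<^sup>2" "(norm (csqrt r))\<^sup>2 \<le> 13/12 * norm z"
    by (auto simp: norm_csqrt)
  have "norm z > 0" by (rule less_le_trans[OF _ z]) (use m in simp)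
  then show "norm (csqrt r) > 0" using b(1) by (auto simp: norm_csqrt)
qed

text \<open>For large \<open>\<zeta>\<close> the root of \<open>m - \<zeta>\<close> is close to \<open>\<plusminus> \<i>\<close> times the root of \<open>m + \<zeta>\<close>. The identity
\<open>(q + \<iota> p) (q - \<iota> p) = p\<^sup>2 + q\<^sup>2 = 2 m\<close> makes this quantitative once the other factor is known to be large.\<close>

lemma quadrant_approx:
  assumes j: "\<iota> = \<i> \<or> \<iota> = - \<i>" and pq: "p\<^sup>2 + q\<^sup>2 = of_real (2 * m)" and m: "m > 0" and p0: "p \<noteq> 0"
    and quad: "norm p \<le> norm (q - \<iota> * p)"
  shows "norm (q + \<iota> * p) \<le> 2 * m / norm p"
proof -
  have "(q + \<iota> * p) * (q - \<iota> * p) = p\<^sup>2 + q\<^sup>2"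
    using j by (auto simp: algebra_simps power2_eq_square)
  then have "norm (q + \<iota> * p) * norm (q - \<iota> * p) = 2 * m"
    using m unfolding pq norm_mult[symmetric] by simp
  moreover have "norm (q + \<iota> * p) * norm p \<le> norm (q + \<iota> * p) * norm (q - \<iota> * p)"
    by (rule mult_left_mono[OF quad]) simp
  ultimately show ?thesis using p0 by (simp add: field_simps)
qed

text \<open>The two numbers \<open>q\<close> and \<open>- \<i> p\<close> (or \<open>\<i> p\<close>) lie in the same quadrant, so their sum is no shorter than
either.\<close>

lemma quadrant_separated:
  assumes "Re p \<ge> 0" "Re q \<ge> 0"
  shows "Im p \<ge> 0 \<Longrightarrow> Im q \<le> 0 \<Longrightarrow> norm p \<le> norm (q - \<i> * p)"
    and "Im p \<le> 0 \<Longrightarrow> Im q \<ge> 0 \<Longrightarrow> norm p \<le> norm (q + \<i> * p)"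
proof -
  show "norm p \<le> norm (q - \<i> * p)" if "Im p \<ge> 0" "Im q \<le> 0"
  proof -
    have "\<bar>Im p\<bar> \<le> \<bar>Re q + Im p\<bar>" "\<bar>Re p\<bar> \<le> \<bar>Im q - Re p\<bar>" using that assms by auto
    then have "(Im p)\<^sup>2 + (Re p)\<^sup>2 \<le> (Re q + Im p)\<^sup>2 + (Im q - Re p)\<^sup>2" by (intro add_mono) (simp_all add: abs_le_square_iff)
    then show ?thesis by (simp add: cmod_def add.commute)
  qed
  show "norm p \<le> norm (q + \<i> * p)" if "Im p \<le> 0" "Im q \<ge> 0"
  proof -
    have "\<bar>Im p\<bar> \<le> \<bar>Re q - Im p\<bar>" "\<bar>Re p\<bar> \<le> \<bar>Im q + Re p\<bar>" using that assms by auto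
    then have "(Im p)\<^sup>2 + (Re p)\<^sup>2 \<le> (Re q - Im p)\<^sup>2 + (Im q + Re p)\<^sup>2" by (intro add_mono) (simp_all add: abs_le_square_iff)
    then show ?thesis by (simp add: cmod_def add.commute)
  qed
qed

text \<open>Outside the strip \<open>z - \<i>\<close> and \<open>z + \<i>\<close> lie in the same half plane, so both roots are approximated with
the same sign and the Wronskian is close to \<open>\<plusminus> 2 \<i>\<close> times the product of the two roots of \<open>m + \<zeta>\<close>.
Inside the strip the signs differ and the leading terms cancel.\<close>

lemma wronskian_outside_strip:
  assumes m: "m > 0" and z: "norm z \<ge> 12 * (m + 1)" and im: "\<bar>Im z\<bar> > 1"
  shows "2/3 * norm z \<le> norm (wronskian m z)"
proof -
  define p q p' q' where "p = csqrt (of_real m + (z - \<i>))" and "q = csqrt (of_real m - (z - \<i>))"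
    and "p' = csqrt (of_real m + (z + \<i>))" and "q' = csqrt (of_real m - (z + \<i>))"
  have re: "Re p \<ge> 0" "Re q \<ge> 0" "Re p' \<ge> 0" "Re q' \<ge> 0"
    unfolding p_def q_def p'_def q'_def by (simp_all del: csqrt.simps add: Re_csqrt)
  obtain \<iota> where \<iota>: "\<iota> = \<i> \<or> \<iota> = - \<i>" and qd: "norm p \<le> norm (q - \<iota> * p)" "norm p' \<le> norm (q' - \<iota> * p')"
  proof (cases "Im z > 1")
    case True
    then have "Im p > 0" "Im q < 0" "Im p' > 0" "Im q' < 0"
      unfolding p_def q_def p'_def q'_def by (auto intro!: Im_csqrt_sgn simp del: csqrt.simps)
    then show ?thesis using quadrant_separated(1)[OF re(1,2)] quadrant_separated(1)[OF re(3,4)] that[of \<i>] by auto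
  next
    case False
    then have "Im z < - 1" using im by auto
    then have "Im p < 0" "Im q > 0" "Im p' < 0" "Im q' > 0"
      unfolding p_def q_def p'_def q'_def by (auto intro!: Im_csqrt_sgn simp del: csqrt.simps)
    then show ?thesis using quadrant_separated(2)[OF re(1,2)] quadrant_separated(2)[OF re(3,4)] that[of "-\<i>"] by auto
  qed
  have P: "11/12 * norm z \<le> (norm p)\<^sup>2" "(norm p)\<^sup>2 \<le> 13/12 * norm z" "norm p > 0"
    unfolding p_def using norm_csqrt_far[OF z m, of "z - \<i>" "of_real m + (z - \<i>)"] by auto
  have P': "11/12 * norm z \<le> (norm p')\<^sup>2" "(norm p')\<^sup>2 \<le> 13/12 * norm z" "norm p' > 0"
    unfolding p'_def using norm_csqrt_far[OF z m, of "z + \<i>" "of_real m + (z + \<i>)"] by auto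
  define e e' where "e = q + \<iota> * p" and "e' = q' + \<iota> * p'"
  have "p\<^sup>2 + q\<^sup>2 = of_real (2 * m)" "p'\<^sup>2 + q'\<^sup>2 = of_real (2 * m)"
    by (simp_all add: p_def q_def p'_def q'_def)
  then have E: "norm e \<le> 2 * m / norm p" "norm e' \<le> 2 * m / norm p'"
    unfolding e_def e'_def using quadrant_approx[OF \<iota> _ m] qd P(3) P'(3) by auto
  have ratio: "norm p \<le> 2 * norm p'" "norm p' \<le> 2 * norm p"
  proof -
    have "norm z \<ge> 0" by simp
    then have "(norm p)\<^sup>2 \<le> (2 * norm p')\<^sup>2" "(norm p')\<^sup>2 \<le> (2 * norm p)\<^sup>2"
      using P P' unfolding power_mult_distrib by auto
    then show "norm p \<le> 2 * norm p'" "norm p' \<le> 2 * norm p" by (auto intro: power2_le_imp_le)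
  qed
  have t1: "norm (p * e') \<le> 4 * m"
  proof -
    have "norm (p * e') \<le> norm p * (2 * m / norm p')" unfolding norm_mult by (rule mult_left_mono[OF E(2)]) simp
    also have "\<dots> \<le> (2 * norm p') * (2 * m / norm p')" by (rule mult_right_mono[OF ratio(1)]) (use m in simp)
    also have "\<dots> = 4 * m" using P'(3) by simp
    finally show ?thesis .
  qed
  have t2: "norm (p' * e) \<le> 4 * m"
  proof -
    have "norm (p' * e) \<le> norm p' * (2 * m / norm p)" unfolding norm_mult by (rule mult_left_mono[OF E(1)]) simp
    also have "\<dots> \<le> (2 * norm p) * (2 * m / norm p)" by (rule mult_right_mono[OF ratio(2)]) (use m in simp)
    also have "\<dots> = 4 * m" using P(3) by simp
    finally show ?thesis .
  qed
  have pp: "11/12 * norm z \<le> norm p * norm p'"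
  proof -
    have "(11/12 * norm z) * (11/12 * norm z) \<le> (norm p)\<^sup>2 * (norm p')\<^sup>2" by (rule mult_mono[OF P(1) P'(1)]) auto
    then have "(11/12 * norm z)\<^sup>2 \<le> (norm p * norm p')\<^sup>2" by (simp add: power_mult_distrib power2_eq_square mult_ac)
    then show ?thesis by (rule power2_le_imp_le) simp
  qed
  have W: "wronskian m z = (p * e' + p' * e) - 2 * \<iota> * (p * p')"
    unfolding wronskian_def e_def e'_def p_def q_def p'_def q'_def by (simp add: algebra_simps)
  have "norm (2 * \<iota> * (p * p')) = 2 * (norm p * norm p')" using \<iota> by (auto simp: norm_mult)
  moreover have "norm (2 * \<iota> * (p * p')) - norm (p * e' + p' * e) \<le> norm (wronskian m z)"
    unfolding W by (metis norm_minus_commute norm_triangle_ineq2)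
  moreover have "norm (p * e' + p' * e) \<le> 8 * m" using norm_triangle_ineq[of "p * e'" "p' * e"] t1 t2 by linarith
  moreover have "12 * m + 12 \<le> norm z" using z by simp
  ultimately show ?thesis using pp m by linarith
qed

text \<open>A square integrable solution of the inhomogeneous Dirac system on the line with spectral parameter
\<open>z\<close>. Since \<open>z\<close> ranges over the whole plane, the estimates also exclude eigenvalues embedded in the
essential spectrum.\<close>

locale line_system =
  fixes m :: real and z :: complex and F1 F2 s1 s2 :: "real \<Rightarrow> complex" and \<sigma> :: "real \<Rightarrow> real"
  assumes m: "m > 0"
    and right: "primitive_on {0..} F1 (\<lambda>x. (of_real m + (z - \<i>)) * F2 x + s1 x)"
      "primitive_on {0..} F2 (\<lambda>x. (of_real m - (z - \<i>)) * F1 x + s2 x)"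
    and left: "primitive_on {..0} F1 (\<lambda>x. (of_real m + (z + \<i>)) * F2 x + s1 x)"
      "primitive_on {..0} F2 (\<lambda>x. (of_real m - (z + \<i>)) * F1 x + s2 x)"
    and sq: "integrable lborel (\<lambda>x. (norm (F1 x))\<^sup>2 + (norm (F2 x))\<^sup>2)"
    and meas[measurable]: "s1 \<in> borel_measurable borel" "s2 \<in> borel_measurable borel"
    and s1: "\<And>x. norm (s1 x) \<le> \<sigma> x" and s2: "\<And>x. norm (s2 x) \<le> \<sigma> x"
    and \<sigma>: "integrable lborel \<sigma>"
begin

lemma small_right:
  assumes e: "e > 0"
  shows "\<exists>x\<ge>X. norm (F1 x) < e \<and> norm (F2 x) < e"
proof -
  obtain x where x: "x \<ge> X" "(norm (F1 x))\<^sup>2 + (norm (F2 x))\<^sup>2 < e\<^sup>2"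
    using integrable_recurs_small[OF sq, of "e\<^sup>2" X] e by auto
  then have "(norm (F1 x))\<^sup>2 < e\<^sup>2" "(norm (F2 x))\<^sup>2 < e\<^sup>2" by (smt (verit) zero_le_power2)+
  then show ?thesis using x(1) e by (meson less_imp_le power_less_imp_less_base)
qed

lemma small_left:
  assumes e: "e > 0"
  shows "\<exists>x\<ge>X. norm (F1 (- x)) < e \<and> norm (- F2 (- x)) < e"
proof -
  have "integrable lborel (\<lambda>x. (norm (F1 (- x)))\<^sup>2 + (norm (F2 (- x)))\<^sup>2)"
    using sq integrable_reflect[of "\<lambda>x. (norm (F1 x))\<^sup>2 + (norm (F2 x))\<^sup>2"] by simp
  then obtain x where x: "x \<ge> X" "(norm (F1 (- x)))\<^sup>2 + (norm (F2 (- x)))\<^sup>2 < e\<^sup>2"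
    using integrable_recurs_small[of "\<lambda>x. (norm (F1 (- x)))\<^sup>2 + (norm (F2 (- x)))\<^sup>2" "e\<^sup>2" X] e by auto
  then have "(norm (F1 (- x)))\<^sup>2 < e\<^sup>2" "(norm (F2 (- x)))\<^sup>2 < e\<^sup>2" by (smt (verit) zero_le_power2)+
  then have "norm (F1 (- x)) < e" "norm (F2 (- x)) < e" using e by (meson less_imp_le power_less_imp_less_base)+
  then show ?thesis using x(1) by auto
qed

definition "p = csqrt (of_real m + (z - \<i>))"
definition "q = csqrt (of_real m - (z - \<i>))"
definition "p' = csqrt (of_real m + (z + \<i>))"
definition "q' = csqrt (of_real m - (z + \<i>))"
definition "\<rho> = sqrt (m + 1 + norm z)"

sublocale R: halfline_system p q F1 F2 s1 s2 \<sigma>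
  using right Re_csqrt_mult_nonneg[OF m, of "z - \<i>"] s1 s2 \<sigma> small_right
  by unfold_locales (auto simp: p_def q_def simp del: csqrt.simps)

text \<open>The left half line is mapped to the right one by \<open>(F1 x, F2 x) \<mapsto> (F1 (- x), - F2 (- x))\<close>, which preserves
the form of the system.\<close>

sublocale L: halfline_system p' q' "\<lambda>x. F1 (- x)" "\<lambda>x. - F2 (- x)" "\<lambda>x. - s1 (- x)" "\<lambda>x. s2 (- x)" "\<lambda>x. \<sigma> (- x)"
proof unfold_locales
  show "primitive_on {0..} (\<lambda>x. F1 (- x)) (\<lambda>x. p'\<^sup>2 * - F2 (- x) + - s1 (- x))"
    by (rule primitive_on_cong[OF primitive_on_subset[OF primitive_on_reflect[OF left(1)]]]) (auto simp: p'_def algebra_simps)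
  have "primitive_on {0..} (\<lambda>x. (-1) * F2 (- x)) (\<lambda>x. (-1) * - ((of_real m - (z + \<i>)) * F1 (- x) + s2 (- x)))"
    by (rule primitive_on_cmult[OF primitive_on_subset[OF primitive_on_reflect[OF left(2)]]]) auto
  then show "primitive_on {0..} (\<lambda>x. - F2 (- x)) (\<lambda>x. q'\<^sup>2 * F1 (- x) + s2 (- x))"
    by (rule primitive_on_cong) (auto simp: q'_def)
  show "0 \<le> Re (p' * q')" using Re_csqrt_mult_nonneg[OF m, of "z + \<i>"] by (simp only: p'_def q'_def)
  show "integrable lborel (\<lambda>x. \<sigma> (- x))" using \<sigma> by (simp add: integrable_reflect)
qed (use s1 s2 small_left in auto)

definition "T = (LINT x|lborel. \<sigma> x)"

lemma total_eq: "R.total = T" "L.total = T"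
  by (simp_all add: R.total_def L.total_def T_def integral_reflect)

lemma roots_le: "norm p \<le> \<rho>" "norm q \<le> \<rho>" "norm p' \<le> \<rho>" "norm q' \<le> \<rho>"
  unfolding p_def q_def p'_def q'_def \<rho>_def
  using norm_csqrt_le[OF norm_shift_le(1) m] norm_csqrt_le[OF norm_shift_le(2) m] by auto

lemma \<rho>_sq: "\<rho>\<^sup>2 = m + 1 + norm z" "\<rho> \<ge> 0" using m by (simp_all add: \<rho>_def add_nonneg_nonneg)

lemma T_nonneg: "T \<ge> 0" using R.total_nonneg total_eq by simp

text \<open>Each half line prescribes one component at the origin; the two linear equations are solved by
Cramer's rule, with the Wronskian as determinant.\<close>

lemma origin_bound:
  "norm (wronskian m z) * norm (F1 0) \<le> 4 * \<rho>\<^sup>2 * T" "norm (wronskian m z) * norm (F2 0) \<le> 4 * \<rho>\<^sup>2 * T"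
proof -
  \<comment> \<open>The two growing components at the origin; Cramer's rule recovers the solution from them.\<close>
  define X Y where "X = q * F1 0 + p * F2 0" and "Y = q' * F1 0 - p' * F2 0"
  have "norm X \<le> (norm p + norm q) * T" using R.boundary_bound by (simp add: X_def total_eq)
  also have "\<dots> \<le> (2 * \<rho>) * T" using roots_le T_nonneg by (intro mult_right_mono) auto
  finally have X: "norm X \<le> 2 * \<rho> * T" .
  have "norm Y \<le> (norm p' + norm q') * T" using L.boundary_bound by (simp add: Y_def total_eq)
  also have "\<dots> \<le> (2 * \<rho>) * T" using roots_le T_nonneg by (intro mult_right_mono) auto
  finally have Y: "norm Y \<le> 2 * \<rho> * T" .
  have W: "wronskian m z = p * q' + q * p'" by (simp add: wronskian_def p_def q_def p'_def q'_def)
  have two: "norm (a * X + b * Y) \<le> 4 * \<rho>\<^sup>2 * T" if "norm a \<le> \<rho>" "norm b \<le> \<rho>" for a b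
  proof -
    have "norm (a * X + b * Y) \<le> norm a * norm X + norm b * norm Y"
      by (rule order_trans[OF norm_triangle_ineq]) (simp add: norm_mult)
    also have "\<dots> \<le> \<rho> * (2 * \<rho> * T) + \<rho> * (2 * \<rho> * T)"
      using that X Y \<rho>_sq(2) by (intro add_mono mult_mono) auto
    finally show ?thesis by (simp add: power2_eq_square mult_ac)
  qed
  have "wronskian m z * F1 0 = p' * X + p * Y" by (simp add: W X_def Y_def algebra_simps)
  then show "norm (wronskian m z) * norm (F1 0) \<le> 4 * \<rho>\<^sup>2 * T"
    using two[OF roots_le(3) roots_le(1)] by (metis norm_mult)
  have "wronskian m z * F2 0 = q' * X + (- q) * Y" by (simp add: W X_def Y_def algebra_simps)
  then show "norm (wronskian m z) * norm (F2 0) \<le> 4 * \<rho>\<^sup>2 * T"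
    using two[OF roots_le(4), of "- q"] roots_le(2) by (metis norm_mult norm_minus_cancel)
qed

lemma origin_bound_general:
  "norm (F1 0) \<le> 2 * \<rho>^4 / m * T" "norm (F2 0) \<le> 2 * \<rho>^4 / m * T"
proof -
  have gen: "x \<le> 2 * \<rho>^4 / m * T" if x: "norm (wronskian m z) * x \<le> 4 * \<rho>\<^sup>2 * T" "x \<ge> 0" for x
  proof -
    have "2 * m * x \<le> norm (wronskian m z) * (m + 1 + norm z) * x"
      using wronskian_lower_bound[OF m, of z] x(2) by (rule mult_right_mono)
    also have "\<dots> = (norm (wronskian m z) * x) * \<rho>\<^sup>2" by (simp add: \<rho>_sq)
    also have "\<dots> \<le> (4 * \<rho>\<^sup>2 * T) * \<rho>\<^sup>2" by (rule mult_right_mono[OF x(1)]) simp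
    also have "\<dots> = 4 * \<rho>^4 * T" by (simp add: power2_eq_square power4_eq_xxxx)
    finally show ?thesis using m by (simp add: field_simps)
  qed
  show "norm (F1 0) \<le> 2 * \<rho>^4 / m * T" "norm (F2 0) \<le> 2 * \<rho>^4 / m * T"
    using gen origin_bound by auto
qed

text \<open>The estimate for bounded \<open>z\<close>, uniform at the thresholds.\<close>

lemma weighted_apriori:
  assumes w: "integrable lborel (\<lambda>y. \<bar>y\<bar> * \<sigma> y)"
  shows "norm (F1 x) \<le> (2 * \<rho>^4 / m + 1) * T + 2 * \<rho>\<^sup>2 * (LINT y|lborel. \<bar>y\<bar> * \<sigma> y)"
    and "norm (F2 x) \<le> (2 * \<rho>^4 / m + 1) * T + 2 * \<rho>\<^sup>2 * (LINT y|lborel. \<bar>y\<bar> * \<sigma> y)"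
proof -
  define B where "B = (LINT y|lborel. \<bar>y\<bar> * \<sigma> y)"
  have B: "B \<ge> 0" unfolding B_def using R.\<sigma>_nonneg by simp
  have w': "integrable lborel (\<lambda>y. \<bar>y\<bar> * \<sigma> (- y))" and B': "(LINT y|lborel. \<bar>y\<bar> * \<sigma> (- y)) = B"
    using w integrable_reflect[of "\<lambda>y. \<bar>y\<bar> * \<sigma> y"] integral_reflect[of "\<lambda>y. \<bar>y\<bar> * \<sigma> y"] by (simp_all add: B_def)
  have rr: "a * (a + b) * B \<le> 2 * \<rho>\<^sup>2 * B" if "0 \<le> a" "a \<le> \<rho>" "0 \<le> b" "b \<le> \<rho>" for a b
  proof -
    have "a * (a + b) \<le> \<rho> * (2 * \<rho>)" using that by (intro mult_mono) auto
    then show ?thesis using B by (intro mult_right_mono) (auto simp: power2_eq_square)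
  qed
  have "norm (F1 x) \<le> norm (F1 0) + T + 2 * \<rho>\<^sup>2 * B" "norm (F2 x) \<le> norm (F2 0) + T + 2 * \<rho>\<^sup>2 * B"
  proof -
    interpret RS: halfline_system q p F2 F1 s2 s1 \<sigma> by (rule R.swap)
    interpret LS: halfline_system q' p' "\<lambda>x. - F2 (- x)" "\<lambda>x. F1 (- x)" "\<lambda>x. s2 (- x)" "\<lambda>x. - s1 (- x)" "\<lambda>x. \<sigma> (- x)"
      by (rule L.swap)
    have tot: "RS.total = T" "LS.total = T" by (simp_all add: RS.total_def LS.total_def T_def integral_reflect)
    show "norm (F1 x) \<le> norm (F1 0) + T + 2 * \<rho>\<^sup>2 * B"
    proof (cases "x \<ge> 0")
      case True
      then show ?thesis using R.weighted_bound[OF w True] rr[of "norm p" "norm q"] roots_le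
        by (simp add: total_eq B_def)
    next
      case False
      then show ?thesis using L.weighted_bound[OF w', of "-x"] rr[of "norm p'" "norm q'"] roots_le
        by (simp add: total_eq B')
    qed
    show "norm (F2 x) \<le> norm (F2 0) + T + 2 * \<rho>\<^sup>2 * B"
    proof (cases "x \<ge> 0")
      case True
      then show ?thesis using RS.weighted_bound[OF w True] rr[of "norm q" "norm p"] roots_le
        by (simp add: tot B_def)
    next
      case False
      then show ?thesis using LS.weighted_bound[OF w', of "-x"] rr[of "norm q'" "norm p'"] roots_le
        by (simp add: tot B')
    qed
  qed
  then show "norm (F1 x) \<le> (2 * \<rho>^4 / m + 1) * T + 2 * \<rho>\<^sup>2 * (LINT y|lborel. \<bar>y\<bar> * \<sigma> y)"
    and "norm (F2 x) \<le> (2 * \<rho>^4 / m + 1) * T + 2 * \<rho>\<^sup>2 * (LINT y|lborel. \<bar>y\<bar> * \<sigma> y)"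
    using origin_bound_general by (auto simp: B_def algebra_simps)
qed

text \<open>For large \<open>z\<close> the roots \<open>p\<close> and \<open>q\<close> have comparable size, so the unweighted half-line estimate may be
divided by \<open>q\<close>.\<close>

lemma far_apriori:
  assumes z: "norm z \<ge> 12 * (m + 1)"
  shows "norm (F1 x) \<le> 3 * T + norm (F1 0) + norm (F2 0)" "norm (F2 x) \<le> 3 * T + norm (F1 0) + norm (F2 0)"
proof -
  interpret RS: halfline_system q p F2 F1 s2 s1 \<sigma> by (rule R.swap)
  interpret LS: halfline_system q' p' "\<lambda>x. - F2 (- x)" "\<lambda>x. F1 (- x)" "\<lambda>x. s2 (- x)" "\<lambda>x. - s1 (- x)" "\<lambda>x. \<sigma> (- x)"
    by (rule L.swap)
  have tot: "RS.total = T" "LS.total = T" by (simp_all add: RS.total_def LS.total_def T_def integral_reflect)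
  have ratio: "norm (csqrt r) \<le> 2 * norm (csqrt r')" "norm (csqrt r') > 0"
    if "w = z - \<i> \<or> w = z + \<i>" "r = of_real m + w \<or> r = of_real m - w" "r' = of_real m + w \<or> r' = of_real m - w" for w r r'
  proof -
    note 1 = norm_csqrt_far[OF z m that(1,2)] and 2 = norm_csqrt_far[OF z m that(1,3)]
    have "norm z \<ge> 0" by simp
    then have "(norm (csqrt r))\<^sup>2 \<le> (2 * norm (csqrt r'))\<^sup>2" using 1 2 unfolding power_mult_distrib by auto
    then show "norm (csqrt r) \<le> 2 * norm (csqrt r')" by (auto intro: power2_le_imp_le)
    show "norm (csqrt r') > 0" by (rule 2)
  qed
  have r1: "norm p \<le> 2 * norm q" "norm q > 0" "norm q \<le> 2 * norm p" "norm p > 0"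
    using ratio[OF disjI1[OF refl] disjI1[OF refl] disjI2[OF refl], folded p_def q_def]
      ratio[OF disjI1[OF refl] disjI2[OF refl] disjI1[OF refl], folded p_def q_def] by blast+
  have r2: "norm p' \<le> 2 * norm q'" "norm q' > 0" "norm q' \<le> 2 * norm p'" "norm p' > 0"
    using ratio[OF disjI2[OF refl] disjI1[OF refl] disjI2[OF refl], folded p'_def q'_def]
      ratio[OF disjI2[OF refl] disjI2[OF refl] disjI1[OF refl], folded p'_def q'_def] by blast+
  have gen: "x \<le> 3 * T + b + c"
    if h: "2 * b1 * x \<le> 2 * (a1 + b1) * T + a1 * b + b1 * c" and a: "a1 \<le> 2 * b1" "b1 > 0" "b \<ge> 0" "c \<ge> 0" for x a1 b1 b c :: real
  proof -
    have "2 * (a1 + b1) * T \<le> (6 * b1) * T" using a T_nonneg by (intro mult_right_mono) auto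
    moreover have "a1 * b \<le> (2 * b1) * b" using a by (intro mult_right_mono) auto
    moreover have "b1 * c \<le> 2 * b1 * c" using a by simp
    ultimately have "2 * b1 * x \<le> 2 * b1 * (3 * T + b + c)" using h by (simp add: algebra_simps)
    then show ?thesis using a by simp
  qed
  show "norm (F1 x) \<le> 3 * T + norm (F1 0) + norm (F2 0)"
  proof (cases "x \<ge> 0")
    case True
    then show ?thesis using gen[OF R.unweighted_bound[OF True, unfolded total_eq] r1(1,2)] by simp
  next
    case False
    then have "- x \<ge> 0" by simp
    then show ?thesis using gen[OF L.unweighted_bound[OF \<open>- x \<ge> 0\<close>, unfolded total_eq] r2(1,2)] by simp
  qed
  show "norm (F2 x) \<le> 3 * T + norm (F1 0) + norm (F2 0)"
  proof (cases "x \<ge> 0")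
    case True
    then show ?thesis using gen[OF RS.unweighted_bound[OF True, unfolded tot] r1(3,4)] by simp
  next
    case False
    then have "- x \<ge> 0" by simp
    then show ?thesis using gen[OF LS.unweighted_bound[OF \<open>- x \<ge> 0\<close>, unfolded tot] r2(3,4)] by simp
  qed
qed

lemma origin_bound_outside:
  assumes z: "norm z \<ge> 12 * (m + 1)" and im: "\<bar>Im z\<bar> > 1"
  shows "norm (F1 0) \<le> 7 * T" "norm (F2 0) \<le> 7 * T"
proof -
  have W: "2/3 * norm z \<le> norm (wronskian m z)" by (rule wronskian_outside_strip[OF m z im])
  have pos: "norm z > 0" by (rule less_le_trans[OF _ z]) (use m in simp)
  have "x \<le> 7 * T" if x: "norm (wronskian m z) * x \<le> 4 * \<rho>\<^sup>2 * T" "x \<ge> 0" for x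
  proof -
    have "2/3 * norm z * x \<le> norm (wronskian m z) * x" using W x(2) by (rule mult_right_mono)
    also have "\<dots> \<le> 4 * \<rho>\<^sup>2 * T" by (rule x(1))
    also have "\<dots> \<le> 4 * (13/12 * norm z) * T" using z T_nonneg by (intro mult_right_mono mult_left_mono) (auto simp: \<rho>_sq)
    also have "\<dots> \<le> (2/3 * norm z) * (7 * T)" using T_nonneg pos by (simp add: mult_right_mono)
    finally show ?thesis using pos by (simp add: mult_le_cancel_left)
  qed
  then show "norm (F1 0) \<le> 7 * T" "norm (F2 0) \<le> 7 * T" using origin_bound by auto
qed

end

section \<open>The exponential kernel\<close>

lemma exp_abs_integral:
  shows "integrable lborel (\<lambda>y::real. exp (- \<bar>x - y\<bar>))" "(LINT y|lborel. exp (- \<bar>x - y\<bar>)) = 2"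
proof -
  let ?f = "\<lambda>t::real. indicator {0..} t * exp (- t)"
  have nn: "(\<integral>\<^sup>+t. ennreal (?f t) \<partial>lborel) = 1"
  proof -
    have "(\<integral>\<^sup>+t. ennreal (exp (- t)) * indicator {0::real ..} t \<partial>lborel) = ennreal (0 - (- exp (- 0)))"
    proof (rule nn_integral_FTC_atLeast)
      show "((\<lambda>t::real. - exp (- t)) \<longlongrightarrow> 0) at_top"
        using tendsto_minus[OF filterlim_compose[OF exp_at_bot filterlim_uminus_at_bot_at_top]] by simp
    qed (auto intro!: derivative_eq_intros)
    also have "(\<integral>\<^sup>+t. ennreal (exp (- t)) * indicator {0::real ..} t \<partial>lborel) = (\<integral>\<^sup>+t. ennreal (?f t) \<partial>lborel)"
      by (intro nn_integral_cong) (auto split: split_indicator)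
    finally show ?thesis by simp
  qed
  have 1: "has_bochner_integral lborel ?f 1"
    by (rule has_bochner_integral_nn_integral) (use nn in auto)
  have i1: "integrable lborel ?f" and v1: "(LINT t|lborel. ?f t) = 1"
    using 1 by (auto simp: has_bochner_integral_iff)
  have i2: "integrable lborel (\<lambda>t. ?f (- t))" and v2: "(LINT t|lborel. ?f (- t)) = 1"
    using i1 v1 integrable_reflect[of ?f] integral_reflect[of ?f] by auto
  have ae: "AE t in lborel. ?f t + ?f (- t) = exp (- \<bar>t\<bar>)"
    using AE_lborel_singleton[of 0] by eventually_elim (auto split: split_indicator)
  have i3: "integrable lborel (\<lambda>t::real. exp (- \<bar>t\<bar>))"
    by (rule integrable_cong_AE_imp[OF Bochner_Integration.integrable_add[OF i1 i2]]) (use ae in \<open>auto elim: eventually_mono\<close>)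
  have "(LINT t|lborel. exp (- \<bar>t\<bar>)) = (LINT t|lborel. ?f t + ?f (- t))"
    by (rule integral_cong_AE) (use ae i1 i2 in \<open>auto elim: eventually_mono\<close>)
  then have v3: "(LINT t|lborel. exp (- \<bar>t::real\<bar>)) = 2" using i1 i2 v1 v2 by simp
  have e: "- \<bar>x - y\<bar> = - \<bar>(-x) + 1 * y\<bar>" for y by simp
  show "integrable lborel (\<lambda>y::real. exp (- \<bar>x - y\<bar>))"
    unfolding e using i3 lborel_integrable_real_affine_iff[of 1 "\<lambda>t. exp (- \<bar>t\<bar>)" "-x"] by simp
  show "(LINT y|lborel. exp (- \<bar>x - y\<bar>)) = 2"
    unfolding e using v3 lborel_integral_real_affine[of 1 "\<lambda>t. exp (- \<bar>t\<bar>)" "-x"] by simp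
qed

text \<open>Convolution with the kernel that dominates the Green function at \<open>z = 0\<close>.\<close>

definition conv :: "(real \<Rightarrow> real) \<Rightarrow> real \<Rightarrow> real" where
  "conv h x = (LINT y|lborel. exp (- \<bar>x - y\<bar>) * h y)"

lemma conv_L1:
  assumes h: "integrable lborel h" and pos: "\<And>y. h y \<ge> 0"
  shows "integrable lborel (\<lambda>y. exp (- \<bar>x - y\<bar>) * h y)" "0 \<le> conv h x" "conv h x \<le> (LINT y|lborel. h y)"
    "integrable lborel (conv h)" "(LINT x|lborel. conv h x) = 2 * (LINT y|lborel. h y)"
proof -
  have [measurable]: "h \<in> borel_measurable borel" using borel_measurable_integrable[OF h] by simp
  show i: "integrable lborel (\<lambda>y. exp (- \<bar>x - y\<bar>) * h y)" for x
    by (rule Bochner_Integration.integrable_bound[OF h]) (auto intro!: AE_I2 mult_left_le_one_le simp: abs_mult)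
  show "0 \<le> conv h x" unfolding conv_def using pos by (intro integral_nonneg_AE AE_I2) auto
  show "conv h x \<le> (LINT y|lborel. h y)" unfolding conv_def
    by (rule integral_mono[OF i h]) (auto intro!: mult_left_le_one_le pos)
  have ab: "(\<lambda>x. exp (- \<bar>x - y\<bar>)) = (\<lambda>x. exp (- \<bar>y - x\<bar>))" for y :: real
    by (intro ext) (simp only: abs_minus_commute)
  have sw: "(LINT x|lborel. exp (- \<bar>x - y\<bar>) * h y) = 2 * h y" for y
    unfolding integral_mult_left_zero ab[of y] exp_abs_integral(2) ..
  have I: "integrable (lborel \<Otimes>\<^sub>M lborel) (\<lambda>(y, x). exp (- \<bar>x - y\<bar>) * h y)"
  proof (rule lborel_pair.Fubini_integrable)
    show "(\<lambda>(y, x). exp (- \<bar>x - y\<bar>) * h y) \<in> borel_measurable (lborel \<Otimes>\<^sub>M lborel)" by measurable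
    have "(LINT x|lborel. norm (case (y, x) of (y, x) \<Rightarrow> exp (- \<bar>x - y\<bar>) * h y)) = 2 * h y" for y
    proof -
      have "(LINT x|lborel. norm (case (y, x) of (y, x) \<Rightarrow> exp (- \<bar>x - y\<bar>) * h y)) = (LINT x|lborel. exp (- \<bar>x - y\<bar>) * h y)"
        by (intro Bochner_Integration.integral_cong) (simp_all add: abs_mult pos)
      then show ?thesis unfolding sw .
    qed
    then show "integrable lborel (\<lambda>y. LINT x|lborel. norm (case (y, x) of (y, x) \<Rightarrow> exp (- \<bar>x - y\<bar>) * h y))"
      using h by simp
    show "AE y in lborel. integrable lborel (\<lambda>x. case (y, x) of (y, x) \<Rightarrow> exp (- \<bar>x - y\<bar>) * h y)"
      using exp_abs_integral(1) by (auto intro!: AE_I2 simp: abs_minus_commute)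
  qed
  show "integrable lborel (conv h)"
    using lborel_pair.integrable_snd[OF I] by (simp add: conv_def[abs_def])
  show "(LINT x|lborel. conv h x) = 2 * (LINT y|lborel. h y)"
  proof -
    have "(LINT x|lborel. conv h x) = (LINT y|lborel. LINT x|lborel. exp (- \<bar>x - y\<bar>) * h y)"
      unfolding conv_def by (rule lborel_pair.Fubini_integral[OF I])
    then show ?thesis unfolding sw by simp
  qed
qed

text \<open>The Cauchy-Schwarz inequality for the kernel, whose mass is 2.\<close>

lemma conv_square_le:
  assumes [measurable]: "h \<in> borel_measurable borel" and h: "integrable lborel (\<lambda>y. (h y)\<^sup>2)"
  shows "integrable lborel (\<lambda>y. exp (- \<bar>x - y\<bar>) * h y)" "(conv h x)\<^sup>2 \<le> 2 * conv (\<lambda>y. (h y)\<^sup>2) x"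
proof -
  note c2 = conv_L1[OF h zero_le_power2]
  show i: "integrable lborel (\<lambda>y. exp (- \<bar>x - y\<bar>) * h y)"
  proof (rule Bochner_Integration.integrable_bound)
    show "integrable lborel (\<lambda>y. exp (- \<bar>x - y\<bar>) + exp (- \<bar>x - y\<bar>) * (h y)\<^sup>2)"
      using exp_abs_integral(1) c2(1) by (rule Bochner_Integration.integrable_add)
    have "\<bar>t\<bar> \<le> 1 + t\<^sup>2" for t :: real
      using zero_le_power2[of "\<bar>t\<bar> - 1"] by (simp add: power2_eq_square algebra_simps)
    then have "exp (- \<bar>x - y\<bar>) * \<bar>h y\<bar> \<le> exp (- \<bar>x - y\<bar>) * (1 + (h y)\<^sup>2)" for y by (intro mult_left_mono) auto
    then show "AE y in lborel. norm (exp (- \<bar>x - y\<bar>) * h y) \<le> norm (exp (- \<bar>x - y\<bar>) + exp (- \<bar>x - y\<bar>) * (h y)\<^sup>2)"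
      by (intro AE_I2) (simp add: abs_mult distrib_left)
  qed simp
  define e where "e = conv h x"
  \<comment> \<open>The variance of \<open>h\<close> for the kernel, whose total mass is 2, is nonnegative.\<close>
  have "0 \<le> (LINT y|lborel. exp (- \<bar>x - y\<bar>) * (h y - e / 2)\<^sup>2)" by (intro integral_nonneg_AE AE_I2) auto
  also have "\<dots> = (LINT y|lborel. exp (- \<bar>x - y\<bar>) * (h y)\<^sup>2 - e * (exp (- \<bar>x - y\<bar>) * h y) + e\<^sup>2 / 4 * exp (- \<bar>x - y\<bar>))"
    by (intro Bochner_Integration.integral_cong) (auto simp: power2_eq_square algebra_simps)
  also have "\<dots> = conv (\<lambda>y. (h y)\<^sup>2) x - e * e + e\<^sup>2 / 4 * 2"
    using i c2(1) exp_abs_integral[of x] by (simp add: conv_def e_def)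
  finally show "(conv h x)\<^sup>2 \<le> 2 * conv (\<lambda>y. (h y)\<^sup>2) x" by (simp add: e_def power2_eq_square)
qed

text \<open>The sources for which the Green function converges absolutely. The class contains both the integrable
and the square integrable functions, and it is a vector space; sources of the form \<open>z f - V f\<close> are of
mixed type.\<close>

definition admissible :: "(real \<Rightarrow> 'a::{banach, second_countable_topology}) \<Rightarrow> bool" where
  "admissible r \<longleftrightarrow> r \<in> borel_measurable borel \<and> (\<forall>x. integrable lborel (\<lambda>y. exp (- \<bar>x - y\<bar>) * norm (r y)))"

lemma admissible_L1: "integrable lborel r \<Longrightarrow> admissible r"
  unfolding admissible_def using conv_L1(1)[of "\<lambda>y. norm (r y)"] by auto

lemma admissible_L2:
  assumes "r \<in> borel_measurable borel" "integrable lborel (\<lambda>y. (norm (r y))\<^sup>2)"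
  shows "admissible r"
  unfolding admissible_def using conv_square_le(1)[of "\<lambda>y. norm (r y)"] assms by auto

lemma admissible_bounded_by:
  assumes h: "admissible h" and [measurable]: "g \<in> borel_measurable borel" and le: "\<And>y. norm (g y) \<le> C * norm (h y)"
  shows "admissible g"
  unfolding admissible_def
proof (intro conjI allI)
  fix x :: real
  have "integrable lborel (\<lambda>y. C * (exp (- \<bar>x - y\<bar>) * norm (h y)))" using h by (auto simp: admissible_def)
  then show "integrable lborel (\<lambda>y. exp (- \<bar>x - y\<bar>) * norm (g y))"
  proof (rule Bochner_Integration.integrable_bound)
    have "exp (- \<bar>x - y\<bar>) * norm (g y) \<le> exp (- \<bar>x - y\<bar>) * (C * norm (h y))" for y using le by (intro mult_left_mono) auto
    then show "AE y in lborel. norm (exp (- \<bar>x - y\<bar>) * norm (g y)) \<le> norm (C * (exp (- \<bar>x - y\<bar>) * norm (h y)))"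
      by (intro AE_I2) (smt (verit, best) abs_ge_self mult.left_commute real_norm_def mult_nonneg_nonneg norm_ge_zero exp_ge_zero abs_of_nonneg)
  qed simp
qed simp

lemma admissible_add:
  assumes "admissible g" "admissible h" shows "admissible (\<lambda>y. g y + h y)"
  unfolding admissible_def
proof (intro conjI allI)
  have [measurable]: "g \<in> borel_measurable borel" "h \<in> borel_measurable borel" using assms by (auto simp: admissible_def)
  show "(\<lambda>y. g y + h y) \<in> borel_measurable borel" by simp
  fix x :: real
  have "integrable lborel (\<lambda>y. exp (- \<bar>x - y\<bar>) * norm (g y) + exp (- \<bar>x - y\<bar>) * norm (h y))"
    using assms by (auto simp: admissible_def)
  then show "integrable lborel (\<lambda>y. exp (- \<bar>x - y\<bar>) * norm (g y + h y))"
    by (rule Bochner_Integration.integrable_bound)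
       (auto intro!: AE_I2 simp: norm_triangle_ineq simp flip: distrib_left)
qed

text \<open>The solution of \<open>u' = - \<kappa> u + r\<close> that is driven from the left.\<close>

definition Eminus :: "real \<Rightarrow> (real \<Rightarrow> complex) \<Rightarrow> real \<Rightarrow> complex" where
  "Eminus \<kappa> r x = (LINT y:{..x}|lborel. exp (- \<kappa> * (x - y)) *\<^sub>R r y)"

text \<open>The solution of \<open>u' = \<kappa> u - r\<close> that is driven from the right.\<close>

definition Eplus :: "real \<Rightarrow> (real \<Rightarrow> complex) \<Rightarrow> real \<Rightarrow> complex" where
  "Eplus \<kappa> r x = Eminus \<kappa> (\<lambda>y. r (- y)) (- x)"

lemma admissible_reflect: "admissible r \<Longrightarrow> admissible (\<lambda>y. r (- y))"
  unfolding admissible_def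
proof (intro conjI allI; elim conjE)
  assume [measurable]: "r \<in> borel_measurable borel"
  show "(\<lambda>y. r (- y)) \<in> borel_measurable borel" by measurable
  fix x assume "\<forall>x. integrable lborel (\<lambda>y. exp (- \<bar>x - y\<bar>) * norm (r y))"
  then have "integrable lborel (\<lambda>y. exp (- \<bar>- x - y\<bar>) * norm (r y))" by blast
  then have "integrable lborel (\<lambda>y. exp (- \<bar>- x - (- y)\<bar>) * norm (r (- y)))"
    by (subst (asm) integrable_reflect[symmetric])
  then show "integrable lborel (\<lambda>y. exp (- \<bar>x - y\<bar>) * norm (r (- y)))" by (simp add: abs_minus_commute)
qed

lemma Eminus_integrable:
  assumes r: "admissible r" and k: "\<kappa> \<ge> 1"
  shows "set_integrable lborel {..x} (\<lambda>y. exp (- \<kappa> * (x - y)) *\<^sub>R r y)"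
    "norm (Eminus \<kappa> r x) \<le> conv (\<lambda>y. norm (r y)) x"
proof -
  have [measurable]: "r \<in> borel_measurable borel" using r by (simp add: admissible_def)
  have i: "integrable lborel (\<lambda>y. exp (- \<bar>x - y\<bar>) * norm (r y))" using r by (auto simp: admissible_def)
  have le: "norm (indicator {..x} y *\<^sub>R exp (- \<kappa> * (x - y)) *\<^sub>R r y) \<le> exp (- \<bar>x - y\<bar>) * norm (r y)" for y
  proof (cases "y \<le> x")
    case True
    have "1 * (x - y) \<le> \<kappa> * (x - y)" using k True by (intro mult_right_mono) auto
    then show ?thesis using True by (auto intro!: mult_right_mono)
  qed simp
  have int: "integrable lborel (\<lambda>y. indicator {..x} y *\<^sub>R exp (- \<kappa> * (x - y)) *\<^sub>R r y)"
  proof (rule Bochner_Integration.integrable_bound[OF i])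
    show "AE y in lborel. norm (indicator {..x} y *\<^sub>R exp (- \<kappa> * (x - y)) *\<^sub>R r y) \<le> norm (exp (- \<bar>x - y\<bar>) * norm (r y))"
      using le by (intro AE_I2) (simp del: norm_scaleR)
  qed measurable
  then show "set_integrable lborel {..x} (\<lambda>y. exp (- \<kappa> * (x - y)) *\<^sub>R r y)" by (simp only: set_integrable_def)
  show "norm (Eminus \<kappa> r x) \<le> conv (\<lambda>y. norm (r y)) x"
    unfolding Eminus_def conv_def set_lebesgue_integral_def
    by (rule Bochner_Integration.integral_norm_bound_integral[OF int i le])
qed

lemma Eplus_bound:
  assumes r: "admissible r" and k: "\<kappa> \<ge> 1"
  shows "norm (Eplus \<kappa> r x) \<le> conv (\<lambda>y. norm (r y)) x"
proof -
  have "norm (Eplus \<kappa> r x) \<le> conv (\<lambda>y. norm (r (- y))) (- x)"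
    unfolding Eplus_def by (rule Eminus_integrable(2)[OF admissible_reflect[OF r] k])
  also have "\<dots> = conv (\<lambda>y. norm (r y)) x"
  proof -
    have "exp (- \<bar>- x - y\<bar>) * norm (r (- y)) = (\<lambda>u. exp (- \<bar>x - u\<bar>) * norm (r u)) (- y)" for y
      by (auto simp: abs_if)
    then show ?thesis unfolding conv_def
      using integral_reflect[of "\<lambda>y. exp (- \<bar>x - y\<bar>) * norm (r y)"] by (simp only:)
  qed
  finally show ?thesis .
qed

lemma primitive_on_Eminus:
  assumes r: "admissible r" and k: "\<kappa> \<ge> 1"
  shows "primitive_on UNIV (Eminus \<kappa> r) (\<lambda>x. - of_real \<kappa> * Eminus \<kappa> r x + r x)"
proof -
  define H where "H = (\<lambda>x. LINT y:{..x}|lborel. exp (\<kappa> * y) *\<^sub>R r y)"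
  have e: "exp (\<kappa> * y) *\<^sub>R r y = exp (\<kappa> * x) *\<^sub>R (exp (- \<kappa> * (x - y)) *\<^sub>R r y)" for x y
    by (simp add: algebra_simps flip: exp_add)
  have I: "set_integrable lborel {..x} (\<lambda>y. exp (\<kappa> * y) *\<^sub>R r y)" for x
    unfolding e[of _ x] using Eminus_integrable(1)[OF r k] by (rule set_integrable_scaleR_right)
  have EH: "Eminus \<kappa> r x = exp (- of_real \<kappa> * of_real x) * H x" for x
  proof -
    have "H x = exp (\<kappa> * x) *\<^sub>R Eminus \<kappa> r x"
      unfolding H_def e[of _ x] Eminus_def by (rule set_integral_scaleR_right)
    then have "exp (- \<kappa> * x) *\<^sub>R H x = Eminus \<kappa> r x" by (simp flip: exp_add)
    then show ?thesis by (simp add: scaleR_conv_of_real flip: exp_of_real)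
  qed
  have "primitive_on UNIV H (\<lambda>y. exp (\<kappa> * y) *\<^sub>R r y)"
    unfolding primitive_on_def
  proof (intro allI impI, elim conjE)
    fix a b :: real assume ab: "a \<le> b"
    have I1: "set_integrable lborel {a..b} (\<lambda>y. exp (\<kappa> * y) *\<^sub>R r y)"
      by (rule set_integrable_subset[OF I[of b]]) auto
    have un: "{..b} = {..a} \<union> {a..b}" using ab by auto
    have "AE y in lborel. \<not> (y \<in> {..a} \<and> y \<in> {a..b})"
      using AE_lborel_singleton[of a] by eventually_elim auto
    from set_integral_Un_AE[OF this _ _ I I1] have "H b = H a + (LINT y:{a..b}|lborel. exp (\<kappa> * y) *\<^sub>R r y)"
      by (simp add: H_def un)
    then show "set_integrable lborel {a..b} (\<lambda>y. exp (\<kappa> * y) *\<^sub>R r y) \<and> H b - H a = (LINT y:{a..b}|lborel. exp (\<kappa> * y) *\<^sub>R r y)"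
      using I1 by simp
  qed
  then have P: "primitive_on UNIV (\<lambda>x. exp (- of_real \<kappa> * of_real x) * H x)
      (\<lambda>x. exp (- of_real \<kappa> * of_real x) * (exp (\<kappa> * x) *\<^sub>R r x) + (- of_real \<kappa> * exp (- of_real \<kappa> * of_real x)) * H x)"
  proof (rule primitive_on_product)
    fix t
    have "((\<lambda>t. exp (- of_real \<kappa> * t)) has_field_derivative - of_real \<kappa> * exp (- of_real \<kappa> * of_real t)) (at (of_real t :: complex))"
      by (auto intro!: derivative_eq_intros)
    from has_vector_derivative_real_field[OF this]
    show "((\<lambda>t. exp (- of_real \<kappa> * of_real t)) has_vector_derivative - of_real \<kappa> * exp (- of_real \<kappa> * of_real t :: complex)) (at t)" .
  qed (intro continuous_intros)
  show ?thesis
  proof (rule primitive_on_cong[OF P])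
    fix x
    have "exp (- of_real \<kappa> * of_real x :: complex) * (exp (\<kappa> * x) *\<^sub>R r x) = r x"
      by (simp add: scaleR_conv_of_real flip: exp_of_real exp_add mult.assoc)
    then show "exp (- of_real \<kappa> * of_real x) * (exp (\<kappa> * x) *\<^sub>R r x) + (- of_real \<kappa> * exp (- of_real \<kappa> * of_real x)) * H x
       = - of_real \<kappa> * Eminus \<kappa> r x + r x" by (simp add: EH)
  qed (simp add: EH)
qed

lemma primitive_on_Eplus:
  assumes r: "admissible r" and k: "\<kappa> \<ge> 1"
  shows "primitive_on UNIV (Eplus \<kappa> r) (\<lambda>x. of_real \<kappa> * Eplus \<kappa> r x - r x)"
proof -
  have "primitive_on {x. - x \<in> UNIV} (\<lambda>x. Eminus \<kappa> (\<lambda>y. r (- y)) (- x))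
     (\<lambda>x. - (- of_real \<kappa> * Eminus \<kappa> (\<lambda>y. r (- y)) (- x) + r (- (- x))))"
    by (rule primitive_on_reflect[OF primitive_on_Eminus[OF admissible_reflect[OF r] k]])
  then show ?thesis by (auto simp: Eplus_def[abs_def])
qed

lemma Eminus_add:
  assumes "admissible r" "admissible s" "\<kappa> \<ge> 1"
  shows "Eminus \<kappa> (\<lambda>y. r y + s y) x = Eminus \<kappa> r x + Eminus \<kappa> s x"
  unfolding Eminus_def scaleR_add_right
  by (rule set_integral_add(2)) (intro Eminus_integrable(1) assms)+

lemma Eminus_cmult: "Eminus \<kappa> (\<lambda>y. c * r y) x = c * Eminus \<kappa> r x"
  unfolding Eminus_def by (simp add: mult_scaleR_right[symmetric] del: mult_scaleR_right)

lemma Eminus_cong_AE: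
  assumes [measurable]: "r \<in> borel_measurable borel" "s \<in> borel_measurable borel" and "AE y in lborel. r y = s y"
  shows "Eminus \<kappa> r x = Eminus \<kappa> s x"
  unfolding Eminus_def set_lebesgue_integral_def
  by (rule integral_cong_AE) (use assms(3) in \<open>auto elim: eventually_mono\<close>)

lemma AE_reflect:
  assumes "AE y in lborel. P (y::real)" shows "AE y in lborel. P (- y)"
proof -
  have "AE y in distr lborel borel uminus. P y" unfolding lborel_distr_uminus by (rule assms)
  then show ?thesis by (rule AE_distrD[rotated]) simp
qed

lemma Eplus_add:
  assumes "admissible r" "admissible s" "\<kappa> \<ge> 1"
  shows "Eplus \<kappa> (\<lambda>y. r y + s y) x = Eplus \<kappa> r x + Eplus \<kappa> s x"
  unfolding Eplus_def by (rule Eminus_add) (intro admissible_reflect assms)+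

lemma Eplus_cmult: "Eplus \<kappa> (\<lambda>y. c * r y) x = c * Eplus \<kappa> r x"
  unfolding Eplus_def by (rule Eminus_cmult)

lemma Eplus_cong_AE:
  assumes [measurable]: "r \<in> borel_measurable borel" "s \<in> borel_measurable borel" and "AE y in lborel. r y = s y"
  shows "Eplus \<kappa> r x = Eplus \<kappa> s x"
  unfolding Eplus_def by (rule Eminus_cong_AE) (use AE_reflect[OF assms(3)] in auto)

section \<open>The Green function at the origin\<close>

text \<open>At \<open>z = 0\<close> the rate is the same real number on both half lines; it is at least 1, so that the kernels are
dominated by \<open>exp (- \<bar>x - y\<bar>)\<close>.\<close>

definition kap :: "real \<Rightarrow> real" where "kap m = sqrt (m\<^sup>2 + 1)"

lemma kap_ge_1: "kap m \<ge> 1" by (simp add: kap_def)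

lemma kap_sq: "(kap m)\<^sup>2 = m\<^sup>2 + 1" unfolding kap_def by (intro real_sqrt_pow2) (simp add: add_nonneg_nonneg)

text \<open>With \<open>N = ((0, m - \<i> \<epsilon>), (m + \<i> \<epsilon>, 0))\<close> on the half line of sign \<open>\<epsilon>\<close>, so that \<open>N\<^sup>2 = \<kappa>\<^sup>2\<close>, let \<open>P\<close> and
\<open>M\<close> be the left- and right-driven solutions for the source \<open>(g2, - g1)\<close>. The function
\<open>(P - M) / 2 - N (P + M) / (2 \<kappa>)\<close> solves the system on each half line but jumps at the origin by a matrix multiple
of \<open>(jump1, jump2) = P 0 + M 0\<close>. Adding \<open>exp (- \<kappa> \<bar>x\<bar>) (N / \<kappa> - \<epsilon>) c\<close>, which solves the homogeneous
system and decays, cancels the jump for the vector \<open>c = (coef1, coef2)\<close> below; this needs \<open>m \<noteq> 0\<close>.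
The two components of the resulting function are \<open>branch1\<close> and \<open>branch2\<close>.\<close>

definition jump1 :: "real \<Rightarrow> (real \<Rightarrow> complex^2) \<Rightarrow> complex" where
  "jump1 m g = Eminus (kap m) (\<lambda>y. g y $ 2) 0 + Eplus (kap m) (\<lambda>y. g y $ 2) 0"

definition jump2 :: "real \<Rightarrow> (real \<Rightarrow> complex^2) \<Rightarrow> complex" where
  "jump2 m g = - (Eminus (kap m) (\<lambda>y. g y $ 1) 0 + Eplus (kap m) (\<lambda>y. g y $ 1) 0)"

definition coef1 :: "real \<Rightarrow> (real \<Rightarrow> complex^2) \<Rightarrow> complex" where
  "coef1 m g = - (jump1 m g - \<i> * of_real (kap m) * jump2 m g) / (2 * of_real (m\<^sup>2))"

definition coef2 :: "real \<Rightarrow> (real \<Rightarrow> complex^2) \<Rightarrow> complex" where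
  "coef2 m g = - (jump2 m g + \<i> * of_real (kap m) * jump1 m g) / (2 * of_real (m\<^sup>2))"

definition branch1 :: "real \<Rightarrow> real \<Rightarrow> (real \<Rightarrow> complex^2) \<Rightarrow> real \<Rightarrow> complex" where
  "branch1 m \<epsilon> g x =
     (Eminus (kap m) (\<lambda>y. g y $ 2) x - Eplus (kap m) (\<lambda>y. g y $ 2) x) / 2
     + (of_real m - \<i> * of_real \<epsilon>) / (2 * of_real (kap m)) *
         (Eminus (kap m) (\<lambda>y. g y $ 1) x + Eplus (kap m) (\<lambda>y. g y $ 1) x)
     + exp (- of_real (\<epsilon> * kap m) * of_real x) *
         ((of_real m - \<i> * of_real \<epsilon>) * coef2 m g / of_real (kap m) - of_real \<epsilon> * coef1 m g)"

definition branch2 :: "real \<Rightarrow> real \<Rightarrow> (real \<Rightarrow> complex^2) \<Rightarrow> real \<Rightarrow> complex" where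
  "branch2 m \<epsilon> g x =
     (Eplus (kap m) (\<lambda>y. g y $ 1) x - Eminus (kap m) (\<lambda>y. g y $ 1) x) / 2
     - (of_real m + \<i> * of_real \<epsilon>) / (2 * of_real (kap m)) *
         (Eminus (kap m) (\<lambda>y. g y $ 2) x + Eplus (kap m) (\<lambda>y. g y $ 2) x)
     + exp (- of_real (\<epsilon> * kap m) * of_real x) *
         ((of_real m + \<i> * of_real \<epsilon>) * coef1 m g / of_real (kap m) - of_real \<epsilon> * coef2 m g)"

definition green :: "real \<Rightarrow> (real \<Rightarrow> complex^2) \<Rightarrow> real \<Rightarrow> complex^2" where
  "green m g x = (let \<epsilon> = if x \<ge> 0 then 1 else -1 in vector [branch1 m \<epsilon> g x, branch2 m \<epsilon> g x])"

lemma measurable_nth[measurable (raw)]: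
  fixes f :: "'a \<Rightarrow> ('b :: euclidean_space)^'n"
  assumes "f \<in> borel_measurable M"
  shows "(\<lambda>x. f x $ i) \<in> borel_measurable M"
proof -
  have "continuous_on UNIV (\<lambda>v :: 'b^'n. v $ i)" by (intro continuous_intros)
  then show ?thesis by (rule measurable_compose[OF assms borel_measurable_continuous_onI])
qed

lemma admissible_component:
  assumes "admissible (g :: real \<Rightarrow> complex^2)"
  shows "admissible (\<lambda>y. g y $ i)"
proof (rule admissible_bounded_by[OF assms])
  have [measurable]: "g \<in> borel_measurable borel" using assms by (simp add: admissible_def)
  show "(\<lambda>y. g y $ i) \<in> borel_measurable borel" by measurable
  show "norm (g y $ i) \<le> 1 * norm (g y)" for y by (simp add: Finite_Cartesian_Product.norm_nth_le)
qed

lemma primitive_on_const: "primitive_on S (\<lambda>_. c) (\<lambda>_. 0)"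
  by (auto simp: primitive_on_def set_integrable_def set_lebesgue_integral_def)

lemma primitive_on_exp_fun:
  "primitive_on S (\<lambda>x. exp (k * of_real x) * c) (\<lambda>x. k * exp (k * of_real x) * c)"
proof -
  have "primitive_on S (\<lambda>x. exp (k * of_real x) * c) (\<lambda>x. exp (k * of_real x) * 0 + (k * exp (k * of_real x)) * c)"
  proof (rule primitive_on_product[OF primitive_on_const])
    fix t
    have "((\<lambda>t. exp (k * t)) has_field_derivative k * exp (k * of_real t)) (at (of_real t :: complex))"
      by (auto intro!: derivative_eq_intros)
    from has_vector_derivative_real_field[OF this]
    show "((\<lambda>t. exp (k * of_real t)) has_vector_derivative k * exp (k * of_real t :: complex)) (at t)" .
  qed (intro continuous_intros)
  then show ?thesis by simp
qed

lemma kap_complex: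
  "complex_of_real (kap m) \<noteq> 0" "complex_of_real (kap m) * complex_of_real (kap m) = of_real m * of_real m + 1"
proof -
  show "complex_of_real (kap m) \<noteq> 0" using kap_ge_1[of m] by auto
  show "complex_of_real (kap m) * complex_of_real (kap m) = of_real m * of_real m + 1"
    using arg_cong[OF kap_sq[of m], of complex_of_real] by (simp add: power2_eq_square)
qed

lemma branch_primitive:
  assumes g: "admissible g" and \<epsilon>: "\<epsilon> = 1 \<or> \<epsilon> = -1"
  shows "primitive_on UNIV (branch1 m \<epsilon> g) (\<lambda>x. (of_real m - \<i> * of_real \<epsilon>) * branch2 m \<epsilon> g x + g x $ 2)"
    and "primitive_on UNIV (branch2 m \<epsilon> g) (\<lambda>x. (of_real m + \<i> * of_real \<epsilon>) * branch1 m \<epsilon> g x - g x $ 1)"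
proof -
  define k :: complex where "k = of_real (kap m)"
  have k: "k \<noteq> 0" "k * k = of_real m * of_real m + 1" using kap_complex by (auto simp: k_def)
  define a b e where "a = of_real m - \<i> * of_real \<epsilon>" and "b = of_real m + \<i> * of_real \<epsilon>" and "e = complex_of_real \<epsilon>"
  have ab: "a * b = k * k" "e * e = 1" unfolding a_def b_def e_def k using \<epsilon> by (auto simp: algebra_simps)
  define P1 M1 P2 M2 where "P1 = Eminus (kap m) (\<lambda>y. g y $ 2)" and "M1 = Eplus (kap m) (\<lambda>y. g y $ 2)"
    and "P2 = Eminus (kap m) (\<lambda>y. g y $ 1)" and "M2 = Eplus (kap m) (\<lambda>y. g y $ 1)"
  define c1 c2 where "c1 = coef1 m g" and "c2 = coef2 m g"
  have asc: "u * v * w = v * (u * w)" for u v w :: complex by simp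
  have ex: "- of_real (\<epsilon> * kap m) = - e * k" by (simp add: e_def k_def)
  have p: "primitive_on UNIV P1 (\<lambda>x. - k * P1 x + g x $ 2)" "primitive_on UNIV M1 (\<lambda>x. k * M1 x - g x $ 2)"
    "primitive_on UNIV P2 (\<lambda>x. - k * P2 x + g x $ 1)" "primitive_on UNIV M2 (\<lambda>x. k * M2 x - g x $ 1)"
    unfolding P1_def M1_def P2_def M2_def k_def
    by (intro primitive_on_Eminus primitive_on_Eplus admissible_component g kap_ge_1)+
  have b1: "branch1 m \<epsilon> g = (\<lambda>x. (1/2) * (P1 x - M1 x) + a / (2 * k) * (P2 x + M2 x) + exp (- e * k * of_real x) * (a * c2 / k - e * c1))"
    unfolding branch1_def[abs_def] P1_def M1_def P2_def M2_def c1_def c2_def a_def ex k_def e_def by simp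
  have b2: "branch2 m \<epsilon> g = (\<lambda>x. (1/2) * (M2 x - P2 x) - b / (2 * k) * (P1 x + M1 x) + exp (- e * k * of_real x) * (b * c1 / k - e * c2))"
    unfolding branch2_def[abs_def] P1_def M1_def P2_def M2_def c1_def c2_def b_def ex k_def e_def by simp
  have "primitive_on UNIV (branch1 m \<epsilon> g) (\<lambda>x. (1/2) * ((- k * P1 x + g x $ 2) - (k * M1 x - g x $ 2))
      + a / (2 * k) * ((- k * P2 x + g x $ 1) + (k * M2 x - g x $ 1)) + (- e * k) * exp (- e * k * of_real x) * (a * c2 / k - e * c1))"
    unfolding b1 by (intro primitive_on_add primitive_on_cmult primitive_on_diff p primitive_on_exp_fun)
  then show "primitive_on UNIV (branch1 m \<epsilon> g) (\<lambda>x. (of_real m - \<i> * of_real \<epsilon>) * branch2 m \<epsilon> g x + g x $ 2)"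
  proof (rule primitive_on_cong)
    fix x
    define E where "E = exp (- e * k * of_real x)"
    have "a * (b / (2 * k) * (P1 x + M1 x)) = (a * b) / (2 * k) * (P1 x + M1 x)" by simp
    then have A: "a * (b / (2 * k) * (P1 x + M1 x)) = k / 2 * (P1 x + M1 x)" using ab(1) k(1) by (simp add: mult.commute)
    have "a * (b * c1 / k) = (a * b) * c1 / k" by simp
    then have B: "a * (b * c1 / k) = k * c1" using ab(1) k(1) by (simp add: mult.commute)
    have C: "(- e * k) * (a * c2 / k - e * c1) = k * c1 - a * (e * c2)"
    proof -
      have "(- e * k) * (a * c2 / k - e * c1) = - (e * a * c2) + (e * e) * k * c1" using k(1) by (simp add: field_simps)
      then show ?thesis unfolding ab(2) by (simp add: algebra_simps)
    qed
    have D: "a / (2 * k) * ((- k * P2 x + g x $ 1) + (k * M2 x - g x $ 1)) = a * ((1/2) * (M2 x - P2 x))"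
      using k(1) by (simp add: field_simps)
    define Z where "Z = E * (k * c1 - a * (e * c2))"
    have X: "(- e * k) * E * (a * c2 / k - e * c1) = Z"
      using C by (simp only: asc[of "- e * k" E] Z_def)
    have Y: "a * branch2 m \<epsilon> g x = a * ((1/2) * (M2 x - P2 x)) - k / 2 * (P1 x + M1 x) + Z"
      unfolding b2 A[symmetric] B[symmetric] Z_def E_def by (simp add: algebra_simps)
    show "(1/2) * ((- k * P1 x + g x $ 2) - (k * M1 x - g x $ 2))
      + a / (2 * k) * ((- k * P2 x + g x $ 1) + (k * M2 x - g x $ 1)) + (- e * k) * exp (- e * k * of_real x) * (a * c2 / k - e * c1)
      = (of_real m - \<i> * of_real \<epsilon>) * branch2 m \<epsilon> g x + g x $ 2"
      unfolding D a_def[symmetric] E_def[symmetric] X Y by (simp add: field_simps)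
  qed simp
  have "primitive_on UNIV (branch2 m \<epsilon> g) (\<lambda>x. (1/2) * ((k * M2 x - g x $ 1) - (- k * P2 x + g x $ 1))
      - b / (2 * k) * ((- k * P1 x + g x $ 2) + (k * M1 x - g x $ 2)) + (- e * k) * exp (- e * k * of_real x) * (b * c1 / k - e * c2))"
    unfolding b2 by (intro primitive_on_add primitive_on_cmult primitive_on_diff p primitive_on_exp_fun)
  then show "primitive_on UNIV (branch2 m \<epsilon> g) (\<lambda>x. (of_real m + \<i> * of_real \<epsilon>) * branch1 m \<epsilon> g x - g x $ 1)"
  proof (rule primitive_on_cong)
    fix x
    define E where "E = exp (- e * k * of_real x)"
    have "b * (a / (2 * k) * (P2 x + M2 x)) = (b * a) / (2 * k) * (P2 x + M2 x)" by simp
    then have A: "b * (a / (2 * k) * (P2 x + M2 x)) = k / 2 * (P2 x + M2 x)" using ab(1) k(1) by (simp add: mult.commute)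
    have "b * (a * c2 / k) = (b * a) * c2 / k" by simp
    then have B: "b * (a * c2 / k) = k * c2" using ab(1) k(1) by (simp add: mult.commute)
    have C: "(- e * k) * (b * c1 / k - e * c2) = k * c2 - b * (e * c1)"
    proof -
      have "(- e * k) * (b * c1 / k - e * c2) = - (e * b * c1) + (e * e) * k * c2" using k(1) by (simp add: field_simps)
      then show ?thesis unfolding ab(2) by (simp add: algebra_simps)
    qed
    have D: "b / (2 * k) * ((- k * P1 x + g x $ 2) + (k * M1 x - g x $ 2)) = b * ((1/2) * (M1 x - P1 x))"
      using k(1) by (simp add: field_simps)
    define Z where "Z = E * (k * c2 - b * (e * c1))"
    have X: "(- e * k) * E * (b * c1 / k - e * c2) = Z"
      using C by (simp only: asc[of "- e * k" E] Z_def)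
    have Y: "b * branch1 m \<epsilon> g x = b * ((1/2) * (P1 x - M1 x)) + k / 2 * (P2 x + M2 x) + Z"
      unfolding b1 A[symmetric] B[symmetric] Z_def E_def by (simp add: algebra_simps)
    show "(1/2) * ((k * M2 x - g x $ 1) - (- k * P2 x + g x $ 1))
      - b / (2 * k) * ((- k * P1 x + g x $ 2) + (k * M1 x - g x $ 2)) + (- e * k) * exp (- e * k * of_real x) * (b * c1 / k - e * c2)
      = (of_real m + \<i> * of_real \<epsilon>) * branch1 m \<epsilon> g x - g x $ 1"
      unfolding D b_def[symmetric] E_def[symmetric] X Y by (simp add: field_simps)
  qed simp
qed

text \<open>The coefficients \<open>c\<close> are the solution of the two linear equations that continuity at the origin imposes.\<close>

lemma branch_match:
  assumes m: "m > 0"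
  shows "branch1 m 1 g 0 = branch1 m (-1) g 0" "branch2 m 1 g 0 = branch2 m (-1) g 0"
proof -
  define k :: complex where "k = of_real (kap m)"
  have k: "k \<noteq> 0" "k * k = of_real m * of_real m + 1" using kap_complex by (auto simp: k_def)
  define M :: complex where "M = of_real m * of_real m"
  have M: "M \<noteq> 0" "k * k = M + 1" using m k by (auto simp: M_def)
  define w1 w2 where "w1 = jump1 m g" and "w2 = jump2 m g"
  have c1: "2 * M * coef1 m g = - (w1 - \<i> * k * w2)"
    using m unfolding coef1_def M_def w1_def w2_def k_def by (simp add: power2_eq_square)
  have c2: "2 * M * coef2 m g = - (w2 + \<i> * k * w1)"
    using m unfolding coef2_def M_def w1_def w2_def k_def by (simp add: power2_eq_square)
  have "M * (2 * \<i> * coef2 m g + 2 * k * coef1 m g) = \<i> * (2 * M * coef2 m g) + k * (2 * M * coef1 m g)" by (simp add: algebra_simps)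
  also have "\<dots> = \<i> * (k * k - 1) * w2" unfolding c1 c2 by (simp add: algebra_simps)
  also have "\<dots> = M * (\<i> * w2)" unfolding M(2) by simp
  finally have e1: "2 * \<i> * coef2 m g + 2 * k * coef1 m g = \<i> * w2" using M(1) by simp
  have "M * (2 * k * coef2 m g - 2 * \<i> * coef1 m g) = k * (2 * M * coef2 m g) - \<i> * (2 * M * coef1 m g)" by (simp add: algebra_simps)
  also have "\<dots> = - (\<i> * (k * k - 1) * w1)" unfolding c1 c2 by (simp add: algebra_simps)
  also have "\<dots> = M * (- \<i> * w1)" unfolding M(2) by simp
  finally have e2: "2 * k * coef2 m g - 2 * \<i> * coef1 m g = - \<i> * w1" using M(1) by (metis mult_left_cancel)
  have W2: "Eminus (kap m) (\<lambda>y. g y $ 1) 0 + Eplus (kap m) (\<lambda>y. g y $ 1) 0 = - w2" by (simp add: w2_def jump2_def)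
  have W1: "Eminus (kap m) (\<lambda>y. g y $ 2) 0 + Eplus (kap m) (\<lambda>y. g y $ 2) 0 = w1" by (simp add: w1_def jump1_def)
  have "branch1 m 1 g 0 - branch1 m (-1) g 0 = (\<i> * w2 - (2 * \<i> * coef2 m g + 2 * k * coef1 m g)) / k"
    unfolding branch1_def W2 k_def[symmetric] using k(1) by (simp add: field_simps)
  then show "branch1 m 1 g 0 = branch1 m (-1) g 0" unfolding e1 by simp
  have "branch2 m 1 g 0 - branch2 m (-1) g 0 = (- \<i> * w1 - (2 * k * coef2 m g - 2 * \<i> * coef1 m g)) / k"
    unfolding branch2_def W1 k_def[symmetric] using k(1) by (simp add: field_simps)
  then show "branch2 m 1 g 0 = branch2 m (-1) g 0" unfolding e2 by simp
qed

lemma green_eq: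
  "x \<ge> 0 \<Longrightarrow> green m g x = vector [branch1 m 1 g x, branch2 m 1 g x]"
  "m > 0 \<Longrightarrow> x \<le> 0 \<Longrightarrow> green m g x = vector [branch1 m (-1) g x, branch2 m (-1) g x]"
  by (auto simp: green_def branch_match Let_def)

lemma green_ode:
  assumes g: "admissible g" and m: "m > 0"
  shows "primitive_on {0..} (\<lambda>x. green m g x $ 1) (\<lambda>x. (of_real m - \<i>) * green m g x $ 2 + g x $ 2)"
    "primitive_on {0..} (\<lambda>x. green m g x $ 2) (\<lambda>x. (of_real m + \<i>) * green m g x $ 1 - g x $ 1)"
    "primitive_on {..0} (\<lambda>x. green m g x $ 1) (\<lambda>x. (of_real m + \<i>) * green m g x $ 2 + g x $ 2)"
    "primitive_on {..0} (\<lambda>x. green m g x $ 2) (\<lambda>x. (of_real m - \<i>) * green m g x $ 1 - g x $ 1)"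
proof -
  note P = branch_primitive[OF g, of 1 m] branch_primitive[OF g, of "-1" m]
  show "primitive_on {0..} (\<lambda>x. green m g x $ 1) (\<lambda>x. (of_real m - \<i>) * green m g x $ 2 + g x $ 2)"
    by (rule primitive_on_cong[OF primitive_on_subset[OF P(1)]]) (auto simp: green_eq)
  show "primitive_on {0..} (\<lambda>x. green m g x $ 2) (\<lambda>x. (of_real m + \<i>) * green m g x $ 1 - g x $ 1)"
    by (rule primitive_on_cong[OF primitive_on_subset[OF P(2)]]) (auto simp: green_eq)
  show "primitive_on {..0} (\<lambda>x. green m g x $ 1) (\<lambda>x. (of_real m + \<i>) * green m g x $ 2 + g x $ 2)"
    by (rule primitive_on_cong[OF primitive_on_subset[OF P(3)]]) (auto simp: green_eq m)
  show "primitive_on {..0} (\<lambda>x. green m g x $ 2) (\<lambda>x. (of_real m - \<i>) * green m g x $ 1 - g x $ 1)"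
    by (rule primitive_on_cong[OF primitive_on_subset[OF P(4)]]) (auto simp: green_eq m)
qed

lemma continuous_green:
  assumes g: "admissible g" and m: "m > 0"
  shows "continuous_on UNIV (green m g)"
proof -
  have c: "continuous_on UNIV (branch1 m \<epsilon> g)" "continuous_on UNIV (branch2 m \<epsilon> g)" if "\<epsilon> = 1 \<or> \<epsilon> = -1" for \<epsilon>
    using branch_primitive[OF g that] by (auto intro: primitive_on_UNIV_continuous)
  have v: "(vector [a, b] :: complex^2) = (\<chi> i. if i = 1 then a else b)" for a b
    by (simp add: vec_eq_iff forall_2)
  have cv: "continuous_on UNIV (\<lambda>x. vector [branch1 m \<epsilon> g x, branch2 m \<epsilon> g x] :: complex^2)" if "\<epsilon> = 1 \<or> \<epsilon> = -1" for \<epsilon>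
    unfolding v
  proof (rule continuous_on_vec_lambda)
    fix i :: 2
    show "continuous_on UNIV (\<lambda>x. if i = 1 then branch1 m \<epsilon> g x else branch2 m \<epsilon> g x)"
      using c[OF that] by (cases "i = 1") auto
  qed
  have "continuous_on ({0..} \<union> {..0}) (\<lambda>x. if x \<ge> 0 then (vector [branch1 m 1 g x, branch2 m 1 g x] :: complex^2) else vector [branch1 m (-1) g x, branch2 m (-1) g x])"
  proof (rule continuous_on_If)
    show "continuous_on {0..} (\<lambda>x. vector [branch1 m 1 g x, branch2 m 1 g x] :: complex^2)"
      using cv[of 1] continuous_on_subset by blast
    show "continuous_on {..0} (\<lambda>x. vector [branch1 m (-1) g x, branch2 m (-1) g x] :: complex^2)"
      using cv[of "-1"] continuous_on_subset by blast
  qed (auto simp: branch_match[OF m])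
  moreover have "{0..} \<union> {..0} = (UNIV :: real set)" by auto
  moreover have "green m g = (\<lambda>x. if x \<ge> 0 then (vector [branch1 m 1 g x, branch2 m 1 g x] :: complex^2) else vector [branch1 m (-1) g x, branch2 m (-1) g x])"
    by (auto simp: green_def Let_def)
  ultimately show ?thesis by simp
qed

lemma green_add:
  assumes "admissible g" "admissible h"
  shows "green m (\<lambda>y. g y + h y) x = green m g x + green m h x"
proof -
  have E: "Eminus (kap m) (\<lambda>y. (g y + h y) $ i) x = Eminus (kap m) (\<lambda>y. g y $ i) x + Eminus (kap m) (\<lambda>y. h y $ i) x"
    "Eplus (kap m) (\<lambda>y. (g y + h y) $ i) x = Eplus (kap m) (\<lambda>y. g y $ i) x + Eplus (kap m) (\<lambda>y. h y $ i) x" for i x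
    unfolding vector_add_component
    by (intro Eminus_add Eplus_add admissible_component assms kap_ge_1)+
  have j: "jump1 m (\<lambda>y. g y + h y) = jump1 m g + jump1 m h" "jump2 m (\<lambda>y. g y + h y) = jump2 m g + jump2 m h"
    unfolding jump1_def jump2_def E by simp_all
  have r: "- ((u + u') - \<i> * k * (v + v')) / D = - (u - \<i> * k * v) / D + - (u' - \<i> * k * v') / D"
    "- ((u + u') + \<i> * k * (v + v')) / D = - (u + \<i> * k * v) / D + - (u' + \<i> * k * v') / D" for u v u' v' k D
    unfolding add_divide_distrib[symmetric] by (simp_all add: distrib_left)
  have cc: "coef1 m (\<lambda>y. g y + h y) = coef1 m g + coef1 m h" "coef2 m (\<lambda>y. g y + h y) = coef2 m g + coef2 m h"
    unfolding coef1_def coef2_def j by (rule r)+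
  have s: "((u + u') - (v + v')) / 2 + d * ((e + e') + (f + f')) + E * (n * (p + p') / k - l * (q + q'))
      = ((u - v) / 2 + d * (e + f) + E * (n * p / k - l * q)) + ((u' - v') / 2 + d * (e' + f') + E * (n * p' / k - l * q'))"
    "((u + u') - (v + v')) / 2 - d * ((e + e') + (f + f')) + E * (n * (p + p') / k - l * (q + q'))
      = ((u - v) / 2 - d * (e + f) + E * (n * p / k - l * q)) + ((u' - v') / 2 - d * (e' + f') + E * (n * p' / k - l * q'))"
    for u v u' v' d e e' f f' n p p' q q' l k E :: complex
    by (simp_all add: distrib_left right_diff_distrib add_divide_distrib diff_divide_distrib)
  have b: "branch1 m \<epsilon> (\<lambda>y. g y + h y) x = branch1 m \<epsilon> g x + branch1 m \<epsilon> h x"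
    "branch2 m \<epsilon> (\<lambda>y. g y + h y) x = branch2 m \<epsilon> g x + branch2 m \<epsilon> h x" for \<epsilon>
    unfolding branch1_def branch2_def cc E by (rule s)+
  show ?thesis by (simp add: green_def b vec_eq_iff forall_2 Let_def)
qed

lemma green_scale: "green m (\<lambda>y. c *s g y) x = c *s green m g x"
proof -
  have E: "Eminus (kap m) (\<lambda>y. (c *s g y) $ i) x = c * Eminus (kap m) (\<lambda>y. g y $ i) x"
    "Eplus (kap m) (\<lambda>y. (c *s g y) $ i) x = c * Eplus (kap m) (\<lambda>y. g y $ i) x" for i x
    by (simp_all only: vector_smult_component Eminus_cmult Eplus_cmult)
  have j: "jump1 m (\<lambda>y. c *s g y) = c * jump1 m g" "jump2 m (\<lambda>y. c *s g y) = c * jump2 m g"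
    unfolding jump1_def jump2_def E by (simp_all add: distrib_left right_diff_distrib)
  have r: "- (c * u - \<i> * k * (c * v)) / D = c * (- (u - \<i> * k * v) / D)"
    "- (c * u + \<i> * k * (c * v)) / D = c * (- (u + \<i> * k * v) / D)" for u v k D
    by (simp_all add: right_diff_distrib distrib_left mult_ac)
  have cc: "coef1 m (\<lambda>y. c *s g y) = c * coef1 m g" "coef2 m (\<lambda>y. c *s g y) = c * coef2 m g"
    unfolding coef1_def coef2_def j by (rule r)+
  have s: "(c * u - c * v) / 2 + d * (c * e + c * f) + E * (n * (c * p) / k - l * (c * q)) = c * ((u - v) / 2 + d * (e + f) + E * (n * p / k - l * q))"
    "(c * u - c * v) / 2 - d * (c * e + c * f) + E * (n * (c * p) / k - l * (c * q)) = c * ((u - v) / 2 - d * (e + f) + E * (n * p / k - l * q))"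
    for u v d e f n p q l k E
    by (simp_all add: right_diff_distrib distrib_left mult_ac diff_divide_distrib)
  have b: "branch1 m \<epsilon> (\<lambda>y. c *s g y) x = c * branch1 m \<epsilon> g x"
    "branch2 m \<epsilon> (\<lambda>y. c *s g y) x = c * branch2 m \<epsilon> g x" for \<epsilon>
    unfolding branch1_def branch2_def cc E by (rule s)+
  show ?thesis by (simp add: green_def b vec_eq_iff forall_2 Let_def)
qed

lemma green_cong_AE:
  assumes "admissible g" "admissible h" "AE y in lborel. g y = h y"
  shows "green m g x = green m h x"
proof -
  have ms: "(\<lambda>y. g y $ i) \<in> borel_measurable borel" "(\<lambda>y. h y $ i) \<in> borel_measurable borel" for i
    using admissible_component[OF assms(1)] admissible_component[OF assms(2)] by (auto simp: admissible_def)
  have ae: "AE y in lborel. g y $ i = h y $ i" for i using assms(3) by eventually_elim simp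
  note E = Eminus_cong_AE[OF ms ae] Eplus_cong_AE[OF ms ae]
  have j: "jump1 m g = jump1 m h" "jump2 m g = jump2 m h" unfolding jump1_def jump2_def by (simp_all add: E)
  have c: "coef1 m g = coef1 m h" "coef2 m g = coef2 m h" by (simp_all add: coef1_def coef2_def j)
  have b: "branch1 m \<epsilon> g x = branch1 m \<epsilon> h x" "branch2 m \<epsilon> g x = branch2 m \<epsilon> h x" for \<epsilon>
    unfolding branch1_def branch2_def by (simp_all add: c E)
  show ?thesis by (simp add: green_def b)
qed

lemma norm_vec2_le: "norm (v :: complex^2) \<le> norm (v $ 1) + norm (v $ 2)"
  unfolding norm_vec_def using L2_set_le_sum[of UNIV "\<lambda>i. norm (v $ i)"] by (simp add: sum_2)

definition green_const :: "real \<Rightarrow> real" where "green_const m = 4 + 4 * (1 + kap m) / m\<^sup>2"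

lemma green_const_pos: "green_const m \<ge> 4" 
  using kap_ge_1[of m] by (simp add: green_const_def)

lemma norm_coeff: "norm (of_real m - \<i>) = kap m" "norm (of_real m + \<i>) = kap m"
  by (simp_all add: cmod_def kap_def)

text \<open>Every term is dominated by the convolution at \<open>x\<close>, except for the correction at the origin, which is
dominated by its value at 0.\<close>

lemma green_bound:
  assumes g: "admissible g" and m: "m > 0"
  shows "norm (green m g x) \<le> green_const m * (conv (\<lambda>y. norm (g y)) x + exp (- \<bar>x\<bar>) * conv (\<lambda>y. norm (g y)) 0)"
proof -
  let ?e = "conv (\<lambda>y. norm (g y))"
  have mono: "conv (\<lambda>y. norm (g y $ i)) x \<le> ?e x" for x i
    unfolding conv_def
  proof (rule integral_mono)
    show "integrable lborel (\<lambda>y. exp (- \<bar>x - y\<bar>) * norm (g y $ i))"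
      using admissible_component[OF g] by (auto simp: admissible_def)
    show "integrable lborel (\<lambda>y. exp (- \<bar>x - y\<bar>) * norm (g y))" using g by (auto simp: admissible_def)
  qed (auto intro!: mult_left_mono Finite_Cartesian_Product.norm_nth_le)
  have EP: "norm (Eminus (kap m) (\<lambda>y. g y $ i) x) \<le> ?e x" "norm (Eplus (kap m) (\<lambda>y. g y $ i) x) \<le> ?e x" for i x
    using Eminus_integrable(2)[OF admissible_component[OF g] kap_ge_1, of m i x]
      Eplus_bound[OF admissible_component[OF g] kap_ge_1, of m i x] mono[of i x] by (auto intro: order_trans)
  have e0: "?e x \<ge> 0" for x unfolding conv_def by (intro integral_nonneg_AE AE_I2) auto
  have J: "norm (jump1 m g) \<le> 2 * ?e 0" "norm (jump2 m g) \<le> 2 * ?e 0"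
    unfolding jump1_def jump2_def norm_minus_cancel mult_2
    by (intro norm_triangle_mono EP)+
  have k1: "kap m \<ge> 1" by (rule kap_ge_1)
  have m2: "norm (2 * of_real (m\<^sup>2) :: complex) = 2 * m\<^sup>2" by (simp add: norm_mult norm_power)
  have kJ: "norm (\<i> * of_real (kap m) * j) = kap m * norm j" for j using k1 by (simp add: norm_mult)
  have num: "norm (j + l) \<le> (1 + kap m) * (2 * ?e 0)" "norm (j - l) \<le> (1 + kap m) * (2 * ?e 0)"
    if "norm j \<le> 2 * ?e 0" "norm l \<le> kap m * (2 * ?e 0)" for j l :: complex
    using norm_triangle_ineq[of j l] norm_triangle_ineq4[of j l] that by (auto simp: algebra_simps)
  have JK: "norm (\<i> * of_real (kap m) * jump1 m g) \<le> kap m * (2 * ?e 0)" "norm (\<i> * of_real (kap m) * jump2 m g) \<le> kap m * (2 * ?e 0)"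
    unfolding kJ using J k1 by (auto intro!: mult_left_mono)
  define D where "D = (1 + kap m) / m\<^sup>2 * ?e 0"
  have D0: "D \<ge> 0" unfolding D_def using k1 e0[of 0] by simp
  have C: "norm (coef1 m g) \<le> D" "norm (coef2 m g) \<le> D"
    unfolding coef1_def coef2_def norm_divide norm_minus_cancel m2 D_def
    using num(2)[OF J(1) JK(2)] num(1)[OF J(2) JK(1)] m by (auto simp: field_simps)
  have last: "norm (exp (- of_real (\<epsilon> * kap m) * of_real x) * (a * c / of_real (kap m) - of_real \<epsilon> * d)) \<le> exp (- \<bar>x\<bar>) * (2 * D)"
    if "norm a = kap m" "norm c \<le> D" "norm d \<le> D" "\<bar>\<epsilon>\<bar> = 1" "\<epsilon> * x = \<bar>x\<bar>" for a c d :: complex and \<epsilon>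
  proof -
    have "norm (exp (- of_real (\<epsilon> * kap m) * of_real x) :: complex) = exp (- (kap m * (\<epsilon> * x)))"
      by (simp add: mult_ac)
    also have "\<dots> \<le> exp (- \<bar>x\<bar>)" using k1 mult_right_mono[OF k1, of "\<bar>x\<bar>"] by (simp add: that(5))
    finally have 1: "norm (exp (- of_real (\<epsilon> * kap m) * of_real x) :: complex) \<le> exp (- \<bar>x\<bar>)" .
    have "norm (a * c / of_real (kap m) - of_real \<epsilon> * d) \<le> norm (a * c / of_real (kap m)) + norm (of_real \<epsilon> * d)"
      by (rule norm_triangle_ineq4)
    also have "norm (a * c / of_real (kap m)) = norm c" using that(1) k1 by (simp add: norm_mult norm_divide)
    also have "norm (of_real \<epsilon> * d) = norm d" using that(4) by (simp add: norm_mult)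
    finally have 2: "norm (a * c / of_real (kap m) - of_real \<epsilon> * d) \<le> 2 * D" using that by simp
    show ?thesis unfolding norm_mult by (rule mult_mono[OF 1 2]) auto
  qed
  have mid: "norm (a / (2 * of_real (kap m)) * (u + v)) \<le> ?e x" if "norm a = kap m" "norm u \<le> ?e x" "norm v \<le> ?e x" for a u v :: complex
  proof -
    have "norm (a / (2 * of_real (kap m)) * (u + v)) = norm (u + v) / 2" using that(1) k1 by (simp add: norm_mult norm_divide)
    also have "norm (u + v) \<le> ?e x + ?e x" using that norm_triangle_ineq[of u v] by simp
    finally show ?thesis by simp
  qed
  have fst: "norm ((u - v) / 2) \<le> ?e x" if "norm u \<le> ?e x" "norm v \<le> ?e x" for u v :: complex
    using that norm_triangle_ineq4[of u v] by (simp add: norm_divide)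
  define \<epsilon> :: real where "\<epsilon> = (if x \<ge> 0 then 1 else -1)"
  have \<epsilon>: "\<bar>\<epsilon>\<bar> = 1" "\<epsilon> * x = \<bar>x\<bar>" by (auto simp: \<epsilon>_def)
  have nc: "norm (of_real m - \<i> * of_real \<epsilon>) = kap m" "norm (of_real m + \<i> * of_real \<epsilon>) = kap m"
    by (auto simp: \<epsilon>_def norm_coeff)
  let ?S = "2 * ?e x + exp (- \<bar>x\<bar>) * (2 * D)"
  have B1: "norm (branch1 m \<epsilon> g x) \<le> ?S"
  proof -
    have "norm (branch1 m \<epsilon> g x) \<le> ?e x + ?e x + exp (- \<bar>x\<bar>) * (2 * D)"
      unfolding branch1_def by (intro norm_triangle_mono fst mid nc EP last C \<epsilon>)
    then show ?thesis by simp
  qed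
  have B2: "norm (branch2 m \<epsilon> g x) \<le> ?S"
  proof -
    have "norm (branch2 m \<epsilon> g x) \<le> ?e x + ?e x + exp (- \<bar>x\<bar>) * (2 * D)"
      unfolding branch2_def
      by (intro norm_triangle_mono order_trans[OF norm_triangle_ineq4 add_mono] fst mid nc EP last C \<epsilon>)
    then show ?thesis by simp
  qed
  have "norm (green m g x) \<le> norm (branch1 m \<epsilon> g x) + norm (branch2 m \<epsilon> g x)"
    using norm_vec2_le[of "green m g x"] by (simp add: green_def \<epsilon>_def Let_def split: if_splits)
  also have "\<dots> \<le> 4 * ?e x + exp (- \<bar>x\<bar>) * (4 * D)" using B1 B2 by simp
  also have "\<dots> \<le> green_const m * ?e x + exp (- \<bar>x\<bar>) * (green_const m * ?e 0)"
  proof (intro add_mono mult_left_mono mult_right_mono)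
    show "4 \<le> green_const m" by (rule green_const_pos)
    show "4 * D \<le> green_const m * ?e 0" unfolding D_def green_const_def using e0[of 0] by (simp add: algebra_simps)
  qed (auto simp: e0)
  finally show ?thesis by (simp add: algebra_simps)
qed

section \<open>Square integrable classes and the Green operator\<close>

lemma L2_rel_fun_of: "L2_rel (fun_of u) (fun_of u)"
  using Quotient3_rep_reflp[OF Quotient3_L2] .

lemma sq_fun_of: "sq_integrable (fun_of u)"
  using L2_rel_fun_of by (simp add: L2_rel_refl_iff)

lemma class_of_fun_of: "class_of (fun_of u) = u"
  using Quotient3_abs_rep[OF Quotient3_L2] .

lemma fun_of_class_of: "sq_integrable f \<Longrightarrow> AE x in lborel. fun_of (class_of f) x = f x"
  using Quotient3_rep_abs[OF Quotient3_L2, of f] by (simp add: L2_rel_def)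

lemma class_of_eqI: "sq_integrable f \<Longrightarrow> sq_integrable g \<Longrightarrow> AE x in lborel. f x = g x \<Longrightarrow> class_of f = class_of g"
  by (rule Quotient3_rel_abs[OF Quotient3_L2]) (simp add: L2_rel_def)

lemma L2_eqI: "AE x in lborel. fun_of u x = fun_of v x \<Longrightarrow> u = v"
  using class_of_eqI[OF sq_fun_of sq_fun_of, of u v] by (simp add: class_of_fun_of)

lemma measurable_fun_of[measurable]: "fun_of u \<in> borel_measurable borel"
  using sq_fun_of[of u] by (simp add: sq_integrable_def)

lemma fun_of_plus: "AE x in lborel. fun_of (u + v) x = fun_of u x + fun_of v x"
proof -
  have "u + v = class_of (\<lambda>x. fun_of u x + fun_of v x)"
    using plus_L2.abs_eq[OF L2_rel_fun_of L2_rel_fun_of, of u v] by (simp add: class_of_fun_of)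
  then show ?thesis using fun_of_class_of[OF sq_integrable_add[OF sq_fun_of sq_fun_of]] by simp
qed

lemma fun_of_minus: "AE x in lborel. fun_of (u - v) x = fun_of u x - fun_of v x"
proof -
  have "u - v = class_of (\<lambda>x. fun_of u x - fun_of v x)"
    using minus_L2.abs_eq[OF L2_rel_fun_of L2_rel_fun_of, of u v] by (simp add: class_of_fun_of)
  then show ?thesis using fun_of_class_of[OF sq_integrable_diff[OF sq_fun_of sq_fun_of]] by simp
qed

lemma fun_of_scaleC: "AE x in lborel. fun_of (c *\<^sub>C u) x = c *s fun_of u x"
proof -
  have "c *\<^sub>C u = class_of (\<lambda>x. c *s fun_of u x)"
    using scaleC.abs_eq[OF L2_rel_fun_of, of c u] by (simp add: class_of_fun_of)
  then show ?thesis using fun_of_class_of[OF sq_integrable_scale[OF sq_fun_of]] by simp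
qed

lemma fun_of_zero: "AE x in lborel. fun_of 0 x = 0"
  using fun_of_class_of[OF sq_integrable_zero] by (simp add: zero_L2_def)

lemma norm_L2_square: "(norm (u :: L2))\<^sup>2 = (LINT x|lborel. (norm (fun_of u x))\<^sup>2)"
proof -
  have "(norm u)\<^sup>2 = u \<bullet> u" by (simp add: norm_eq_sqrt_inner)
  also have "\<dots> = class_of (fun_of u) \<bullet> class_of (fun_of u)" by (simp add: class_of_fun_of)
  also have "\<dots> = (LINT x|lborel. fun_of u x \<bullet> fun_of u x)"
    by (rule inner_L2.abs_eq[OF L2_rel_fun_of L2_rel_fun_of])
  finally show ?thesis by (simp add: power2_norm_eq_inner)
qed

lemma norm_class_of:
  assumes "sq_integrable f"
  shows "(norm (class_of f))\<^sup>2 = (LINT x|lborel. (norm (f x))\<^sup>2)"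
  unfolding norm_L2_square
  by (rule integral_cong_AE) (use fun_of_class_of[OF assms] assms in \<open>auto simp: sq_integrable_def elim: eventually_mono\<close>)

lemma norm_class_of_le:
  assumes "sq_integrable f" "(LINT x|lborel. (norm (f x))\<^sup>2) \<le> C\<^sup>2" "C \<ge> 0"
  shows "norm (class_of f) \<le> C"
  using norm_class_of[OF assms(1)] assms(2,3) by (metis power2_le_imp_le)

definition green_norm :: "real \<Rightarrow> real" where "green_norm m = 4 * green_const m"

lemma green_norm_pos: "green_norm m > 0" using green_const_pos[of m] by (simp add: green_norm_def)

lemma measurable_green: "admissible g \<Longrightarrow> m > 0 \<Longrightarrow> green m g \<in> borel_measurable borel"
  by (rule borel_measurable_continuous_onI[OF continuous_green])

text \<open>The two hypotheses on the convolution hold for integrable and for square integrable sources, with \<open>I\<close>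
the respective norm.\<close>

lemma green_square_bound:
  assumes g: "admissible g" and m: "m > 0"
    and i: "integrable lborel (\<lambda>x. (conv (\<lambda>y. norm (g y)) x)\<^sup>2)"
    and le: "(LINT x|lborel. (conv (\<lambda>y. norm (g y)) x)\<^sup>2) \<le> 4 * I\<^sup>2" "(conv (\<lambda>y. norm (g y)) 0)\<^sup>2 \<le> 2 * I\<^sup>2"
  shows "sq_integrable (green m g)" "(LINT x|lborel. (norm (green m g x))\<^sup>2) \<le> (green_norm m * I)\<^sup>2"
proof -
  let ?e = "conv (\<lambda>y. norm (g y))"
  let ?K = "green_const m"
  have K: "?K \<ge> 0" using green_const_pos[of m] by simp
  have e0: "?e x \<ge> 0" for x unfolding conv_def by (intro integral_nonneg_AE AE_I2) auto
  have pt: "(norm (green m g x))\<^sup>2 \<le> 2 * ?K\<^sup>2 * (?e x)\<^sup>2 + (2 * ?K\<^sup>2 * (?e 0)\<^sup>2) * exp (- \<bar>0 - x\<bar>)" for x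
  proof -
    have "(norm (green m g x))\<^sup>2 \<le> (?K * (?e x + exp (- \<bar>x\<bar>) * ?e 0))\<^sup>2"
      by (rule power_mono[OF green_bound[OF g m]]) simp
    also have "\<dots> = ?K\<^sup>2 * (?e x + exp (- \<bar>x\<bar>) * ?e 0)\<^sup>2" by (simp add: power_mult_distrib)
    also have "\<dots> \<le> ?K\<^sup>2 * (2 * (?e x)\<^sup>2 + 2 * ((?e 0)\<^sup>2 * exp (- \<bar>x\<bar>)))"
    proof (rule mult_left_mono)
      have "(a + b)\<^sup>2 \<le> 2 * a\<^sup>2 + 2 * b\<^sup>2" for a b :: real
        using zero_le_power2[of "a - b"] by (simp add: power2_eq_square algebra_simps)
      then have "(?e x + exp (- \<bar>x\<bar>) * ?e 0)\<^sup>2 \<le> 2 * (?e x)\<^sup>2 + 2 * (exp (- \<bar>x\<bar>) * ?e 0)\<^sup>2" .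
      also have "(exp (- \<bar>x\<bar>) * ?e 0)\<^sup>2 = (exp (- \<bar>x\<bar>))\<^sup>2 * (?e 0)\<^sup>2" by (rule power_mult_distrib)
      also have "\<dots> \<le> exp (- \<bar>x\<bar>) * (?e 0)\<^sup>2"
        by (rule mult_right_mono) (auto simp: power2_eq_square mult_left_le_one_le)
      finally show "(?e x + exp (- \<bar>x\<bar>) * ?e 0)\<^sup>2 \<le> 2 * (?e x)\<^sup>2 + 2 * ((?e 0)\<^sup>2 * exp (- \<bar>x\<bar>))"
        by (simp add: mult.commute)
    qed simp
    finally show ?thesis by (simp add: algebra_simps)
  qed
  have IB: "integrable lborel (\<lambda>x. 2 * ?K\<^sup>2 * (?e x)\<^sup>2 + (2 * ?K\<^sup>2 * (?e 0)\<^sup>2) * exp (- \<bar>0 - x\<bar>))"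
    using i exp_abs_integral(1)[of 0] by (intro Bochner_Integration.integrable_add integrable_mult_right) auto
  have [measurable]: "green m g \<in> borel_measurable borel" by (rule measurable_green[OF g m])
  have IG: "integrable lborel (\<lambda>x. (norm (green m g x))\<^sup>2)"
    by (rule Bochner_Integration.integrable_bound[OF IB]) (use pt in \<open>auto intro!: AE_I2 order_trans[OF pt]\<close>)
  then show "sq_integrable (green m g)" by (simp add: sq_integrable_def)
  have "(LINT x|lborel. (norm (green m g x))\<^sup>2) \<le> (LINT x|lborel. 2 * ?K\<^sup>2 * (?e x)\<^sup>2 + (2 * ?K\<^sup>2 * (?e 0)\<^sup>2) * exp (- \<bar>0 - x\<bar>))"
    by (rule integral_mono[OF IG IB pt])
  also have "\<dots> = 2 * ?K\<^sup>2 * (LINT x|lborel. (?e x)\<^sup>2) + (2 * ?K\<^sup>2 * (?e 0)\<^sup>2) * 2"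
    using i exp_abs_integral[of 0] by (subst Bochner_Integration.integral_add) auto
  also have "\<dots> \<le> 2 * ?K\<^sup>2 * (4 * I\<^sup>2) + (2 * ?K\<^sup>2 * (2 * I\<^sup>2)) * 2"
    using le by (intro add_mono mult_left_mono mult_right_mono) auto
  finally show "(LINT x|lborel. (norm (green m g x))\<^sup>2) \<le> (green_norm m * I)\<^sup>2"
    by (simp add: green_norm_def power_mult_distrib mult_ac)
qed

lemma green_L1:
  fixes g :: "real \<Rightarrow> complex^2"
  assumes g: "integrable lborel g" and m: "m > 0"
  defines "I \<equiv> (LINT y|lborel. norm (g y))"
  shows "norm (green m g x) \<le> green_norm m * I" "sq_integrable (green m g)"
    "(LINT x|lborel. (norm (green m g x))\<^sup>2) \<le> (green_norm m * I)\<^sup>2"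
proof -
  let ?e = "conv (\<lambda>y. norm (g y))"
  have ng: "integrable lborel (\<lambda>y. norm (g y))" using g by simp
  note c = conv_L1[OF ng norm_ge_zero, folded I_def]
  have I0: "I \<ge> 0" unfolding I_def by simp
  have adm: "admissible g" by (rule admissible_L1[OF g])
  have K: "green_const m \<ge> 0" using green_const_pos[of m] by simp
  have "norm (green m g x) \<le> green_const m * (?e x + exp (- \<bar>x\<bar>) * ?e 0)" by (rule green_bound[OF adm m])
  also have "\<dots> \<le> green_const m * (I + 1 * I)"
    using c(2,3) K by (intro mult_left_mono add_mono mult_mono) auto
  also have "\<dots> \<le> green_norm m * I" using K I0 by (simp add: green_norm_def)
  finally show "norm (green m g x) \<le> green_norm m * I" .
  have sq: "(?e x)\<^sup>2 \<le> I * ?e x" for x using c(2,3)[of x] by (simp add: power2_eq_square mult_right_mono)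
  have [measurable]: "?e \<in> borel_measurable borel" using borel_measurable_integrable[OF c(4)] by simp
  have ie: "integrable lborel (\<lambda>x. I * ?e x)" using c(4) by simp
  have i2: "integrable lborel (\<lambda>x. (?e x)\<^sup>2)"
    by (rule Bochner_Integration.integrable_bound[OF ie]) (use sq in \<open>auto intro!: AE_I2 order_trans[OF sq]\<close>)
  have l1: "(LINT x|lborel. (?e x)\<^sup>2) \<le> 4 * I\<^sup>2"
  proof -
    have "(LINT x|lborel. (?e x)\<^sup>2) \<le> (LINT x|lborel. I * ?e x)" by (rule integral_mono[OF i2 ie sq])
    also have "\<dots> = I * (2 * I)" using c(5) by simp
    also have "\<dots> \<le> 4 * I\<^sup>2" using I0 by (simp add: power2_eq_square)
    finally show ?thesis .
  qed
  have "(?e 0)\<^sup>2 \<le> I\<^sup>2" by (rule power_mono[OF c(3) c(2)])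
  also have "\<dots> \<le> 2 * I\<^sup>2" by simp
  finally have l2: "(?e 0)\<^sup>2 \<le> 2 * I\<^sup>2" .
  show "sq_integrable (green m g)" "(LINT x|lborel. (norm (green m g x))\<^sup>2) \<le> (green_norm m * I)\<^sup>2"
    by (rule green_square_bound[OF adm m i2 l1 l2])+
qed

lemma green_L2:
  assumes g: "sq_integrable g" and m: "m > 0" and I: "(LINT y|lborel. (norm (g y))\<^sup>2) = I\<^sup>2" "I \<ge> 0"
  shows "admissible g" "norm (green m g x) \<le> green_norm m * I" "sq_integrable (green m g)"
    "(LINT x|lborel. (norm (green m g x))\<^sup>2) \<le> (green_norm m * I)\<^sup>2"
proof -
  let ?e = "conv (\<lambda>y. norm (g y))"
  let ?c = "conv (\<lambda>y. (norm (g y))\<^sup>2)"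
  have [measurable]: "g \<in> borel_measurable borel" and g2: "integrable lborel (\<lambda>y. (norm (g y))\<^sup>2)"
    using g by (auto simp: sq_integrable_def)
  show adm: "admissible g" by (rule admissible_L2) (use g2 in auto)
  note c = conv_L1[OF g2 zero_le_power2, unfolded I(1)]
  have sq: "(?e x)\<^sup>2 \<le> 2 * ?c x" for x using conv_square_le(2)[of "\<lambda>y. norm (g y)"] g2 by simp
  have sqI: "(?e x)\<^sup>2 \<le> 2 * I\<^sup>2" for x using sq[of x] c(3)[of x] by simp
  have e0: "?e x \<ge> 0" for x unfolding conv_def by (intro integral_nonneg_AE AE_I2) auto
  have e2: "?e x \<le> 2 * I" for x
  proof -
    have "(?e x)\<^sup>2 \<le> (2 * I)\<^sup>2" 
    proof -
      have "(2 * I)\<^sup>2 = 4 * I\<^sup>2" by (simp add: power_mult_distrib)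
      then show ?thesis using sqI[of x] zero_le_power2[of I] by linarith
    qed
    then show ?thesis using I(2) by (auto intro: power2_le_imp_le)
  qed
  have K: "green_const m \<ge> 0" using green_const_pos[of m] by simp
  have "norm (green m g x) \<le> green_const m * (?e x + exp (- \<bar>x\<bar>) * ?e 0)" by (rule green_bound[OF adm m])
  also have "\<dots> \<le> green_const m * (2 * I + 1 * (2 * I))"
    using e2 e0 K by (intro mult_left_mono add_mono mult_mono) auto
  also have "\<dots> = green_norm m * I" by (simp add: green_norm_def)
  finally show "norm (green m g x) \<le> green_norm m * I" .
  have [measurable]: "?e \<in> borel_measurable borel"
    unfolding conv_def[abs_def] by measurable
  have ie: "integrable lborel (\<lambda>x. 2 * ?c x)" using c(4) by simp
  have i2: "integrable lborel (\<lambda>x. (?e x)\<^sup>2)"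
    by (rule Bochner_Integration.integrable_bound[OF ie]) (use sq in \<open>auto intro!: AE_I2 order_trans[OF sq]\<close>)
  have l1: "(LINT x|lborel. (?e x)\<^sup>2) \<le> 4 * I\<^sup>2"
  proof -
    have "(LINT x|lborel. (?e x)\<^sup>2) \<le> (LINT x|lborel. 2 * ?c x)" by (rule integral_mono[OF i2 ie sq])
    also have "\<dots> = 4 * I\<^sup>2" using c(5) by simp
    finally show ?thesis .
  qed
  show "sq_integrable (green m g)" "(LINT x|lborel. (norm (green m g x))\<^sup>2) \<le> (green_norm m * I)\<^sup>2"
    by (rule green_square_bound[OF adm m i2 l1 sqI])+
qed

section \<open>Weak derivatives and the free operator\<close>

lemma primitive_exists:
  assumes I: "\<And>a b. a \<le> b \<Longrightarrow> set_integrable lborel {a..b} \<phi>"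
  shows "\<exists>F. primitive_on UNIV F \<phi>"
proof -
  define F where "F = (\<lambda>x. if x \<ge> 0 then (LINT t:{0..x}|lborel. \<phi> t) else - (LINT t:{x..0}|lborel. \<phi> t))"
  have add: "(LINT t:{a..c}|lborel. \<phi> t) = (LINT t:{a..b}|lborel. \<phi> t) + (LINT t:{b..c}|lborel. \<phi> t)"
    if "a \<le> b" "b \<le> c" for a b c
  proof -
    have un: "{a..c} = {a..b} \<union> {b..c}" using that by auto
    have "AE y in lborel. \<not> (y \<in> {a..b} \<and> y \<in> {b..c})"
      using AE_lborel_singleton[of b] by eventually_elim auto
    from set_integral_Un_AE[OF this _ _ I I] show ?thesis using that by (simp add: un)
  qed
  have "F b - F a = (LINT x:{a..b}|lborel. \<phi> x)" if "a \<le> b" for a b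
  proof -
    consider "0 \<le> a" | "b < 0" | "a < 0" "0 \<le> b" by linarith
    then show ?thesis
    proof cases
      case 1 then show ?thesis using that add[of 0 a b] by (simp add: F_def)
    next
      case 2 then show ?thesis using that add[of a b 0] by (simp add: F_def)
    next
      case 3 then show ?thesis using add[of a 0 b] by (simp add: F_def)
    qed
  qed
  then have "primitive_on UNIV F \<phi>" using I by (simp add: primitive_on_def)
  then show ?thesis by blast
qed

lemma weak_deriv_test_fun:
  "weak_deriv u w \<longleftrightarrow> (\<forall>\<phi> \<phi>'. test_fun \<phi> \<phi>' \<longrightarrow>
     (LINT x|lborel. \<phi>' x *\<^sub>R fun_of u x) = - (LINT x|lborel. \<phi> x *\<^sub>R fun_of w x))"
  unfolding weak_deriv_def test_fun_def by blast

lemma test_fun_continuous: "test_fun \<phi> \<phi>' \<Longrightarrow> continuous_on UNIV \<phi>" "test_fun \<phi> \<phi>' \<Longrightarrow> continuous_on UNIV \<phi>'"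
  unfolding test_fun_def by (meson DERIV_isCont continuous_at_imp_continuous_on, blast)

lemma integrable_cont_times_L2:
  fixes f :: "real \<Rightarrow> complex^2"
  assumes f: "sq_integrable f" and c: "continuous_on UNIV \<psi>" and z: "\<And>x. \<bar>x\<bar> \<ge> R \<Longrightarrow> \<psi> x = 0"
  shows "integrable lborel (\<lambda>x. \<psi> x *\<^sub>R f x)"
proof (rule Bochner_Integration.integrable_bound)
  have [measurable]: "\<psi> \<in> borel_measurable borel" using c by (rule borel_measurable_continuous_onI)
  have [measurable]: "f \<in> borel_measurable borel" using f by (simp add: sq_integrable_def)
  have s: "set_integrable lborel {-R..R} (\<lambda>x. (\<psi> x)\<^sup>2)"
    by (rule integrable_lborel_continuous) (intro continuous_intros continuous_on_subset[OF c]; simp)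
  have e: "(\<lambda>x. indicator {-R..R} x *\<^sub>R (\<psi> x)\<^sup>2) = (\<lambda>x. (\<psi> x)\<^sup>2)"
    using z by (intro ext) (auto split: split_indicator)
  have "integrable lborel (\<lambda>x. (\<psi> x)\<^sup>2)" using s unfolding set_integrable_def e .
  then show "integrable lborel (\<lambda>x. (\<psi> x)\<^sup>2 + (norm (f x))\<^sup>2)" using f by (simp add: sq_integrable_def)
  show "(\<lambda>x. \<psi> x *\<^sub>R f x) \<in> borel_measurable lborel" by simp
  have "a * b \<le> a\<^sup>2 + b\<^sup>2" if "a \<ge> 0" "b \<ge> 0" for a b :: real
  proof -
    have "2 * (a * b) \<le> a\<^sup>2 + b\<^sup>2" using zero_le_power2[of "a - b"] by (simp add: power2_eq_square algebra_simps)
    moreover have "0 \<le> a * b" using that by simp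
    ultimately show ?thesis by linarith
  qed
  from this[of "\<bar>\<psi> _\<bar>" "norm (f _)"]
  show "AE x in lborel. norm (\<psi> x *\<^sub>R f x) \<le> norm ((\<psi> x)\<^sup>2 + (norm (f x))\<^sup>2)"
    by (intro AE_I2) simp
qed

lemma integral_vec_nth:
  fixes f :: "real \<Rightarrow> complex^2"
  assumes "integrable M f"
  shows "(LINT x|M. f x) $ i = (LINT x|M. f x $ i)" "integrable M (\<lambda>x. f x $ i)"
proof -
  have b: "bounded_linear (\<lambda>v :: complex^2. v $ i)" by (rule bounded_linear_vec_nth)
  show "(LINT x|M. f x) $ i = (LINT x|M. f x $ i)" using integral_bounded_linear[OF b assms] by simp
  show "integrable M (\<lambda>x. f x $ i)" using integrable_bounded_linear[OF b assms] .
qed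

lemma sq_integrable_local:
  fixes f :: "real \<Rightarrow> complex^2"
  assumes f: "sq_integrable f"
  shows "set_integrable lborel {a..b} (\<lambda>x. f x $ i)"
  unfolding set_integrable_def
proof (rule Bochner_Integration.integrable_bound)
  have [measurable]: "f \<in> borel_measurable borel" using f by (simp add: sq_integrable_def)
  show "integrable lborel (\<lambda>x. indicator {a..b} x + (norm (f x))\<^sup>2)"
    using f integrable_real_indicator[of "{a..b}" lborel]
    by (intro Bochner_Integration.integrable_add) (auto simp: sq_integrable_def emeasure_lborel_Icc_eq)
  show "(\<lambda>x. indicator {a..b} x *\<^sub>R f x $ i) \<in> borel_measurable lborel" by measurable
  have sq: "t \<le> 1 + t\<^sup>2" for t :: real
    using zero_le_power2[of "t - 1"] zero_le_power2[of t] zero_le_power2[of "t + 1"]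
    by (simp add: power2_eq_square algebra_simps)
  have "norm (f x $ i) \<le> 1 + (norm (f x))\<^sup>2" for x
    using Finite_Cartesian_Product.norm_nth_le[of "f x" i] sq[of "norm (f x)"] by linarith
  then show "AE x in lborel. norm (indicator {a..b} x *\<^sub>R f x $ i) \<le> norm (indicator {a..b} x + (norm (f x))\<^sup>2)"
    by (intro AE_I2) (auto split: split_indicator)
qed

text \<open>By integration by parts a primitive of the weak derivative has the same distributional derivative as
\<open>u\<close>, so the two differ by a constant.\<close>

lemma weak_deriv_primitive:
  assumes wd: "weak_deriv u w"
  shows "\<exists>F :: real \<Rightarrow> complex^2. (\<forall>i. primitive_on UNIV (\<lambda>x. F x $ i) (\<lambda>x. fun_of w x $ i)) \<and> (AE x in lborel. fun_of u x = F x)"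
proof -
  have comp: "\<exists>F. primitive_on UNIV F (\<lambda>x. fun_of w x $ i) \<and> (AE x in lborel. fun_of u x $ i = F x)" for i
  proof -
    obtain F where F: "primitive_on UNIV F (\<lambda>x. fun_of w x $ i)"
      using primitive_exists[OF sq_integrable_local[OF sq_fun_of]] by blast
    have cF: "continuous_on UNIV F" by (rule primitive_on_UNIV_continuous[OF F])
    have "\<exists>K. AE x in lborel. fun_of u x $ i - F x = K"
    proof (rule du_Bois_Reymond)
      fix a b :: real assume "a \<le> b"
      show "set_integrable lborel {a..b} (\<lambda>x. fun_of u x $ i - F x)"
        by (intro set_integral_diff sq_integrable_local sq_fun_of integrable_lborel_continuous continuous_on_subset[OF cF]) simp
    next
      fix \<phi> \<phi>' assume t: "test_fun \<phi> \<phi>'"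
      obtain R where R: "R > 0" "\<And>x. \<bar>x\<bar> \<ge> R \<Longrightarrow> \<phi> x = 0" "\<And>x. \<bar>x\<bar> \<ge> R \<Longrightarrow> \<phi>' x = 0"
        using test_fun_support[OF t] by blast
      note c = test_fun_continuous[OF t]
      have Iu: "integrable lborel (\<lambda>x. \<phi>' x *\<^sub>R fun_of u x)" by (rule integrable_cont_times_L2[OF sq_fun_of c(2) R(3)])
      have Iw: "integrable lborel (\<lambda>x. \<phi> x *\<^sub>R fun_of w x)" by (rule integrable_cont_times_L2[OF sq_fun_of c(1) R(2)])
      have "(LINT x|lborel. \<phi>' x *\<^sub>R fun_of u x) $ i = - (LINT x|lborel. \<phi> x *\<^sub>R fun_of w x) $ i"
        using wd t by (simp add: weak_deriv_test_fun)
      then have e: "(LINT x|lborel. \<phi>' x *\<^sub>R (fun_of u x $ i)) = - (LINT x|lborel. \<phi> x *\<^sub>R (fun_of w x $ i))"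
        using integral_vec_nth(1)[OF Iu, of i] integral_vec_nth(1)[OF Iw, of i] by simp
      have i1: "integrable lborel (\<lambda>x. \<phi>' x *\<^sub>R (fun_of u x $ i))" using integral_vec_nth(2)[OF Iu, of i] by simp
      note p = primitive_test_by_parts[OF F t]
      have "(LINT x|lborel. \<phi>' x *\<^sub>R (fun_of u x $ i - F x)) = (LINT x|lborel. \<phi>' x *\<^sub>R (fun_of u x $ i) - \<phi>' x *\<^sub>R F x)"
        by (simp add: scaleR_diff_right)
      also have "\<dots> = (LINT x|lborel. \<phi>' x *\<^sub>R (fun_of u x $ i)) - (LINT x|lborel. \<phi>' x *\<^sub>R F x)"
        by (rule Bochner_Integration.integral_diff[OF i1 p(1)])
      also have "\<dots> = 0" using e p(3) by simp
      finally show "(LINT x|lborel. \<phi>' x *\<^sub>R (fun_of u x $ i - F x)) = 0" .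
    qed
    then obtain K where K: "AE x in lborel. fun_of u x $ i - F x = K" by blast
    have "primitive_on UNIV (\<lambda>x. F x + K) (\<lambda>x. fun_of w x $ i + 0)" by (rule primitive_on_add[OF F primitive_on_const])
    moreover have "AE x in lborel. fun_of u x $ i = F x + K" using K by eventually_elim (simp add: algebra_simps)
    ultimately show ?thesis by (intro exI[of _ "\<lambda>x. F x + K"]) simp
  qed
  obtain G where G: "\<And>i. primitive_on UNIV (G i) (\<lambda>x. fun_of w x $ i)" "\<And>i. AE x in lborel. fun_of u x $ i = G i x"
    using comp by metis
  have "AE x in lborel. fun_of u x $ 1 = G 1 x \<and> fun_of u x $ 2 = G 2 x" using G(2)[of 1] G(2)[of 2] by eventually_elim simp
  then have "AE x in lborel. fun_of u x = (\<chi> i. G i x)"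
    by eventually_elim (simp add: vec_eq_iff forall_2)
  then show ?thesis using G(1) by (intro exI[of _ "\<lambda>x. \<chi> i. G i x"]) simp
qed

lemma primitive_weak_deriv:
  fixes F W :: "real \<Rightarrow> complex^2"
  assumes F: "\<And>i. primitive_on UNIV (\<lambda>x. F x $ i) (\<lambda>x. W x $ i)" and sq: "sq_integrable F" "sq_integrable W"
  shows "weak_deriv (class_of F) (class_of W)"
  unfolding weak_deriv_test_fun
proof (intro allI impI)
  fix \<phi> \<phi>' assume t: "test_fun \<phi> \<phi>'"
  obtain R where R: "R > 0" "\<And>x. \<bar>x\<bar> \<ge> R \<Longrightarrow> \<phi> x = 0" "\<And>x. \<bar>x\<bar> \<ge> R \<Longrightarrow> \<phi>' x = 0"
    using test_fun_support[OF t] by blast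
  note c = test_fun_continuous[OF t]
  have IF: "integrable lborel (\<lambda>x. \<phi>' x *\<^sub>R F x)" by (rule integrable_cont_times_L2[OF sq(1) c(2) R(3)])
  have IW: "integrable lborel (\<lambda>x. \<phi> x *\<^sub>R W x)" by (rule integrable_cont_times_L2[OF sq(2) c(1) R(2)])
  have [measurable]: "\<phi> \<in> borel_measurable borel" "\<phi>' \<in> borel_measurable borel" using c by (auto intro: borel_measurable_continuous_onI)
  have [measurable]: "F \<in> borel_measurable borel" "W \<in> borel_measurable borel" using sq by (auto simp: sq_integrable_def)
  have 1: "(LINT x|lborel. \<phi>' x *\<^sub>R fun_of (class_of F) x) = (LINT x|lborel. \<phi>' x *\<^sub>R F x)"
    by (rule integral_cong_AE) (use fun_of_class_of[OF sq(1)] in \<open>auto elim: eventually_mono\<close>)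
  have 2: "(LINT x|lborel. \<phi> x *\<^sub>R fun_of (class_of W) x) = (LINT x|lborel. \<phi> x *\<^sub>R W x)"
    by (rule integral_cong_AE) (use fun_of_class_of[OF sq(2)] in \<open>auto elim: eventually_mono\<close>)
  have "(LINT x|lborel. \<phi>' x *\<^sub>R F x) $ i = (- (LINT x|lborel. \<phi> x *\<^sub>R W x)) $ i" for i
    using primitive_test_by_parts(3)[OF F[of i] t] by (simp add: integral_vec_nth[OF IF] integral_vec_nth[OF IW])
  then show "(LINT x|lborel. \<phi>' x *\<^sub>R fun_of (class_of F) x) = - (LINT x|lborel. \<phi> x *\<^sub>R fun_of (class_of W) x)"
    unfolding 1 2 by (simp add: vec_eq_iff)
qed

lemma measurable_vector2[measurable (raw)]:
  assumes "f \<in> borel_measurable M" "g \<in> borel_measurable M"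
  shows "(\<lambda>x. vector [f x, g x] :: complex^2) \<in> borel_measurable M"
proof -
  have v: "(vector [fst p, snd p] :: complex^2) = (\<chi> i. if i = 1 then fst p else snd p)" for p
    by (simp add: vec_eq_iff forall_2)
  have c: "continuous_on UNIV (\<lambda>p :: complex \<times> complex. vector [fst p, snd p] :: complex^2)"
    unfolding v
  proof (rule continuous_on_vec_lambda)
    fix i :: 2
    show "continuous_on UNIV (\<lambda>p :: complex \<times> complex. if i = 1 then fst p else snd p)"
      by (cases "i = 1") (auto intro!: continuous_intros)
  qed
  have "(\<lambda>x. (f x, g x)) \<in> borel_measurable M" using assms by simp
  from measurable_compose[OF this borel_measurable_continuous_onI[OF c]] show ?thesis by simp
qed

lemma norm_vec2_square: "(norm (v :: complex^2))\<^sup>2 = (norm (v $ 1))\<^sup>2 + (norm (v $ 2))\<^sup>2"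
  by (simp add: norm_vec_def L2_set_def sum_2 add_nonneg_nonneg)

lemma sq_integrable_bound:
  assumes a: "sq_integrable a" and b: "sq_integrable b" and [measurable]: "f \<in> borel_measurable borel"
    and le: "\<And>x. norm (f x) \<le> C * (norm (a x) + norm (b x))"
  shows "sq_integrable f"
  unfolding sq_integrable_def
proof
  show "f \<in> borel_measurable lborel" by simp
  have I: "integrable lborel (\<lambda>x. C\<^sup>2 * (2 * (norm (a x))\<^sup>2 + 2 * (norm (b x))\<^sup>2))"
    using a b by (auto simp: sq_integrable_def)
  show "integrable lborel (\<lambda>x. (norm (f x))\<^sup>2)"
  proof (rule Bochner_Integration.integrable_bound[OF I])
    have "(norm (f x))\<^sup>2 \<le> C\<^sup>2 * (2 * (norm (a x))\<^sup>2 + 2 * (norm (b x))\<^sup>2)" for x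
    proof -
      have "(norm (f x))\<^sup>2 \<le> (C * (norm (a x) + norm (b x)))\<^sup>2" by (rule power_mono[OF le]) simp
      also have "\<dots> = C\<^sup>2 * (norm (a x) + norm (b x))\<^sup>2" by (rule power_mult_distrib)
      also have "\<dots> \<le> C\<^sup>2 * (2 * (norm (a x))\<^sup>2 + 2 * (norm (b x))\<^sup>2)"
        by (rule mult_left_mono) (use zero_le_power2[of "norm (a x) - norm (b x)"] in \<open>simp_all add: power2_eq_square algebra_simps\<close>)
      finally show ?thesis .
    qed
    then show "AE x in lborel. norm ((norm (f x))\<^sup>2) \<le> norm (C\<^sup>2 * (2 * (norm (a x))\<^sup>2 + 2 * (norm (b x))\<^sup>2))"
      by (intro AE_I2) (metis abs_ge_self order_trans real_norm_def abs_of_nonneg zero_le_power2)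
  qed simp
qed

lemma sq_integrable_cong_AE:
  assumes a: "sq_integrable a" and [measurable]: "b \<in> borel_measurable borel" and e: "AE x in lborel. a x = b x"
  shows "sq_integrable b"
  unfolding sq_integrable_def
proof
  have [measurable]: "a \<in> borel_measurable borel" using a by (simp add: sq_integrable_def)
  show "integrable lborel (\<lambda>x. (norm (b x))\<^sup>2)"
    by (rule integrable_cong_AE_imp[of _ "\<lambda>x. (norm (a x))\<^sup>2"]) (use a e in \<open>auto simp: sq_integrable_def elim: eventually_mono\<close>)
qed simp

text \<open>The inverse of the free operator, that is, its resolvent at the base point \<open>z = 0\<close>.\<close>

definition free_inverse :: "real \<Rightarrow> L2 \<Rightarrow> L2" where
  "free_inverse m g = class_of (green m (fun_of g))"

lemma green_fun_of:
  assumes m: "m > 0"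
  shows "admissible (fun_of g)" "norm (green m (fun_of g) x) \<le> green_norm m * norm g"
    "sq_integrable (green m (fun_of g))" "norm (free_inverse m g) \<le> green_norm m * norm g"
proof -
  note G = green_L2[OF sq_fun_of m norm_L2_square[symmetric] norm_ge_zero, of g]
  show "admissible (fun_of g)" "norm (green m (fun_of g) x) \<le> green_norm m * norm g"
    "sq_integrable (green m (fun_of g))" by (rule G)+
  show "norm (free_inverse m g) \<le> green_norm m * norm g"
    unfolding free_inverse_def
    by (rule norm_class_of_le[OF G(3,4)]) (use green_norm_pos[of m] in simp)
qed

lemma op_L0_free_inverse:
  assumes m: "m > 0"
  shows "(free_inverse m g, g) \<in> op_L0 m"
proof -
  let ?g = "fun_of g" and ?G = "green m (fun_of g)"
  note gf = green_fun_of[OF m, of g]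
  have [measurable]: "?G \<in> borel_measurable borel" using gf(3) by (simp add: sq_integrable_def)
  define W :: "real \<Rightarrow> complex^2" where "W = (\<lambda>x. vector [(of_real m - \<i> * of_real (sgn x)) * ?G x $ 2 + ?g x $ 2,
      (of_real m + \<i> * of_real (sgn x)) * ?G x $ 1 - ?g x $ 1])"
  have [measurable]: "(\<lambda>x::real. complex_of_real (sgn x)) \<in> borel_measurable borel" by measurable
  have [measurable]: "W \<in> borel_measurable borel" unfolding W_def by measurable
  have sqW: "sq_integrable W"
  proof (rule sq_integrable_bound[OF gf(3) sq_fun_of[of g]])
    fix x
    have c: "norm (of_real m - \<i> * of_real (sgn x)) \<le> m + 1" "norm (of_real m + \<i> * of_real (sgn x)) \<le> m + 1"
      using m norm_triangle_ineq4[of "of_real m" "\<i> * of_real (sgn x)"] norm_triangle_ineq[of "of_real m" "\<i> * of_real (sgn x)"]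
      by (cases "x = 0"; simp add: norm_mult abs_sgn_eq)+
    have n: "norm (v $ i) \<le> norm v" for v :: "complex^2" and i by (rule Finite_Cartesian_Product.norm_nth_le)
    have "norm (W x $ 1) \<le> norm (of_real m - \<i> * of_real (sgn x)) * norm (?G x $ 2) + norm (?g x $ 2)"
      unfolding W_def by (simp add: norm_mult[symmetric] norm_triangle_ineq)
    also have "\<dots> \<le> (m + 1) * norm (?G x) + norm (?g x)" using c n m by (intro add_mono mult_mono) auto
    finally have 1: "norm (W x $ 1) \<le> (m + 1) * norm (?G x) + norm (?g x)" .
    have "norm (W x $ 2) \<le> norm (of_real m + \<i> * of_real (sgn x)) * norm (?G x $ 1) + norm (?g x $ 1)"
      unfolding W_def by (simp add: norm_mult[symmetric] norm_triangle_ineq4)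
    also have "\<dots> \<le> (m + 1) * norm (?G x) + norm (?g x)" using c n m by (intro add_mono mult_mono) auto
    finally have 2: "norm (W x $ 2) \<le> (m + 1) * norm (?G x) + norm (?g x)" .
    have "norm (W x) \<le> 2 * ((m + 1) * norm (?G x)) + 2 * norm (?g x)" using 1 2 norm_vec2_le[of "W x"] by simp
    also have "\<dots> \<le> (2 * (m + 1)) * (norm (?G x) + norm (?g x))"
      using m mult_right_mono[of 1 "m + 1" "norm (?g x)"] by (simp add: algebra_simps)
    finally show "norm (W x) \<le> (2 * (m + 1)) * (norm (?G x) + norm (?g x))" .
  qed measurable
  note ode = green_ode[OF gf(1) m]
  have ne: "AE x::real in lborel. x \<noteq> 0" by (rule AE_lborel_singleton)
  have P: "primitive_on UNIV (\<lambda>x. ?G x $ i) (\<lambda>x. W x $ i)" for i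
  proof -
    have "primitive_on UNIV (\<lambda>x. ?G x $ 1) (\<lambda>x. W x $ 1)"
    proof (rule primitive_on_glue)
      show "primitive_on {..0} (\<lambda>x. ?G x $ 1) (\<lambda>x. W x $ 1)"
        by (rule primitive_on_cong_AE[OF ode(3)]) (use ne in \<open>auto simp: W_def elim!: eventually_mono\<close>)
      show "primitive_on {0..} (\<lambda>x. ?G x $ 1) (\<lambda>x. W x $ 1)"
        by (rule primitive_on_cong_AE[OF ode(1)]) (use ne in \<open>auto simp: W_def elim!: eventually_mono\<close>)
    qed
    moreover have "primitive_on UNIV (\<lambda>x. ?G x $ 2) (\<lambda>x. W x $ 2)"
    proof (rule primitive_on_glue)
      show "primitive_on {..0} (\<lambda>x. ?G x $ 2) (\<lambda>x. W x $ 2)"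
        by (rule primitive_on_cong_AE[OF ode(4)]) (use ne in \<open>auto simp: W_def elim!: eventually_mono\<close>)
      show "primitive_on {0..} (\<lambda>x. ?G x $ 2) (\<lambda>x. W x $ 2)"
        by (rule primitive_on_cong_AE[OF ode(2)]) (use ne in \<open>auto simp: W_def elim!: eventually_mono\<close>)
    qed
    ultimately show ?thesis using exhaust_2[of i] by auto
  qed
  have wd: "weak_deriv (free_inverse m g) (class_of W)"
    unfolding free_inverse_def by (rule primitive_weak_deriv[OF P gf(3) sqW])
  have "AE x in lborel. ?g x = vector [of_real m * fun_of (free_inverse m g) x $ 1 - fun_of (class_of W) x $ 2,
      fun_of (class_of W) x $ 1 - of_real m * fun_of (free_inverse m g) x $ 2]
        + (\<i> * of_real (sgn x)) *s fun_of (free_inverse m g) x"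
    using fun_of_class_of[OF gf(3)] fun_of_class_of[OF sqW]
  proof eventually_elim
    case (elim x)
    show ?case unfolding free_inverse_def elim by (simp add: vec_eq_iff forall_2 W_def algebra_simps)
  qed
  then show ?thesis using wd by (auto simp: op_L0_def)
qed

text \<open>The difference of \<open>f\<close> and the Green solution is a square integrable solution of the homogeneous system,
and the a priori estimate with zero source makes it vanish.\<close>

lemma op_L0_unique:
  assumes m: "m > 0" and fg: "(f, g) \<in> op_L0 m"
  shows "f = free_inverse m g"
proof -
  let ?g = "fun_of g" and ?G = "green m (fun_of g)"
  note gf = green_fun_of[OF m, of g]
  have [measurable]: "?G \<in> borel_measurable borel" using gf(3) by (simp add: sq_integrable_def)
  obtain f' where wd: "weak_deriv f f'"
    and eq: "AE x in lborel. ?g x = vector [of_real m * fun_of f x $ 1 - fun_of f' x $ 2,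
                fun_of f' x $ 1 - of_real m * fun_of f x $ 2] + (\<i> * of_real (sgn x)) *s fun_of f x"
    using fg by (auto simp: op_L0_def)
  obtain F :: "real \<Rightarrow> complex^2" where F: "\<And>i. primitive_on UNIV (\<lambda>x. F x $ i) (\<lambda>x. fun_of f' x $ i)"
    and fF: "AE x in lborel. fun_of f x = F x" using weak_deriv_primitive[OF wd] by blast
  have cF: "continuous_on UNIV F"
  proof -
    have "continuous_on UNIV (\<lambda>x. \<chi> i. F x $ i)"
      by (rule continuous_on_vec_lambda) (rule primitive_on_UNIV_continuous[OF F])
    then show ?thesis by simp
  qed
  have [measurable]: "F \<in> borel_measurable borel" by (rule borel_measurable_continuous_onI[OF cF])
  have sqF: "sq_integrable F" by (rule sq_integrable_cong_AE[OF sq_fun_of _ fF]) simp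
  have ne: "AE x::real in lborel. x \<noteq> 0" by (rule AE_lborel_singleton)
  have d: "AE x in lborel. (x > 0 \<longrightarrow> fun_of f' x $ 1 = (of_real m - \<i>) * F x $ 2 + ?g x $ 2 \<and> fun_of f' x $ 2 = (of_real m + \<i>) * F x $ 1 - ?g x $ 1)
      \<and> (x < 0 \<longrightarrow> fun_of f' x $ 1 = (of_real m + \<i>) * F x $ 2 + ?g x $ 2 \<and> fun_of f' x $ 2 = (of_real m - \<i>) * F x $ 1 - ?g x $ 1)"
    using eq fF
  proof eventually_elim
    case (elim x)
    have 1: "?g x $ 1 = of_real m * F x $ 1 - fun_of f' x $ 2 + \<i> * of_real (sgn x) * F x $ 1"
      using arg_cong[OF elim(1), of "\<lambda>v. v $ 1"] elim(2) by simp
    have 2: "?g x $ 2 = fun_of f' x $ 1 - of_real m * F x $ 2 + \<i> * of_real (sgn x) * F x $ 2"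
      using arg_cong[OF elim(1), of "\<lambda>v. v $ 2"] elim(2) by simp
    show ?case unfolding 1 2 by (auto simp: algebra_simps)
  qed
  note ode = green_ode[OF gf(1) m]
  have PF: "primitive_on {0..} (\<lambda>x. F x $ 1) (\<lambda>x. (of_real m - \<i>) * F x $ 2 + ?g x $ 2)"
    "primitive_on {0..} (\<lambda>x. F x $ 2) (\<lambda>x. (of_real m + \<i>) * F x $ 1 - ?g x $ 1)"
    "primitive_on {..0} (\<lambda>x. F x $ 1) (\<lambda>x. (of_real m + \<i>) * F x $ 2 + ?g x $ 2)"
    "primitive_on {..0} (\<lambda>x. F x $ 2) (\<lambda>x. (of_real m - \<i>) * F x $ 1 - ?g x $ 1)"
  proof -
    have ae: "AE x in lborel. x \<in> {0..} \<longrightarrow> fun_of f' x $ 1 = (of_real m - \<i>) * F x $ 2 + ?g x $ 2"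
      "AE x in lborel. x \<in> {0..} \<longrightarrow> fun_of f' x $ 2 = (of_real m + \<i>) * F x $ 1 - ?g x $ 1"
      "AE x in lborel. x \<in> {..0} \<longrightarrow> fun_of f' x $ 1 = (of_real m + \<i>) * F x $ 2 + ?g x $ 2"
      "AE x in lborel. x \<in> {..0} \<longrightarrow> fun_of f' x $ 2 = (of_real m - \<i>) * F x $ 1 - ?g x $ 1"
      using d ne by (eventually_elim, force)+
    show "primitive_on {0..} (\<lambda>x. F x $ 1) (\<lambda>x. (of_real m - \<i>) * F x $ 2 + ?g x $ 2)"
      by (rule primitive_on_cong_AE[OF primitive_on_subset[OF F] ae(1)]) auto
    show "primitive_on {0..} (\<lambda>x. F x $ 2) (\<lambda>x. (of_real m + \<i>) * F x $ 1 - ?g x $ 1)"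
      by (rule primitive_on_cong_AE[OF primitive_on_subset[OF F] ae(2)]) auto
    show "primitive_on {..0} (\<lambda>x. F x $ 1) (\<lambda>x. (of_real m + \<i>) * F x $ 2 + ?g x $ 2)"
      by (rule primitive_on_cong_AE[OF primitive_on_subset[OF F] ae(3)]) auto
    show "primitive_on {..0} (\<lambda>x. F x $ 2) (\<lambda>x. (of_real m - \<i>) * F x $ 1 - ?g x $ 1)"
      by (rule primitive_on_cong_AE[OF primitive_on_subset[OF F] ae(4)]) auto
  qed
  have sqD: "sq_integrable (\<lambda>x. F x - ?G x)" by (rule sq_integrable_diff[OF sqF gf(3)])
  interpret line_system m 0 "\<lambda>x. F x $ 1 - ?G x $ 1" "\<lambda>x. F x $ 2 - ?G x $ 2" "\<lambda>_. 0" "\<lambda>_. 0" "\<lambda>_. 0"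
  proof unfold_locales
    show "primitive_on {0..} (\<lambda>x. F x $ 1 - ?G x $ 1) (\<lambda>x. (of_real m + (0 - \<i>)) * (F x $ 2 - ?G x $ 2) + 0)"
      by (rule primitive_on_cong[OF primitive_on_diff[OF PF(1) ode(1)]]) (simp_all add: algebra_simps)
    show "primitive_on {0..} (\<lambda>x. F x $ 2 - ?G x $ 2) (\<lambda>x. (of_real m - (0 - \<i>)) * (F x $ 1 - ?G x $ 1) + 0)"
      by (rule primitive_on_cong[OF primitive_on_diff[OF PF(2) ode(2)]]) (simp_all add: algebra_simps)
    show "primitive_on {..0} (\<lambda>x. F x $ 1 - ?G x $ 1) (\<lambda>x. (of_real m + (0 + \<i>)) * (F x $ 2 - ?G x $ 2) + 0)"
      by (rule primitive_on_cong[OF primitive_on_diff[OF PF(3) ode(3)]]) (simp_all add: algebra_simps)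
    show "primitive_on {..0} (\<lambda>x. F x $ 2 - ?G x $ 2) (\<lambda>x. (of_real m - (0 + \<i>)) * (F x $ 1 - ?G x $ 1) + 0)"
      by (rule primitive_on_cong[OF primitive_on_diff[OF PF(4) ode(4)]]) (simp_all add: algebra_simps)
    have "(norm (F x - ?G x))\<^sup>2 = (norm (F x $ 1 - ?G x $ 1))\<^sup>2 + (norm (F x $ 2 - ?G x $ 2))\<^sup>2" for x
      by (simp add: norm_vec2_square)
    then show "integrable lborel (\<lambda>x. (norm (F x $ 1 - ?G x $ 1))\<^sup>2 + (norm (F x $ 2 - ?G x $ 2))\<^sup>2)"
      using sqD by (simp add: sq_integrable_def)
  qed (use m in auto)
  have "norm (F x $ 1 - ?G x $ 1) \<le> 0" "norm (F x $ 2 - ?G x $ 2) \<le> 0" for x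
    using weighted_apriori[of x] by (simp_all add: T_def)
  then have FG: "F x = ?G x" for x by (simp add: vec_eq_iff forall_2)
  have "AE x in lborel. fun_of f x = fun_of (free_inverse m g) x"
    using fF fun_of_class_of[OF gf(3)] unfolding free_inverse_def by eventually_elim (simp add: FG)
  then show ?thesis by (rule L2_eqI)
qed

lemma op_L0_eq: "m > 0 \<Longrightarrow> op_L0 m = {(free_inverse m g, g) | g. True}"
  using op_L0_free_inverse op_L0_unique by auto

text \<open>If the Green solution vanishes almost everywhere, it vanishes identically by continuity, and the
system then says that the source integrates to zero over every interval.\<close>

lemma free_inverse_inj:
  assumes m: "m > 0" and 0: "free_inverse m g = 0"
  shows "g = 0"
proof -
  let ?g = "fun_of g" and ?G = "green m (fun_of g)"
  note gf = green_fun_of[OF m, of g]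
  note ode = green_ode[OF gf(1) m]
  have ae: "AE x in lborel. ?G x = 0"
  proof -
    have "AE x in lborel. fun_of (free_inverse m g) x = 0" unfolding 0 by (rule fun_of_zero)
    then show ?thesis using fun_of_class_of[OF gf(3)] unfolding free_inverse_def by eventually_elim simp
  qed
  have Z: "?G x = 0" for x
  proof (rule ccontr)
    assume "?G x \<noteq> 0"
    have "open (?G -` (- {0}))" by (rule open_vimage[OF open_Compl[OF closed_singleton] continuous_green[OF gf(1) m]])
    moreover have "x \<in> ?G -` (- {0})" using \<open>?G x \<noteq> 0\<close> by simp
    ultimately obtain e where e: "e > 0" "ball x e \<subseteq> ?G -` (- {0})" using open_contains_ball by blast
    have "AE y in lborel. y \<notin> ball x e" using ae by eventually_elim (use e(2) in auto)
    then have "emeasure lborel (ball x e) = 0" by (subst (asm) AE_iff_measurable[of "ball x e"]) auto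
    then show False using e(1) by (simp add: ball_eq_greaterThanLessThan)
  qed
  have P: "primitive_on {0..} (\<lambda>x. 0) (\<lambda>x. ?g x $ 2)" "primitive_on {0..} (\<lambda>x. 0) (\<lambda>x. - ?g x $ 1)"
    "primitive_on {..0} (\<lambda>x. 0) (\<lambda>x. ?g x $ 2)" "primitive_on {..0} (\<lambda>x. 0) (\<lambda>x. - ?g x $ 1)"
    using ode by (simp_all add: Z)
  note PU = primitive_on_glue[OF P(3) P(1)] primitive_on_glue[OF P(4) P(2)]
  have z: "AE x in lborel. \<phi> x = 0" if p: "primitive_on UNIV (\<lambda>x. 0) \<phi>" for \<phi>
  proof (rule AE_zero_if_interval_integrals_zero)
    fix a b :: real assume ab: "a \<le> b"
    show "set_integrable lborel {a..b} \<phi>" by (rule primitive_onD(1)[OF p ab subset_UNIV])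
    show "(LINT x:{a..b}|lborel. \<phi> x) = 0" using primitive_onD(2)[OF p ab subset_UNIV] by simp
  qed
  have "AE x in lborel. ?g x $ 2 = 0" "AE x in lborel. - ?g x $ 1 = 0"
    by (rule z[OF PU(1)], rule z[OF PU(2)])
  then have "AE x in lborel. fun_of g x = fun_of 0 x"
    using fun_of_zero by eventually_elim (simp add: vec_eq_iff forall_2)
  then show ?thesis by (rule L2_eqI)
qed

section \<open>Bounded maps, graphs and the abstract perturbation\<close>

lemma scaleC_add_right: "c *\<^sub>C (u + v) = c *\<^sub>C u + c *\<^sub>C v"
proof (rule L2_eqI)
  show "AE x in lborel. fun_of (c *\<^sub>C (u + v)) x = fun_of (c *\<^sub>C u + c *\<^sub>C v) x"
    using fun_of_scaleC[of c "u + v"] fun_of_plus[of u v] fun_of_plus[of "c *\<^sub>C u" "c *\<^sub>C v"] fun_of_scaleC[of c u] fun_of_scaleC[of c v]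
    by eventually_elim (simp add: vec_eq_iff distrib_left)
qed

lemma scaleC_add_left: "(c + d) *\<^sub>C u = c *\<^sub>C u + d *\<^sub>C u"
proof (rule L2_eqI)
  show "AE x in lborel. fun_of ((c + d) *\<^sub>C u) x = fun_of (c *\<^sub>C u + d *\<^sub>C u) x"
    using fun_of_scaleC[of "c + d" u] fun_of_plus[of "c *\<^sub>C u" "d *\<^sub>C u"] fun_of_scaleC[of c u] fun_of_scaleC[of d u]
    by eventually_elim (simp add: vec_eq_iff distrib_right)
qed

lemma scaleC_scaleC: "c *\<^sub>C d *\<^sub>C u = (c * d) *\<^sub>C u"
proof (rule L2_eqI)
  show "AE x in lborel. fun_of (c *\<^sub>C d *\<^sub>C u) x = fun_of ((c * d) *\<^sub>C u) x"
    using fun_of_scaleC[of c "d *\<^sub>C u"] fun_of_scaleC[of d u] fun_of_scaleC[of "c * d" u]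
    by eventually_elim (simp add: vec_eq_iff mult.assoc)
qed

lemma scaleC_one: "1 *\<^sub>C u = u"
proof (rule L2_eqI)
  show "AE x in lborel. fun_of (1 *\<^sub>C u) x = fun_of u x"
    using fun_of_scaleC[of 1 u] by eventually_elim (simp add: vec_eq_iff)
qed

lemma scaleC_zero_left: "0 *\<^sub>C u = 0"
  using scaleC_add_left[of 0 0 u] by simp

lemma scaleC_zero_right: "c *\<^sub>C 0 = 0"
  using scaleC_add_right[of c 0 0] by simp

lemma scaleC_minus_one: "(-1) *\<^sub>C u = - u"
proof -
  have "u + (-1) *\<^sub>C u = 0" using scaleC_add_left[of 1 "-1" u] by (simp add: scaleC_one scaleC_zero_left)
  then show ?thesis by (metis add.commute eq_neg_iff_add_eq_0)
qed

lemma scaleC_diff_right: "c *\<^sub>C (u - v) = c *\<^sub>C u - c *\<^sub>C v"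
  using scaleC_add_right[of c "u - v" v] by (simp add: algebra_simps)

lemma norm_scaleC: "norm (c *\<^sub>C u) = norm c * norm u"
proof -
  have "(norm (c *\<^sub>C u))\<^sup>2 = (LINT x|lborel. (norm c)\<^sup>2 * (norm (fun_of u x))\<^sup>2)"
    unfolding norm_L2_square
  proof (rule integral_cong_AE)
    show "AE x in lborel. (norm (fun_of (c *\<^sub>C u) x))\<^sup>2 = (norm c)\<^sup>2 * (norm (fun_of u x))\<^sup>2"
      using fun_of_scaleC[of c u] by eventually_elim (simp add: norm_vector_scalar_mult power_mult_distrib)
  qed auto
  also have "\<dots> = (norm c * norm u)\<^sup>2" by (simp add: norm_L2_square power_mult_distrib)
  finally show ?thesis by simp
qed

lemma scaleR_scaleC: "r *\<^sub>R u = of_real r *\<^sub>C u"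
proof (rule L2_eqI)
  have "r *\<^sub>R u = class_of (\<lambda>x. r *\<^sub>R fun_of u x)"
    using scaleR_L2.abs_eq[OF L2_rel_fun_of, of r u] by (simp add: class_of_fun_of)
  then have "AE x in lborel. fun_of (r *\<^sub>R u) x = r *\<^sub>R fun_of u x"
    using fun_of_class_of[OF sq_integrable_scaleR[OF sq_fun_of]] by simp
  then show "AE x in lborel. fun_of (r *\<^sub>R u) x = fun_of (of_real r *\<^sub>C u) x"
    using fun_of_scaleC[of "of_real r" u] by eventually_elim (simp add: vec_eq_iff scaleR_conv_of_real[where 'a = complex])
qed

text \<open>Bounded complex-linear maps as functions; \<open>graph\<close> below translates to the relational operators.\<close>

definition bounded_map :: "(L2 \<Rightarrow> L2) \<Rightarrow> bool" where
  "bounded_map T \<longleftrightarrow> (\<forall>u v. T (u + v) = T u + T v) \<and> (\<forall>c u. T (c *\<^sub>C u) = c *\<^sub>C T u) \<and>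
     (\<exists>K. \<forall>u. norm (T u) \<le> K * norm u)"

lemma bounded_mapI:
  assumes "\<And>u v. T (u + v) = T u + T v" "\<And>c u. T (c *\<^sub>C u) = c *\<^sub>C T u" "\<And>u. norm (T u) \<le> K * norm u"
  shows "bounded_map T"
  using assms unfolding bounded_map_def by blast

lemma bounded_mapD:
  assumes "bounded_map T"
  shows "T (u + v) = T u + T v" "T (c *\<^sub>C u) = c *\<^sub>C T u" "T 0 = 0" "T (- u) = - T u" "T (u - v) = T u - T v"
proof -
  show a: "T (u + v) = T u + T v" "T (c *\<^sub>C u) = c *\<^sub>C T u" for u v c using assms by (auto simp: bounded_map_def)
  show "T 0 = 0" using a(1)[of 0 0] by simp
  show m: "T (- u) = - T u" for u using a(2)[of "-1" u] by (simp add: scaleC_minus_one)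
  show "T (u - v) = T u - T v" using a(1)[of u "- v"] by (simp add: m)
qed

lemma bounded_map_bounded_linear:
  assumes "bounded_map T" shows "bounded_linear T"
proof -
  obtain K where "\<forall>u. norm (T u) \<le> K * norm u" using assms by (auto simp: bounded_map_def)
  then show ?thesis
    by (intro bounded_linear_intro[of T K]) (auto simp: bounded_mapD[OF assms] scaleR_scaleC mult.commute)
qed

lemma bounded_map_continuous: "bounded_map T \<Longrightarrow> continuous_on UNIV T"
  by (rule linear_continuous_on[OF bounded_map_bounded_linear])

lemma bounded_map_pos_bound:
  assumes "bounded_map T" obtains K where "K \<ge> 0" "\<And>u. norm (T u) \<le> K * norm u"
proof -
  from bounded_linear.nonneg_bounded[OF bounded_map_bounded_linear[OF assms]]
  obtain K where "K \<ge> 0" "\<forall>u. norm (T u) \<le> norm u * K" by blast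
  then show ?thesis using that by (metis mult.commute)
qed

lemma bounded_map_add:
  assumes S: "bounded_map S" and T: "bounded_map T" shows "bounded_map (\<lambda>u. S u + T u)"
proof -
  obtain K L where "\<And>u. norm (S u) \<le> K * norm u" "\<And>u. norm (T u) \<le> L * norm u"
    using bounded_map_pos_bound[OF S] bounded_map_pos_bound[OF T] by metis
  then have "norm (S u + T u) \<le> (K + L) * norm u" for u
    by (intro order_trans[OF norm_triangle_ineq]) (simp add: distrib_right add_mono)
  then show ?thesis
    by (intro bounded_mapI[of _ "K + L"]) (auto simp: bounded_mapD[OF S] bounded_mapD[OF T] scaleC_add_right algebra_simps)
qed

lemma bounded_map_scaleC:
  assumes S: "bounded_map S" shows "bounded_map (\<lambda>u. c *\<^sub>C S u)"
proof -
  obtain K where K: "\<And>u. norm (S u) \<le> K * norm u" using bounded_map_pos_bound[OF S] by metis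
  have "norm (c *\<^sub>C S u) \<le> (norm c * K) * norm u" for u
    using mult_left_mono[OF K[of u], of "norm c"] by (simp add: norm_scaleC mult.assoc)
  then show ?thesis
    by (intro bounded_mapI[of _ "norm c * K"]) (auto simp: bounded_mapD[OF S] scaleC_add_right scaleC_scaleC mult.commute)
qed

lemma bounded_map_compose:
  assumes S: "bounded_map S" and T: "bounded_map T" shows "bounded_map (\<lambda>u. S (T u))"
proof -
  obtain K L where K: "K \<ge> 0" "\<And>u. norm (S u) \<le> K * norm u" and L: "\<And>u. norm (T u) \<le> L * norm u"
    using bounded_map_pos_bound[OF S] bounded_map_pos_bound[OF T] by metis
  have "norm (S (T u)) \<le> (K * L) * norm u" for u
    using K(2)[of "T u"] mult_left_mono[OF L[of u] K(1)] by (simp add: mult.assoc)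
  then show ?thesis
    by (intro bounded_mapI[of _ "K * L"]) (auto simp: bounded_mapD[OF S] bounded_mapD[OF T])
qed

lemma bounded_map_id: "bounded_map (\<lambda>u. u)"
  by (rule bounded_mapI[of _ 1]) auto

lemma bounded_map_diff:
  assumes S: "bounded_map S" and T: "bounded_map T" shows "bounded_map (\<lambda>u. S u - T u)"
  using bounded_map_add[OF S bounded_map_scaleC[OF T, of "-1"]] by (simp add: scaleC_minus_one)

definition graph :: "(L2 \<Rightarrow> L2) \<Rightarrow> L2_op" where "graph T = {(u, T u) | u. True}"

lemma graph_iff: "(u, v) \<in> graph T \<longleftrightarrow> v = T u" by (auto simp: graph_def)

lemma linear_op_graph: "bounded_map T \<Longrightarrow> linear_op (graph T)"
  unfolding linear_op_def graph_iff by (auto simp: bounded_mapD single_valued_def graph_iff)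

lemma closed_graph: assumes "bounded_map T" shows "closed (graph T)"
proof -
  have "graph T = {p. snd p = T (fst p)}" by (auto simp: graph_def)
  moreover have "closed {p :: L2 \<times> L2. snd p = T (fst p)}"
    by (rule closed_Collect_eq) (auto intro!: continuous_intros continuous_on_compose2[OF bounded_map_continuous[OF assms]])
  ultimately show ?thesis by simp
qed

lemma bounded_op_graph: assumes "bounded_map T" shows "bounded_op (graph T)"
proof -
  obtain K where "\<And>u. norm (T u) \<le> K * norm u" using bounded_map_pos_bound[OF assms] by metis
  then show ?thesis using linear_op_graph[OF assms] by (auto simp: bounded_op_def graph_def)
qed

lemma bounded_op_imp_graph:
  assumes "bounded_op S" obtains T where "bounded_map T" "S = graph T"
proof -
  have dom: "\<exists>v. (u, v) \<in> S" for u using assms by (auto simp: bounded_op_def set_eq_iff Domain_iff)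
  have sv: "single_valued S" and lin: "linear_op S" using assms by (auto simp: bounded_op_def linear_op_def)
  obtain T where T: "\<And>u. (u, T u) \<in> S" using dom by metis
  have S: "S = graph T" using T sv by (auto simp: graph_def dest: single_valuedD)
  obtain K where K: "\<forall>(u, v)\<in>S. norm v \<le> K * norm u" using assms unfolding bounded_op_def by blast
  have "bounded_map T"
  proof (rule bounded_mapI)
    show "T (u + v) = T u + T v" for u v
    proof -
      have "(u + v, T u + T v) \<in> S" using lin T by (simp add: linear_op_def)
      then show ?thesis by (simp add: S graph_iff)
    qed
    show "T (c *\<^sub>C u) = c *\<^sub>C T u" for c u
    proof -
      have "(c *\<^sub>C u, c *\<^sub>C T u) \<in> S" using lin T by (simp add: linear_op_def)
      then show ?thesis by (simp add: S graph_iff)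
    qed
    show "norm (T u) \<le> K * norm u" for u using K T[of u] by blast
  qed
  then show ?thesis using that S by blast
qed

text \<open>Identifies the closures in the definition of the perturbed operator: a bounded map known on a dense
domain.\<close>

lemma closure_graph_restrict:
  assumes T: "bounded_map T" and D: "closure D = UNIV"
  shows "closure {(u, T u) | u. u \<in> D} = graph T"
proof
  show "closure {(u, T u) | u. u \<in> D} \<subseteq> graph T"
    by (rule closure_minimal[OF _ closed_graph[OF T]]) (auto simp: graph_def)
  show "graph T \<subseteq> closure {(u, T u) | u. u \<in> D}"
  proof (clarsimp simp: graph_def)
    fix u
    obtain x where x: "\<And>n. x n \<in> D" "x \<longlonglongrightarrow> u" using D closure_sequential[of u D] by auto
    have "(\<lambda>n. T (x n)) \<longlonglongrightarrow> T u"
      using bounded_linear.tendsto[OF bounded_map_bounded_linear[OF T] x(2)] .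
    then have "(\<lambda>n. (x n, T (x n))) \<longlonglongrightarrow> (u, T u)" using x(2) by (rule tendsto_Pair[rotated])
    then show "(u, T u) \<in> closure {(u, T u) | u. u \<in> D}"
      unfolding closure_sequential using x(1) by (intro exI[of _ "\<lambda>n. (x n, T (x n))"]) auto
  qed
qed

lemma resolvent_iff: "(g, f) \<in> resolvent T z \<longleftrightarrow> (f, g + z *\<^sub>C f) \<in> T"
proof -
  have "(g, f) \<in> resolvent T z \<longleftrightarrow> (\<exists>v. g = v - z *\<^sub>C f \<and> (f, v) \<in> T)"
    unfolding resolvent_def shift_op_def by auto
  also have "\<dots> \<longleftrightarrow> (f, g + z *\<^sub>C f) \<in> T" by (metis add_diff_cancel_right' diff_add_cancel)
  finally show ?thesis .
qed

lemma resolvent_inj: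
  assumes "resolvent S z = resolvent T z" shows "S = T"
proof -
  have "(f, k) \<in> S \<longleftrightarrow> (f, k) \<in> T" for f k
    using assms resolvent_iff[of "k - z *\<^sub>C f" f S z] resolvent_iff[of "k - z *\<^sub>C f" f T z] by simp
  then show ?thesis by auto
qed

text \<open>The graph of \<open>T\<close> is the preimage of a closed graph under the homeomorphism \<open>(f, k) \<mapsto> (k - z f, f)\<close>;
injectivity of the resolvent makes \<open>T\<close> single-valued.\<close>

lemma closed_op_if_resolvent_graph:
  assumes r: "resolvent T z = graph S" and S: "bounded_map S" and inj: "\<And>g. S g = 0 \<Longrightarrow> g = 0"
  shows "closed_op T"
proof -
  have T: "(f, k) \<in> T \<longleftrightarrow> f = S (k - z *\<^sub>C f)" for f k
    using resolvent_iff[of "k - z *\<^sub>C f" f T z] by (simp add: r graph_iff)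
  have "T = {p. fst p = S (snd p - z *\<^sub>C fst p)}" using T by auto
  moreover have "closed {p :: L2 \<times> L2. fst p = S (snd p - z *\<^sub>C fst p)}"
    by (rule closed_Collect_eq)
       (auto intro!: continuous_intros continuous_on_compose2[OF bounded_map_continuous[OF S]]
         continuous_on_compose2[OF bounded_map_continuous[OF bounded_map_scaleC[OF bounded_map_id]]])
  ultimately have "closed T" by simp
  moreover have "linear_op T"
    unfolding linear_op_def
  proof (intro conjI allI impI)
    show "(0, 0) \<in> T" by (simp add: T bounded_mapD(3)[OF S] scaleC_zero_right)
    show "(u + u', v + v') \<in> T" if "(u, v) \<in> T \<and> (u', v') \<in> T" for u v u' v'
    proof -
      have "u = S (v - z *\<^sub>C u)" "u' = S (v' - z *\<^sub>C u')" using that unfolding T by blast+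
      then have "u + u' = S (v - z *\<^sub>C u) + S (v' - z *\<^sub>C u')" by (rule arg_cong2)
      also have "\<dots> = S ((v + v') - z *\<^sub>C (u + u'))"
        unfolding bounded_mapD(1)[OF S, symmetric] by (simp add: scaleC_add_right algebra_simps)
      finally show ?thesis unfolding T .
    qed
    show "(c *\<^sub>C u, c *\<^sub>C v) \<in> T" if "(u, v) \<in> T" for c u v
    proof -
      have "c *\<^sub>C u = c *\<^sub>C S (v - z *\<^sub>C u)" using that unfolding T by (rule arg_cong)
      also have "\<dots> = S (c *\<^sub>C v - z *\<^sub>C c *\<^sub>C u)"
        unfolding bounded_mapD(2)[OF S, symmetric] by (simp add: scaleC_diff_right scaleC_scaleC mult.commute)
      finally show ?thesis unfolding T .
    qed
    show "single_valued T"
    proof (rule single_valuedI)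
      fix u v v' assume "(u, v) \<in> T" "(u, v') \<in> T"
      then have "S (v - z *\<^sub>C u) = S (v' - z *\<^sub>C u)" unfolding T by metis
      then have "S (v - v') = 0" using bounded_mapD(5)[OF S, of "v - z *\<^sub>C u" "v' - z *\<^sub>C u"] by simp
      then show "v = v'" using inj[of "v - v'"] by simp
    qed
  qed
  ultimately show ?thesis by (simp add: closed_op_def)
qed

lemma closed_op_graph: "bounded_map T \<Longrightarrow> closed_op (graph T)"
  by (simp add: closed_op_def linear_op_graph closed_graph)

lemma comp_op_iff: "(u, w) \<in> S \<circ>\<^sub>o T \<longleftrightarrow> (\<exists>v. (u, v) \<in> T \<and> (v, w) \<in> S)"
  by (auto simp: comp_op_def)

text \<open>The abstract part of the construction. All information about the free operator and the potential is
contained in four bounded maps at the base point 0: \<open>G\<close> is the free inverse, and \<open>RB\<close>, \<open>AG\<close>, \<open>AGB\<close> are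
the bounded extensions of \<open>G B\<close>, \<open>A G\<close> and \<open>A G B\<close>. The last assumption is the invertibility of
\<open>I + Q(0)\<close>.\<close>

locale perturbation =
  fixes m :: real and V :: "real \<Rightarrow> complex^2^2" and G RB AG AGB :: "L2 \<Rightarrow> L2"
  assumes maps: "bounded_map G" "bounded_map RB" "bounded_map AG" "bounded_map AGB"
    and L0: "op_L0 m = {(G g, g) | g. True}"
    and inj: "\<And>g. G g = 0 \<Longrightarrow> g = 0"
    and linA: "linear_op (op_A V)"
    and AG: "\<And>g. (G g, AG g) \<in> op_A V" and AGB: "\<And>h. (RB h, AGB h) \<in> op_A V"
    and B: "\<And>u v. (u, v) \<in> op_B V \<Longrightarrow> G v = RB u" and denseB: "closure (Domain (op_B V)) = UNIV"
    and small: "bounded_op (resolvent (graph AGB) (-1))"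
begin

lemma A_add: "(u, v) \<in> op_A V \<Longrightarrow> (u', v') \<in> op_A V \<Longrightarrow> (u + u', v + v') \<in> op_A V"
  and A_scale: "(u, v) \<in> op_A V \<Longrightarrow> (c *\<^sub>C u, c *\<^sub>C v) \<in> op_A V"
  and A_sv: "(u, v) \<in> op_A V \<Longrightarrow> (u, w) \<in> op_A V \<Longrightarrow> v = w"
  and A_0: "(0, 0) \<in> op_A V"
  using linA by (auto simp: linear_op_def dest: single_valuedD)

lemma A_diff: "(u, v) \<in> op_A V \<Longrightarrow> (u', v') \<in> op_A V \<Longrightarrow> (u - u', v - v') \<in> op_A V"
  using A_add[of u v "(-1) *\<^sub>C u'" "(-1) *\<^sub>C v'"] A_scale[of u' v' "-1"] by (simp add: scaleC_minus_one)

text \<open>With \<open>h = A f\<close> the equation \<open>f = G g - G B h\<close> is the equation \<open>L f + V f = g\<close> solved for \<open>f\<close>; it makes sense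
although \<open>V f\<close> need not be square integrable.\<close>

definition T :: L2_op where "T = {(f, g). \<exists>h. (f, h) \<in> op_A V \<and> f = G g - RB h}"

lemma L0_iff: "(f, g) \<in> op_L0 m \<longleftrightarrow> f = G g" by (auto simp: L0)

text \<open>The resolvent identity between \<open>0\<close> and \<open>z\<close>, in both orders.\<close>

lemma resolvent_point:
  assumes z: "z \<in> resolvent_set (op_L0 m)"
  obtains R where "bounded_map R" "op_R0 m z = graph R" "\<And>g f. f = R g \<longleftrightarrow> f = G (g + z *\<^sub>C f)"
    "\<And>g. R g = G g + z *\<^sub>C R (G g)"
proof -
  obtain R where R: "bounded_map R" "resolvent (op_L0 m) z = graph R"
    using z bounded_op_imp_graph[of "resolvent (op_L0 m) z"] by (auto simp: resolvent_set_def)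
  have iff: "f = R g \<longleftrightarrow> f = G (g + z *\<^sub>C f)" for g f
    using resolvent_iff[of g f "op_L0 m" z] by (simp add: R(2) graph_iff L0_iff)
  have "R g = G g + z *\<^sub>C R (G g)" for g
  proof -
    define f where "f = G g + z *\<^sub>C R (G g)"
    have "R (G g) = G (G g + z *\<^sub>C R (G g))" using iff[of "R (G g)" "G g"] by simp
    then have "R (G g) = G f" by (simp add: f_def)
    then have "G (g + z *\<^sub>C f) = G g + z *\<^sub>C R (G g)" by (simp only: bounded_mapD(1,2)[OF maps(1)])
    then have "f = G (g + z *\<^sub>C f)" by (simp only: f_def[symmetric])
    then have "f = R g" using iff[of f g] by blast
    then show ?thesis by (simp only: f_def)
  qed
  then show ?thesis using that[of R] R iff unfolding op_R0_def by blast
qed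

text \<open>The resolvent identity carries the bounded extensions from the base point to every point of the free
resolvent set.\<close>

lemma good_point_resolvent:
  assumes z: "z \<in> resolvent_set (op_L0 m)"
  obtains R RBz ARz Qz where "bounded_map R" "op_R0 m z = graph R" "\<And>g f. f = R g \<longleftrightarrow> f = G (g + z *\<^sub>C f)"
    "bounded_map RBz" "closure (op_R0 m z \<circ>\<^sub>o op_B V) = graph RBz" "\<And>h. RBz h = RB h + z *\<^sub>C G (RBz h)"
    "bounded_map ARz" "op_A V \<circ>\<^sub>o op_R0 m z = graph ARz" "\<And>g. (R g, ARz g) \<in> op_A V"
    "bounded_map Qz" "op_Q m V z = graph Qz" "\<And>h. (RBz h, Qz h) \<in> op_A V" "\<And>h. Qz h = AGB h + z *\<^sub>C AG (RBz h)"
proof -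
  obtain R where R: "bounded_map R" "op_R0 m z = graph R" "\<And>g f. f = R g \<longleftrightarrow> f = G (g + z *\<^sub>C f)"
    "\<And>g. R g = G g + z *\<^sub>C R (G g)" using resolvent_point[OF z] by blast
  define RBz where "RBz = (\<lambda>h. RB h + z *\<^sub>C R (RB h))"
  have RBz: "bounded_map RBz" unfolding RBz_def
    by (intro bounded_map_add bounded_map_scaleC bounded_map_compose[OF R(1)] maps)
  have RBz_eq: "RBz h = RB h + z *\<^sub>C G (RBz h)" for h
  proof -
    have "R (RB h) = G (RB h + z *\<^sub>C R (RB h))" using R(3)[of "R (RB h)" "RB h"] by simp
    then show ?thesis by (simp add: RBz_def)
  qed
  define ARz where "ARz = (\<lambda>g. AG (g + z *\<^sub>C R g))"
  have ARz: "bounded_map ARz" unfolding ARz_def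
    by (intro bounded_map_compose[OF maps(3)] bounded_map_add bounded_map_id bounded_map_scaleC R)
  have ARz_A: "(R g, ARz g) \<in> op_A V" for g
  proof -
    have "R g = G (g + z *\<^sub>C R g)" using R(3)[of "R g" g] by simp
    then show ?thesis using AG[of "g + z *\<^sub>C R g"] by (simp add: ARz_def)
  qed
  define Qz where "Qz = (\<lambda>h. AGB h + z *\<^sub>C AG (RBz h))"
  have Qz: "bounded_map Qz" unfolding Qz_def
    by (intro bounded_map_add bounded_map_scaleC bounded_map_compose[OF maps(3)] RBz maps)
  have Qz_A: "(RBz h, Qz h) \<in> op_A V" for h
    using A_add[OF AGB[of h] A_scale[OF AG[of "RBz h"], of z]] RBz_eq[of h] by (simp add: Qz_def)
  have RBdom: "op_R0 m z \<circ>\<^sub>o op_B V = {(u, RBz u) | u. u \<in> Domain (op_B V)}"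
  proof -
    have "R v = RBz u" if "(u, v) \<in> op_B V" for u v
      using R(4)[of v] B[OF that] by (simp add: RBz_def)
    then have e: "(u, v) \<in> op_B V \<Longrightarrow> (w = R v) = (w = RBz u)" for u v w by simp
    show ?thesis unfolding comp_op_def relcomp_unfold R(2) graph_iff using e by blast
  qed
  have cRB: "closure (op_R0 m z \<circ>\<^sub>o op_B V) = graph RBz"
    unfolding RBdom by (rule closure_graph_restrict[OF RBz denseB])
  have cA: "op_A V \<circ>\<^sub>o op_R0 m z = graph ARz"
    using ARz_A A_sv by (auto simp: comp_op_iff R(2) graph_iff)
  have "op_A V \<circ>\<^sub>o op_R0 m z \<circ>\<^sub>o op_B V = {(u, Qz u) | u. u \<in> Domain (op_B V)}"
    unfolding RBdom using Qz_A A_sv by (auto simp: comp_op_iff)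
  then have cQ: "op_Q m V z = graph Qz"
    unfolding op_Q_def using closure_graph_restrict[OF Qz denseB] by simp
  show ?thesis by (rule that[OF R(1-3) RBz cRB RBz_eq ARz cA ARz_A Qz cQ Qz_A]) (simp add: Qz_def)
qed

text \<open>Solving \<open>f = G (g + z f) - G B h\<close> with \<open>h = A f\<close>: the free resolvent gives \<open>f = R g - R B h\<close>, and applying \<open>A\<close>
leaves \<open>(I + Q) h = A R g\<close>.\<close>

lemma resolvent_formula:
  assumes z: "z \<in> good_points m V"
  obtains S where "bounded_map S" "resolvent T z = graph S"
    "diff_op (op_R0 m z) (closure (op_R0 m z \<circ>\<^sub>o op_B V) \<circ>\<^sub>o resolvent (op_Q m V z) (-1) \<circ>\<^sub>o op_A V \<circ>\<^sub>o op_R0 m z) = graph S"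
    "\<And>g. S g = 0 \<Longrightarrow> g = 0"
proof -
  have z0: "z \<in> resolvent_set (op_L0 m)" and z1: "-1 \<in> resolvent_set (op_Q m V z)"
    using z by (auto simp: good_points_def)
  obtain R RBz ARz Qz where R: "bounded_map R" "op_R0 m z = graph R" "\<And>g f. f = R g \<longleftrightarrow> f = G (g + z *\<^sub>C f)"
    and RBz: "bounded_map RBz" "closure (op_R0 m z \<circ>\<^sub>o op_B V) = graph RBz" "\<And>h. RBz h = RB h + z *\<^sub>C G (RBz h)"
    and ARz: "bounded_map ARz" "op_A V \<circ>\<^sub>o op_R0 m z = graph ARz" "\<And>g. (R g, ARz g) \<in> op_A V"
    and Qz: "bounded_map Qz" "op_Q m V z = graph Qz" "\<And>h. (RBz h, Qz h) \<in> op_A V" "\<And>h. Qz h = AGB h + z *\<^sub>C AG (RBz h)"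
    by (rule good_point_resolvent[OF z0]) (rule that; assumption)
  obtain I where I: "bounded_map I" "resolvent (op_Q m V z) (-1) = graph I"
    using z1 bounded_op_imp_graph[of "resolvent (op_Q m V z) (-1)"] by (auto simp: resolvent_set_def)
  have I_iff: "h = I w \<longleftrightarrow> w = Qz h + h" for h w
  proof -
    have "h = I w \<longleftrightarrow> w + (-1) *\<^sub>C h = Qz h"
      using resolvent_iff[of w h "op_Q m V z" "-1"] unfolding I(2) unfolding Qz(2) graph_iff .
    then show ?thesis by (auto simp: scaleC_minus_one algebra_simps)
  qed
  define S where "S = (\<lambda>g. R g - RBz (I (ARz g)))"
  have S: "bounded_map S" unfolding S_def
    by (intro bounded_map_diff R bounded_map_compose[OF RBz(1)] bounded_map_compose[OF I(1)] ARz)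
  note Gl = bounded_mapD[OF maps(1)]
  have "(g, f) \<in> resolvent T z \<longleftrightarrow> f = S g" for g f
  proof
    assume "(g, f) \<in> resolvent T z"
    then obtain h where h: "(f, h) \<in> op_A V" "f = G (g + z *\<^sub>C f) - RB h" by (auto simp: resolvent_iff T_def)
    \<comment> \<open>The difference solves the homogeneous free equation at \<open>z\<close>, which \<open>R\<close> solves uniquely.\<close>
    define d where "d = f - (R g - RBz h)"
    have Rg: "R g = G g + z *\<^sub>C G (R g)" using R(3)[of "R g" g] by (simp add: Gl)
    have "f = G g + z *\<^sub>C G f - RB h" using h(2) by (simp add: Gl)
    then have "d = z *\<^sub>C G f - z *\<^sub>C G (R g) + z *\<^sub>C G (RBz h)"
      using Rg RBz(3)[of h] unfolding d_def by (metis (no_types, lifting) add_diff_cancel_left add_diff_eq diff_add_eq diff_diff_eq2)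
    also have "\<dots> = G (0 + z *\<^sub>C d)" by (simp add: d_def Gl scaleC_diff_right)
    finally have "d = R 0" using R(3)[of d 0] by simp
    then have f: "f = R g - RBz h" using bounded_mapD(3)[OF R(1)] by (simp add: d_def)
    have "(f, ARz g - Qz h) \<in> op_A V" unfolding f by (rule A_diff[OF ARz(3) Qz(3)])
    then have "h = ARz g - Qz h" using A_sv h(1) by blast
    then have "h = I (ARz g)" using I_iff[of h "ARz g"] by (metis add.commute diff_add_cancel)
    then show "f = S g" using f by (simp add: S_def)
  next
    assume f: "f = S g"
    define h where "h = I (ARz g)"
    have h: "ARz g = Qz h + h" using I_iff[of h "ARz g"] by (simp add: h_def)
    have f': "f = R g - RBz h" by (simp add: f S_def h_def)
    have "(f, ARz g - Qz h) \<in> op_A V" unfolding f' by (rule A_diff[OF ARz(3) Qz(3)])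
    then have A: "(f, h) \<in> op_A V" using h by simp
    have Rg: "R g = G g + z *\<^sub>C G (R g)" using R(3)[of "R g" g] by (simp add: Gl)
    have "G (g + z *\<^sub>C f) - RB h = (G g + z *\<^sub>C G (R g)) - (RB h + z *\<^sub>C G (RBz h))"
      by (simp add: f' Gl scaleC_diff_right algebra_simps)
    also have "\<dots> = f" unfolding Rg[symmetric] RBz(3)[symmetric] f' ..
    finally show "(g, f) \<in> resolvent T z" using A by (auto simp: resolvent_iff T_def)
  qed
  then have rT: "resolvent T z = graph S" by (auto simp: graph_iff)
  have form: "diff_op (op_R0 m z) (closure (op_R0 m z \<circ>\<^sub>o op_B V) \<circ>\<^sub>o resolvent (op_Q m V z) (-1) \<circ>\<^sub>o op_A V \<circ>\<^sub>o op_R0 m z) = graph S"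
    unfolding RBz(2) unfolding I(2) ARz(2) unfolding R(2) diff_op_def by (auto simp: comp_op_iff graph_iff S_def)
  have "g = 0" if "S g = 0" for g
  proof -
    have "(g, 0) \<in> resolvent T z" using that by (simp add: rT graph_iff)
    then obtain h where h: "(0, h) \<in> op_A V" "0 = G g - RB h" by (auto simp: resolvent_iff T_def scaleC_zero_right)
    then have "h = 0" using A_sv A_0 by blast
    then show ?thesis using h(2) inj bounded_mapD(3)[OF maps(2)] by simp
  qed
  then show ?thesis using that S rT form by blast
qed

lemma zero_good: "0 \<in> good_points m V"
proof -
  have r: "resolvent (op_L0 m) 0 = graph G"
    by (auto simp: resolvent_iff L0_iff graph_iff scaleC_zero_left)
  have z: "0 \<in> resolvent_set (op_L0 m)"
    using closed_op_if_resolvent_graph[OF r maps(1) inj] bounded_op_graph[OF maps(1)] by (simp add: resolvent_set_def r)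
  obtain R RBz ARz Qz where R: "bounded_map R" "op_R0 m 0 = graph R" "\<And>g f. f = R g \<longleftrightarrow> f = G (g + 0 *\<^sub>C f)"
    and RBz: "bounded_map RBz" "closure (op_R0 m 0 \<circ>\<^sub>o op_B V) = graph RBz" "\<And>h. RBz h = RB h + 0 *\<^sub>C G (RBz h)"
    and ARz: "bounded_map ARz" "op_A V \<circ>\<^sub>o op_R0 m 0 = graph ARz" "\<And>g. (R g, ARz g) \<in> op_A V"
    and Qz: "bounded_map Qz" "op_Q m V 0 = graph Qz" "\<And>h. (RBz h, Qz h) \<in> op_A V" "\<And>h. Qz h = AGB h + 0 *\<^sub>C AG (RBz h)"
    by (rule good_point_resolvent[OF z]) (rule that; assumption)
  have "Qz = AGB" using Qz(4) by (auto simp: scaleC_zero_left)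
  then have "op_Q m V 0 = graph AGB" using Qz(2) by simp
  then show ?thesis using z small closed_op_graph[OF maps(4)] by (simp add: good_points_def resolvent_set_def)
qed

lemma is_op_LV_T: "is_op_LV m V T"
  unfolding is_op_LV_def
proof (intro conjI ballI)
  obtain S where S: "bounded_map S" "resolvent T 0 = graph S" "\<And>g. S g = 0 \<Longrightarrow> g = 0"
    using resolvent_formula[OF zero_good] by metis
  show cl: "closed_op T" by (rule closed_op_if_resolvent_graph[OF S(2,1,3)])
  show "good_points m V \<noteq> {}" using zero_good by auto
  fix z assume z: "z \<in> good_points m V"
  obtain S where S: "bounded_map S" "resolvent T z = graph S"
    "diff_op (op_R0 m z) (closure (op_R0 m z \<circ>\<^sub>o op_B V) \<circ>\<^sub>o resolvent (op_Q m V z) (-1) \<circ>\<^sub>o op_A V \<circ>\<^sub>o op_R0 m z) = graph S"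
    using resolvent_formula[OF z] by metis
  show "z \<in> resolvent_set T" using cl bounded_op_graph[OF S(1)] by (simp add: resolvent_set_def S(2))
  show "resolvent T z = diff_op (op_R0 m z) (closure (op_R0 m z \<circ>\<^sub>o op_B V) \<circ>\<^sub>o resolvent (op_Q m V z) (-1) \<circ>\<^sub>o op_A V \<circ>\<^sub>o op_R0 m z)"
    using S by simp
qed

text \<open>The operator is determined by its resolvent at a single good point, here 0.\<close>

lemma op_LV_eq: "op_LV m V = T"
  unfolding op_LV_def
proof (rule the_equality)
  show "is_op_LV m V T" by (rule is_op_LV_T)
  fix T' assume T': "is_op_LV m V T'"
  have "resolvent T' 0 = resolvent T 0"
    using T' is_op_LV_T zero_good unfolding is_op_LV_def by metis
  then show "T' = T" by (rule resolvent_inj)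
qed

end

section \<open>Polar decomposition of two-by-two matrices\<close>

lemma matrix_mult_2: "((M :: complex^2^2) ** N) $ i $ j = M $ i $ 1 * N $ 1 $ j + M $ i $ 2 * N $ 2 $ j"
  by (simp add: matrix_matrix_mult_def sum_2)

lemma matrix_vector_2: "((M :: complex^2^2) *v v) $ i = M $ i $ 1 * v $ 1 + M $ i $ 2 * v $ 2"
  by (simp add: matrix_vector_mult_def sum_2)

lemma mat_1_2: "(mat 1 :: complex^2^2) $ i $ j = (if i = j then 1 else 0)"
  by (simp add: mat_def)

lemma inner_2: "(v :: complex^2) \<bullet> w = Re (cnj (v $ 1) * w $ 1) + Re (cnj (v $ 2) * w $ 2)"
  by (simp add: inner_vec_def sum_2 inner_complex_def)

lemma matrix_eq_2: "(M :: complex^2^2) = N \<longleftrightarrow> (\<forall>i j. M $ i $ j = N $ i $ j)"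
  by (simp add: vec_eq_iff)

lemma ctranspose_nth: "ctranspose M $ i $ j = cnj (M $ j $ i)" by (simp add: ctranspose_def)

lemma ctranspose_inner: "(M *v v) \<bullet> w = v \<bullet> (ctranspose M *v w)"
  by (simp add: inner_2 matrix_vector_2 ctranspose_nth algebra_simps)

lemma ctranspose_mult: "ctranspose (M ** N) = ctranspose N ** ctranspose M"
  by (simp add: matrix_eq_2 ctranspose_nth matrix_mult_2 mult.commute)

lemma ctranspose_ctranspose: "ctranspose (ctranspose M) = M"
  by (simp add: matrix_eq_2 ctranspose_nth)

lemma mat_scaleR_mult: "(r *\<^sub>R M) ** N = r *\<^sub>R (M ** N)" "M ** (r *\<^sub>R N) = r *\<^sub>R (M ** N)" for M N :: "complex^2^2"
  by (simp_all add: matrix_eq_2 matrix_mult_2 algebra_simps)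

lemma mat_add_mult: "(M + N) ** K = M ** K + N ** K" "K ** (M + N) = K ** M + K ** N" for M N K :: "complex^2^2"
  by (simp_all add: matrix_eq_2 matrix_mult_2 algebra_simps)

lemma scaleR_matrix_vector: "(r *\<^sub>R M) *v v = r *\<^sub>R (M *v v)" for M :: "complex^2^2"
  by (simp add: vec_eq_iff matrix_vector_2 algebra_simps)

lemma add_matrix_vector: "(M + N) *v v = M *v v + N *v v" for M :: "complex^2^2"
  by (simp add: vec_eq_iff matrix_vector_2 algebra_simps)

lemma psd_Gram: "psd (ctranspose M ** M)"
proof -
  have "v \<bullet> ((ctranspose M ** M) *v v) = (M *v v) \<bullet> (M *v v)" for v
    by (simp add: ctranspose_inner matrix_vector_mul_assoc)
  then show ?thesis by (simp add: psd_def ctranspose_mult ctranspose_ctranspose)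
qed

lemma psd_inner: "psd P \<Longrightarrow> (P *v v) \<bullet> w = v \<bullet> (P *v w)"
  using ctranspose_inner[of P v w] by (simp add: psd_def)

definition tr2 :: "complex^2^2 \<Rightarrow> real" where "tr2 P = Re (P $ 1 $ 1) + Re (P $ 2 $ 2)"
definition det2 :: "complex^2^2 \<Rightarrow> real" where "det2 P = Re (P $ 1 $ 1) * Re (P $ 2 $ 2) - (norm (P $ 1 $ 2))\<^sup>2"

lemma psd_entries:
  assumes P: "psd P"
  obtains a b d where "P $ 1 $ 1 = of_real a" "P $ 1 $ 2 = b" "P $ 2 $ 1 = cnj b" "P $ 2 $ 2 = of_real d"
    "a \<ge> 0" "d \<ge> 0" "(norm b)\<^sup>2 \<le> a * d" "tr2 P = a + d" "det2 P = a * d - (norm b)\<^sup>2"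
proof -
  have h: "cnj (P $ j $ i) = P $ i $ j" for i j
    using P unfolding psd_def by (metis ctranspose_nth)
  define a b d where "a = Re (P $ 1 $ 1)" and "b = P $ 1 $ 2" and "d = Re (P $ 2 $ 2)"
  have r: "z = of_real (Re z)" if "cnj z = z" for z using that by (metis Reals_cnj_iff of_real_Re)
  have e: "P $ 1 $ 1 = of_real a" "P $ 2 $ 2 = of_real d" "P $ 2 $ 1 = cnj b" "P $ 1 $ 2 = b"
    using r[OF h[of 1 1]] r[OF h[of 2 2]] h[of 1 2] by (auto simp: a_def d_def b_def)
  have q: "0 \<le> a * (norm x)\<^sup>2 + 2 * Re (cnj x * b * y) + d * (norm y)\<^sup>2" for x y
  proof -
    have "0 \<le> vector [x, y] \<bullet> (P *v vector [x, y])" using P by (simp add: psd_def)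
    also have "\<dots> = a * (norm x)\<^sup>2 + 2 * Re (cnj x * b * y) + d * (norm y)\<^sup>2"
      unfolding cmod_power2 by (simp add: inner_2 matrix_vector_2 e algebra_simps power2_eq_square)
    finally show ?thesis .
  qed
  have a: "a \<ge> 0" using q[of 1 0] by simp
  have d: "d \<ge> 0" using q[of 0 1] by simp
  have bb: "Re (cnj b * b) = (norm b)\<^sup>2" unfolding cmod_power2 by (simp add: power2_eq_square)
  have ab: "(norm b)\<^sup>2 \<le> a * d"
  proof (cases "a > 0")
    case True
    have "0 \<le> a * (norm b)\<^sup>2 + 2 * Re (cnj b * b * (- of_real a)) + d * (norm (- of_real a :: complex))\<^sup>2" by (rule q)
    also have "Re (cnj b * b * (- of_real a)) = - (a * (norm b)\<^sup>2)" unfolding bb[symmetric] by (simp add: algebra_simps)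
    finally have "0 \<le> a * (a * d - (norm b)\<^sup>2)" by (simp add: power2_eq_square algebra_simps)
    then show ?thesis using True by (simp add: zero_le_mult_iff)
  next
    case False
    then have a0: "a = 0" using a by simp
    have "norm b = 0"
    proof (rule ccontr)
      assume "norm b \<noteq> 0"
      \<comment> \<open>Any vector \<open>(- s * b, 1)\<close> with \<open>2 * s * (norm b)^2 > d\<close> violates positivity.\<close>
      define s where "s = (d + 1) / (norm b)\<^sup>2"
      have "0 \<le> a * (norm (- (of_real s * b)))\<^sup>2 + 2 * Re (cnj (- (of_real s * b)) * b * 1) + d * (norm (1::complex))\<^sup>2" by (rule q)
      also have "Re (cnj (- (of_real s * b)) * b * 1) = - (s * (norm b)\<^sup>2)" unfolding bb[symmetric] by (simp add: algebra_simps)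
      also have "s * (norm b)\<^sup>2 = d + 1" using \<open>norm b \<noteq> 0\<close> by (simp add: s_def)
      finally show False using a0 d by simp
    qed
    then show ?thesis using a d by simp
  qed
  show ?thesis by (rule that[of a b d]) (use e a d ab in \<open>auto simp: tr2_def det2_def\<close>)
qed

lemma psd_tr_det: assumes "psd P" shows "tr2 P \<ge> 0" "det2 P \<ge> 0"
  using psd_entries[OF assms] by (metis add_nonneg_nonneg, metis diff_ge_0_iff_ge)

lemma psd_zero_trace: assumes P: "psd P" and t: "tr2 P = 0" shows "P = 0"
proof -
  obtain a b d where "P $ 1 $ 1 = of_real a" "P $ 1 $ 2 = b" "P $ 2 $ 1 = cnj b" "P $ 2 $ 2 = of_real d"
    "a \<ge> 0" "d \<ge> 0" "(norm b)\<^sup>2 \<le> a * d" "tr2 P = a + d" by (rule psd_entries[OF P])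
  moreover have "a = 0" "d = 0" using calculation t by auto
  ultimately show ?thesis by (simp add: matrix_eq_2 forall_2)
qed

text \<open>For two-by-two matrices the Cayley-Hamilton theorem expresses a positive square root through the
trace and determinant of its square, which gives existence, uniqueness and measurability at once.\<close>

lemma psd_Cayley_Hamilton:
  assumes P: "psd P" shows "P ** P = tr2 P *\<^sub>R P - det2 P *\<^sub>R mat 1"
    and "tr2 (P ** P) = (tr2 P)\<^sup>2 - 2 * det2 P" "det2 (P ** P) = (det2 P)\<^sup>2"
proof -
  obtain a b d where e: "P $ 1 $ 1 = of_real a" "P $ 1 $ 2 = b" "P $ 2 $ 1 = cnj b" "P $ 2 $ 2 = of_real d"
    and td: "tr2 P = a + d" "det2 P = a * d - (norm b)\<^sup>2" by (rule psd_entries[OF P])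
  have bb: "b * cnj b = of_real ((norm b)\<^sup>2)" by (rule complex_norm_square[symmetric])
  have bb': "cnj b * b = of_real ((norm b)\<^sup>2)" using bb by (simp add: mult.commute)
  show CH: "P ** P = tr2 P *\<^sub>R P - det2 P *\<^sub>R mat 1"
    unfolding td by (simp add: matrix_eq_2 forall_2 matrix_mult_2 mat_1_2 e bb bb' scaleR_conv_of_real[where 'a = complex] algebra_simps)
  have pp: "(P ** P) $ 1 $ 1 = of_real (a * a + (norm b)\<^sup>2)" "(P ** P) $ 2 $ 2 = of_real (d * d + (norm b)\<^sup>2)"
    "(P ** P) $ 1 $ 2 = of_real (a + d) * b"
    by (simp_all add: matrix_mult_2 e bb bb' algebra_simps)
  show "tr2 (P ** P) = (tr2 P)\<^sup>2 - 2 * det2 P"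
    unfolding td unfolding tr2_def pp by (simp add: power2_eq_square algebra_simps)
  have "norm (of_real (a + d) * b) ^ 2 = (a + d)\<^sup>2 * (norm b)\<^sup>2" by (simp add: norm_mult power_mult_distrib del: of_real_add)
  then show "det2 (P ** P) = (det2 P)\<^sup>2"
    unfolding td unfolding det2_def pp by (simp add: power2_eq_square algebra_simps del: of_real_add of_real_mult)
qed

lemma scaleR_collect:
  "t *\<^sub>R x - d *\<^sub>R y + r *\<^sub>R x + (r *\<^sub>R x + d *\<^sub>R y) = (t + r + r) *\<^sub>R x" for x y :: "'a :: real_vector"
  by (simp only: scaleR_add_left add.assoc diff_add_eq) (simp add: add.left_commute add.commute)

text \<open>If \<open>S\<close> is the positive root of \<open>P\<close>, then \<open>det S = \<delta>\<close> and \<open>tr S = \<tau>\<close>, and \<open>\<tau> S = P + \<delta>\<close> by the Cayley-Hamilton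
theorem; \<open>\<tau>\<close> vanishes only for \<open>P = 0\<close>.\<close>

definition sqrt_formula :: "complex^2^2 \<Rightarrow> complex^2^2" where
  "sqrt_formula P = (let \<delta> = sqrt (det2 P); \<tau> = sqrt (tr2 P + 2 * \<delta>)
     in if \<tau> = 0 then 0 else (1 / \<tau>) *\<^sub>R (P + \<delta> *\<^sub>R mat 1))"

lemma psd_0: "psd 0"
  by (simp add: psd_def matrix_eq_2 ctranspose_nth)

lemma psd_combination:
  assumes P: "psd P" and "r \<ge> 0" "s \<ge> 0"
  shows "psd (r *\<^sub>R (P + s *\<^sub>R mat 1))"
proof -
  have "ctranspose (r *\<^sub>R (P + s *\<^sub>R mat 1)) = r *\<^sub>R (P + s *\<^sub>R mat 1)"
  proof -
    have "cnj (P $ j $ i) = P $ i $ j" for i j using P unfolding psd_def by (metis ctranspose_nth)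
    then show ?thesis by (simp add: matrix_eq_2 ctranspose_nth mat_1_2)
  qed
  moreover have "0 \<le> v \<bullet> ((r *\<^sub>R (P + s *\<^sub>R mat 1)) *v v)" for v
    using P assms(2,3) by (simp add: scaleR_matrix_vector add_matrix_vector inner_add_right psd_def)
  ultimately show ?thesis by (simp add: psd_def)
qed

lemma sqrt_formula_correct:
  assumes P: "psd P" shows "psd (sqrt_formula P)" "sqrt_formula P ** sqrt_formula P = P"
proof -
  define \<delta> \<tau> where "\<delta> = sqrt (det2 P)" and "\<tau> = sqrt (tr2 P + 2 * \<delta>)"
  have S: "sqrt_formula P = (if \<tau> = 0 then 0 else (1 / \<tau>) *\<^sub>R (P + \<delta> *\<^sub>R mat 1))"
    by (simp only: sqrt_formula_def Let_def \<delta>_def \<tau>_def)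
  note td = psd_tr_det[OF P]
  have \<delta>: "\<delta> \<ge> 0" "\<delta>\<^sup>2 = det2 P" using td by (auto simp: \<delta>_def)
  have \<tau>: "\<tau> \<ge> 0" "\<tau>\<^sup>2 = tr2 P + 2 * \<delta>" using td \<delta> by (auto simp: \<tau>_def)
  show "psd (sqrt_formula P)"
    unfolding S using psd_combination[OF P, of "1 / \<tau>" \<delta>] \<delta> \<tau> by (simp add: psd_0)
  show "sqrt_formula P ** sqrt_formula P = P"
  proof (cases "\<tau> = 0")
    case True
    then have "tr2 P = 0" using \<tau> \<delta> td by simp
    then show ?thesis using psd_zero_trace[OF P] True by (simp add: S matrix_eq_2 matrix_mult_2)
  next
    case False
    have "(P + \<delta> *\<^sub>R mat 1) ** (P + \<delta> *\<^sub>R mat 1) = P ** P + \<delta> *\<^sub>R P + (\<delta> *\<^sub>R P + (\<delta> * \<delta>) *\<^sub>R mat 1)"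
      by (simp add: mat_add_mult mat_scaleR_mult scaleR_add_right)
    also have "\<dots> = (tr2 P + \<delta> + \<delta>) *\<^sub>R P"
      unfolding psd_Cayley_Hamilton(1)[OF P] \<delta>(2)[symmetric] power2_eq_square by (rule scaleR_collect)
    also have "tr2 P + \<delta> + \<delta> = \<tau>\<^sup>2" using \<tau>(2) by simp
    finally show ?thesis using False by (simp add: S mat_scaleR_mult power2_eq_square)
  qed
qed

lemma psd_sqrt_unique:
  assumes S: "psd S" and P: "S ** S = P" shows "S = sqrt_formula P"
proof -
  note td = psd_tr_det[OF S] and CH = psd_Cayley_Hamilton[OF S, unfolded P]
  have d: "sqrt (det2 P) = det2 S" using CH(3) td by simp
  have t: "sqrt (tr2 P + 2 * det2 S) = tr2 S" using CH(2) td by simp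
  have F: "sqrt_formula P = (if tr2 S = 0 then 0 else (1 / tr2 S) *\<^sub>R (P + det2 S *\<^sub>R mat 1))"
    unfolding sqrt_formula_def Let_def d t ..
  show ?thesis
  proof (cases "tr2 S = 0")
    case True
    show ?thesis unfolding F if_P[OF True] by (rule psd_zero_trace[OF S True])
  next
    case False
    then show ?thesis unfolding F if_not_P[OF False] by (subst CH(1)) simp
  qed
qed

lemma mat_sqrt_eq: "psd P \<Longrightarrow> mat_sqrt P = sqrt_formula P"
  unfolding mat_sqrt_def by (rule the_equality) (auto simp: sqrt_formula_correct psd_sqrt_unique)

lemma mat_abs_props:
  "mat_abs M = sqrt_formula (ctranspose M ** M)" "psd (mat_abs M)" "mat_abs M ** mat_abs M = ctranspose M ** M"
  using sqrt_formula_correct[OF psd_Gram[of M]] by (simp_all add: mat_abs_def mat_sqrt_eq[OF psd_Gram])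

text \<open>The factor \<open>A\<close> of the potential.\<close>

definition half_abs :: "complex^2^2 \<Rightarrow> complex^2^2" where "half_abs M = mat_sqrt (mat_abs M)"

lemma half_abs_props:
  "half_abs M = sqrt_formula (mat_abs M)" "psd (half_abs M)" "half_abs M ** half_abs M = mat_abs M"
  using sqrt_formula_correct[OF mat_abs_props(2)[of M]] by (simp_all add: half_abs_def mat_sqrt_eq[OF mat_abs_props(2)])

lemma norm_mat_abs: "norm (mat_abs M *v v) = norm (M *v v)"
proof -
  have "(norm (mat_abs M *v v))\<^sup>2 = v \<bullet> ((mat_abs M ** mat_abs M) *v v)"
    by (simp add: power2_norm_eq_inner psd_inner[OF mat_abs_props(2)] matrix_vector_mul_assoc)
  also have "\<dots> = (norm (M *v v))\<^sup>2"
    unfolding mat_abs_props(3) by (simp add: power2_norm_eq_inner ctranspose_inner matrix_vector_mul_assoc)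
  finally show ?thesis by simp
qed

text \<open>A generalised inverse that is a polynomial in \<open>P\<close>, hence commutes with everything that commutes with
\<open>P\<close>. All cases are written as such a polynomial.\<close>

definition pinv :: "complex^2^2 \<Rightarrow> complex^2^2" where
  "pinv P = (if det2 P \<noteq> 0 then (tr2 P / det2 P) *\<^sub>R mat 1 + (- 1 / det2 P) *\<^sub>R P
     else if tr2 P \<noteq> 0 then 0 *\<^sub>R mat 1 + (1 / (tr2 P)\<^sup>2) *\<^sub>R P else 0 *\<^sub>R mat 1 + 0 *\<^sub>R P)"

lemma pinv_poly: "\<exists>\<alpha> \<beta>. pinv P = \<alpha> *\<^sub>R mat 1 + \<beta> *\<^sub>R P"
  unfolding pinv_def by (simp only: split: if_split) blast

lemma pinv_commute:
  assumes "S ** P = P ** S" shows "S ** pinv P = pinv P ** S"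
proof -
  obtain \<alpha> \<beta> where "pinv P = \<alpha> *\<^sub>R mat 1 + \<beta> *\<^sub>R P" using pinv_poly by blast
  then show ?thesis using assms by (simp add: mat_add_mult mat_scaleR_mult)
qed

lemma pinv_mult:
  assumes P: "psd P" shows "P ** (P ** pinv P) = P"
proof -
  note CH = psd_Cayley_Hamilton(1)[OF P]
  consider "det2 P \<noteq> 0" | "det2 P = 0" "tr2 P \<noteq> 0" | "det2 P = 0" "tr2 P = 0" by blast
  then show ?thesis
  proof cases
    case 1
    have "P ** pinv P = (tr2 P / det2 P) *\<^sub>R P + (- 1 / det2 P) *\<^sub>R (P ** P)"
      unfolding pinv_def if_P[OF 1] by (simp only: mat_add_mult mat_scaleR_mult matrix_mul_rid)
    also have "\<dots> = mat 1" unfolding CH using 1 by (simp add: scaleR_diff_right)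
    finally show ?thesis by simp
  next
    case 2
    have PP: "P ** P = tr2 P *\<^sub>R P" using CH 2 by simp
    then have "P ** (P ** P) = (tr2 P)\<^sup>2 *\<^sub>R P" by (simp add: mat_scaleR_mult power2_eq_square)
    then show ?thesis using 2 by (simp add: pinv_def mat_scaleR_mult)
  next
    case 3
    then have "P = 0" using psd_zero_trace[OF P] by blast
    then show ?thesis by (simp add: matrix_eq_2 matrix_mult_2)
  qed
qed

lemma matrix_ext: "(\<And>v. M *v v = N *v v) \<Longrightarrow> M = (N :: complex^2^2)"
  by (simp add: matrix_eq)

text \<open>The matrices \<open>M\<close> and \<open>mat_abs M\<close> have the same kernel, which contains the range of the defect
\<open>1 - pinv P ** P\<close>.\<close>

lemma pinv_recovers: "M = (M ** pinv (mat_abs M)) ** mat_abs M"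
proof -
  let ?P = "mat_abs M" and ?X = "pinv (mat_abs M)"
  have com: "?P ** ?X = ?X ** ?P" by (rule pinv_commute) simp
  show ?thesis
  proof (rule matrix_ext)
    fix v
    have "norm (M *v (v - (?X ** ?P) *v v)) = norm (?P *v (v - (?X ** ?P) *v v))" by (simp add: norm_mat_abs)
    also have "?P *v (v - (?X ** ?P) *v v) = ?P *v v - (?P ** (?P ** ?X)) *v v"
      by (simp add: matrix_vector_mult_diff_distrib com[symmetric] matrix_vector_mul_assoc)
    finally have "M *v (v - (?X ** ?P) *v v) = 0" by (simp add: pinv_mult[OF mat_abs_props(2)])
    then have "M *v v = M *v ((?X ** ?P) *v v)" by (simp add: matrix_vector_mult_diff_distrib)
    then show "M *v v = ((M ** ?X) ** ?P) *v v" by (simp only: matrix_vector_mul_assoc matrix_mul_assoc)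
  qed
qed

text \<open>Every vector is the sum of one in the range and one in the kernel of the absolute value, which
determines the partial isometry.\<close>

lemma polar_isometry_eq: "polar_isometry M = M ** pinv (mat_abs M)"
  unfolding polar_isometry_def
proof (rule the_equality)
  let ?P = "mat_abs M" and ?X = "pinv (mat_abs M)"
  have P: "psd ?P" by (rule mat_abs_props)
  have com: "?P ** ?X = ?X ** ?P" by (rule pinv_commute) simp
  have ppx: "?P ** (?P ** ?X) = ?P" by (rule pinv_mult[OF P])
  show "M = (M ** ?X) ** ?P \<and> (\<forall>v. ?P *v v = 0 \<longrightarrow> (M ** ?X) *v v = 0)"
  proof
    show "M = (M ** ?X) ** ?P" by (rule pinv_recovers)
    show "\<forall>v. ?P *v v = 0 \<longrightarrow> (M ** ?X) *v v = 0"
    proof (intro allI impI)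
      fix v assume v: "?P *v v = 0"
      have "norm ((M ** ?X) *v v) = norm (?P *v (?X *v v))" by (simp add: norm_mat_abs matrix_vector_mul_assoc[symmetric])
      also have "?P *v (?X *v v) = ?X *v (?P *v v)" by (simp add: matrix_vector_mul_assoc com)
      finally show "(M ** ?X) *v v = 0" by (simp add: v)
    qed
  qed
  fix U assume U: "M = U ** ?P \<and> (\<forall>v. ?P *v v = 0 \<longrightarrow> U *v v = 0)"
  show "U = M ** ?X"
  proof (rule matrix_ext)
    fix v
    have "?P *v (v - (?P ** ?X) *v v) = 0"
      by (simp add: matrix_vector_mult_diff_distrib matrix_vector_mul_assoc ppx)
    then have "U *v (v - (?P ** ?X) *v v) = 0" using U by blast
    then have "U *v v = (U ** (?P ** ?X)) *v v" by (simp add: matrix_vector_mult_diff_distrib matrix_vector_mul_assoc)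
    then show "U *v v = (M ** ?X) *v v" using U by (metis matrix_mul_assoc)
  qed
qed

text \<open>The factor \<open>B\<close> of the potential.\<close>

definition polar_half :: "complex^2^2 \<Rightarrow> complex^2^2" where
  "polar_half M = polar_isometry M ** half_abs M"

lemma polar_half_mult: "polar_half M ** half_abs M = M"
  unfolding polar_half_def polar_isometry_eq
  by (metis pinv_recovers half_abs_props(3) matrix_mul_assoc)

text \<open>The partial isometry preserves norms on the range of the absolute value, which contains that of its root.\<close>

lemma norm_polar_half: "norm (polar_half M *v v) = norm (half_abs M *v v)"
proof -
  let ?P = "mat_abs M" and ?X = "pinv (mat_abs M)" and ?S = "half_abs M"
  have SS: "?S ** ?S = ?P" by (rule half_abs_props)
  have SP: "?S ** ?P = ?P ** ?S" unfolding SS[symmetric] by (rule matrix_mul_assoc)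
  have SX: "?S ** ?X = ?X ** ?S" by (rule pinv_commute[OF SP])
  \<comment> \<open>The claim \<open>P X S = S\<close> is reduced to \<open>S y = 0\<close>, which follows from \<open>S (S y) = 0\<close> as \<open>S\<close> is Hermitian.\<close>
  define y where "y = (?S ** (?X ** ?S)) *v v - v"
  have w: "?P *v (?X *v (?S *v v)) - ?S *v v = ?S *v y"
    unfolding y_def SS[symmetric] by (simp add: matrix_vector_mult_diff_distrib matrix_vector_mul_assoc matrix_mul_assoc)
  have "?S *v (?S *v y) = ?P *v y" by (simp only: matrix_vector_mul_assoc SS)
  also have "\<dots> = (?P ** (?S ** (?X ** ?S))) *v v - ?P *v v"
    unfolding y_def by (simp only: matrix_vector_mult_diff_distrib matrix_vector_mul_assoc)
  also have "?P ** (?S ** (?X ** ?S)) = ?P ** (?P ** ?X)"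
    unfolding SX[symmetric] matrix_mul_assoc[of ?S ?S ?X] SS ..
  finally have "?S *v (?S *v y) = 0" by (simp add: pinv_mult[OF mat_abs_props(2)])
  then have "(norm (?S *v y))\<^sup>2 = 0"
    by (simp add: power2_norm_eq_inner psd_inner[OF half_abs_props(2)])
  then have eq: "?P *v (?X *v (?S *v v)) = ?S *v v" using w by simp
  have "norm (polar_half M *v v) = norm (M *v (?X *v (?S *v v)))"
    by (simp add: polar_half_def polar_isometry_eq matrix_vector_mul_assoc matrix_mul_assoc)
  also have "\<dots> = norm (?P *v (?X *v (?S *v v)))" by (simp add: norm_mat_abs)
  finally show ?thesis by (simp add: eq)
qed

definition opnorm :: "complex^2^2 \<Rightarrow> real" where "opnorm M = onorm (\<lambda>v. M *v v)"

lemma bounded_linear_matrix: "bounded_linear (\<lambda>v. (M :: complex^2^2) *v v)"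
proof -
  have "linear (\<lambda>v. M *v v)"
    by (rule linearI) (simp_all add: vec_eq_iff matrix_vector_2 algebra_simps)
  then show ?thesis by (simp add: linear_conv_bounded_linear)
qed

lemma opnorm_bound: "norm (M *v v) \<le> opnorm M * norm v"
  unfolding opnorm_def by (rule onorm[OF bounded_linear_matrix])

lemma opnorm_nonneg: "0 \<le> opnorm M"
  unfolding opnorm_def by (rule onorm_pos_le[OF bounded_linear_matrix])

text \<open>The square root of the potential is bounded by the square root of the operator norm, so \<open>A\<close> maps
bounded functions to square integrable ones and \<open>B\<close> maps square integrable functions to integrable
ones.\<close>

lemma norm_half_abs: "(norm (half_abs M *v v))\<^sup>2 \<le> opnorm M * (norm v)\<^sup>2"
proof -
  have "(norm (half_abs M *v v))\<^sup>2 = v \<bullet> (mat_abs M *v v)"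
    by (simp add: power2_norm_eq_inner psd_inner[OF half_abs_props(2)] matrix_vector_mul_assoc half_abs_props(3))
  also have "\<dots> \<le> norm v * norm (mat_abs M *v v)" by (rule norm_cauchy_schwarz)
  also have "\<dots> \<le> norm v * (opnorm M * norm v)" unfolding norm_mat_abs by (rule mult_left_mono[OF opnorm_bound]) simp
  finally show ?thesis by (simp add: power2_eq_square mult_ac)
qed

lemma opnorm_le_norm: "opnorm M \<le> norm M"
  unfolding opnorm_def
proof (rule onorm_le)
  fix v
  have "norm ((M *v v) $ i) \<le> norm (M $ i) * norm v" for i
  proof -
    have "norm ((M *v v) $ i) \<le> norm (M $ i $ 1) * norm (v $ 1) + norm (M $ i $ 2) * norm (v $ 2)"
      unfolding matrix_vector_2 by (rule order_trans[OF norm_triangle_ineq]) (simp add: norm_mult)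
    also have "\<dots> \<le> L2_set (\<lambda>j. norm (M $ i $ j)) UNIV * L2_set (\<lambda>j. norm (v $ j)) UNIV"
      using L2_set_mult_ineq[of "\<lambda>j. norm (M $ i $ j)" "\<lambda>j. norm (v $ j)" UNIV] by (simp add: sum_2)
    finally show ?thesis by (simp add: norm_vec_def)
  qed
  then have "norm (M *v v) \<le> L2_set (\<lambda>i. norm (M $ i) * norm v) UNIV"
    unfolding norm_vec_def[of "M *v v"] by (intro L2_set_mono) auto
  also have "\<dots> = norm M * norm v" by (simp add: L2_set_left_distrib norm_vec_def[of M])
  finally show "norm (M *v v) \<le> norm M * norm v" .
qed

lemma opnorm_lipschitz: "\<bar>opnorm M - opnorm N\<bar> \<le> norm (M - N)"
proof -
  have tri: "opnorm M \<le> opnorm N + norm (M - N)" for M N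
  proof -
    have "opnorm M \<le> opnorm N + opnorm (M - N)"
      unfolding opnorm_def[of M]
    proof (rule onorm_le)
      fix v
      have "M *v v = N *v v + (M - N) *v v" by (simp add: vec_eq_iff matrix_vector_2 algebra_simps)
      then have "norm (M *v v) \<le> norm (N *v v) + norm ((M - N) *v v)" by (metis norm_triangle_ineq)
      also have "\<dots> \<le> opnorm N * norm v + opnorm (M - N) * norm v" by (intro add_mono opnorm_bound)
      finally show "norm (M *v v) \<le> (opnorm N + opnorm (M - N)) * norm v" by (simp add: distrib_right)
    qed
    then show ?thesis using opnorm_le_norm[of "M - N"] by simp
  qed
  show ?thesis using tri[of M N] tri[of N M] by (simp add: norm_minus_commute abs_le_iff)
qed

text \<open>The operator norm is Lipschitz in the matrix.\<close>

lemma measurable_opnorm[measurable (raw)]: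
  assumes "f \<in> borel_measurable M" shows "(\<lambda>x. opnorm (f x)) \<in> borel_measurable M"
proof -
  have "continuous_on UNIV opnorm"
    by (rule lipschitz_on_continuous_on[of 1], rule lipschitz_onI) (use opnorm_lipschitz in \<open>auto simp: dist_norm\<close>)
  then show ?thesis by (rule measurable_compose[OF assms borel_measurable_continuous_onI])
qed

lemma measurable_vec_componentwise:
  fixes f :: "'a \<Rightarrow> ('b :: euclidean_space)^'n"
  assumes "\<And>i. (\<lambda>x. f x $ i) \<in> borel_measurable M"
  shows "f \<in> borel_measurable M"
proof (subst borel_measurable_euclidean_space, intro ballI)
  fix b :: "'b^'n" assume "b \<in> Basis"
  then obtain i u where b: "b = axis i u" by (auto simp: Basis_vec_def)
  show "(\<lambda>x. f x \<bullet> b) \<in> borel_measurable M"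
    unfolding b inner_axis using assms by simp
qed

lemma measurable_matrix_mult[measurable (raw)]:
  fixes f g :: "'a \<Rightarrow> complex^2^2"
  assumes [measurable]: "f \<in> borel_measurable M" "g \<in> borel_measurable M"
  shows "(\<lambda>x. f x ** g x) \<in> borel_measurable M"
  by (intro measurable_vec_componentwise) (simp add: matrix_mult_2)

lemma measurable_matrix_vector[measurable (raw)]:
  fixes f :: "'a \<Rightarrow> complex^2^2"
  assumes [measurable]: "f \<in> borel_measurable M" "g \<in> borel_measurable M"
  shows "(\<lambda>x. f x *v g x) \<in> borel_measurable M"
  by (intro measurable_vec_componentwise) (simp add: matrix_vector_2)

lemma measurable_ctranspose[measurable (raw)]:
  assumes [measurable]: "f \<in> borel_measurable M"
  shows "(\<lambda>x. ctranspose (f x)) \<in> borel_measurable M"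
proof (intro measurable_vec_componentwise)
  fix i j
  have c: "continuous_on UNIV cnj" by (intro continuous_intros)
  show "(\<lambda>x. ctranspose (f x) $ i $ j) \<in> borel_measurable M"
    unfolding ctranspose_nth by (rule measurable_compose[OF _ borel_measurable_continuous_onI[OF c]]) simp
qed

lemma measurable_tr_det[measurable (raw)]:
  assumes [measurable]: "f \<in> borel_measurable M"
  shows "(\<lambda>x. tr2 (f x)) \<in> borel_measurable M" "(\<lambda>x. det2 (f x)) \<in> borel_measurable M"
  unfolding tr2_def det2_def by measurable

lemma measurable_sqrt_formula[measurable (raw)]:
  assumes [measurable]: "f \<in> borel_measurable M"
  shows "(\<lambda>x. sqrt_formula (f x)) \<in> borel_measurable M"
  unfolding sqrt_formula_def Let_def by measurable

lemma measurable_pinv[measurable (raw)]: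
  assumes [measurable]: "f \<in> borel_measurable M"
  shows "(\<lambda>x. pinv (f x)) \<in> borel_measurable M"
  unfolding pinv_def by measurable

lemma measurable_polar_factors:
  assumes [measurable]: "f \<in> borel_measurable M"
  shows "(\<lambda>x. half_abs (f x)) \<in> borel_measurable M" "(\<lambda>x. polar_half (f x)) \<in> borel_measurable M"
  unfolding half_abs_props(1) polar_half_def polar_isometry_eq mat_abs_props(1) by measurable

section \<open>The factored potential\<close>

lemma op_A_eq: "op_A V = mult_op (\<lambda>x. half_abs (V x))"
  by (simp add: op_A_def half_abs_def)

lemma op_B_eq: "op_B V = mult_op (\<lambda>x. polar_half (V x))"
  by (simp add: op_B_def polar_half_def half_abs_def)

lemma mult_op_iff: "(u, v) \<in> mult_op M \<longleftrightarrow> (AE x in lborel. fun_of v x = M x *v fun_of u x)"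
  by (simp add: mult_op_def)

lemma mult_op_class_of:
  assumes f: "sq_integrable f" and g: "sq_integrable g" and e: "AE x in lborel. g x = M x *v f x"
  shows "(class_of f, class_of g) \<in> mult_op M"
  unfolding mult_op_iff using fun_of_class_of[OF f] fun_of_class_of[OF g] e by eventually_elim simp

lemma linear_op_mult_op: "linear_op (mult_op M)"
  unfolding linear_op_def
proof (intro conjI allI impI)
  show "(0, 0) \<in> mult_op M"
    unfolding mult_op_iff using fun_of_zero by eventually_elim (simp add: vec_eq_iff matrix_vector_2)
  show "(u + u', v + v') \<in> mult_op M" if "(u, v) \<in> mult_op M \<and> (u', v') \<in> mult_op M" for u v u' v'
  proof -
    have "AE x in lborel. fun_of v x = M x *v fun_of u x" "AE x in lborel. fun_of v' x = M x *v fun_of u' x"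
      using that by (auto simp: mult_op_iff)
    then show ?thesis unfolding mult_op_iff using fun_of_plus[of u u'] fun_of_plus[of v v']
      by eventually_elim (simp add: matrix_vector_right_distrib)
  qed
  show "(c *\<^sub>C u, c *\<^sub>C v) \<in> mult_op M" if "(u, v) \<in> mult_op M" for c u v
  proof -
    have "AE x in lborel. fun_of v x = M x *v fun_of u x" using that by (simp add: mult_op_iff)
    then show ?thesis unfolding mult_op_iff using fun_of_scaleC[of c u] fun_of_scaleC[of c v]
      by eventually_elim (simp add: vec_eq_iff matrix_vector_2 algebra_simps)
  qed
  show "single_valued (mult_op M)"
  proof (rule single_valuedI)
    fix u v w assume "(u, v) \<in> mult_op M" "(u, w) \<in> mult_op M"
    then have "AE x in lborel. fun_of v x = M x *v fun_of u x" "AE x in lborel. fun_of w x = M x *v fun_of u x"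
      by (auto simp: mult_op_iff)
    then have "AE x in lborel. fun_of v x = fun_of w x" by eventually_elim simp
    then show "v = w" by (rule L2_eqI)
  qed
qed

lemma matrix_vector_scale: "(M :: complex^2^2) *v (c *s v) = c *s (M *v v)"
  by (simp add: vec_eq_iff matrix_vector_2 algebra_simps)

text \<open>Bijectivity with a bounded inverse, in relational form.\<close>

lemma bounded_op_resolvent_minus_one:
  assumes T: "bounded_map T" and ex: "\<And>w. \<exists>h. w = h + T h" and bd: "\<And>h. norm h \<le> C * norm (h + T h)"
  shows "bounded_op (resolvent (graph T) (-1))"
proof -
  obtain S where S: "\<And>w. w = S w + T (S w)" using ex by metis
  have uniq: "h = h'" if "h + T h = h' + T h'" for h h'
  proof -
    have "(h - h') + T (h - h') = (h + T h) - (h' + T h')"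
      by (simp add: bounded_mapD[OF T] algebra_simps)
    then have "norm (h - h') \<le> C * norm (0 :: L2)" using bd[of "h - h'"] that by simp
    then show ?thesis by simp
  qed
  have S_iff: "h = S w \<longleftrightarrow> w = h + T h" for h w using S[of w] uniq[of h "S w"] by metis
  have "bounded_map S"
  proof (rule bounded_mapI)
    fix u v c
    have "u + v = (S u + S v) + T (S u + S v)" using S[of u] S[of v] by (simp add: bounded_mapD[OF T]) (metis add.assoc add.left_commute)
    then show "S (u + v) = S u + S v" using S_iff by metis
    have "c *\<^sub>C u = c *\<^sub>C S u + T (c *\<^sub>C S u)" using S[of u] by (metis bounded_mapD(2)[OF T] scaleC_add_right)
    then show "S (c *\<^sub>C u) = c *\<^sub>C S u" using S_iff by metis
    show "norm (S u) \<le> C * norm u" using bd[of "S u"] S[of u] by metis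
  qed
  moreover have "resolvent (graph T) (-1) = graph S"
  proof -
    have "(w, h) \<in> resolvent (graph T) (-1) \<longleftrightarrow> h = S w" for w h
      unfolding resolvent_iff graph_iff S_iff scaleC_minus_one by (auto simp: algebra_simps)
    then show ?thesis by (auto simp: graph_iff)
  qed
  ultimately show ?thesis using bounded_op_graph by simp
qed

lemma admissible_cong_AE:
  assumes a: "admissible a" and [measurable]: "b \<in> borel_measurable borel" and e: "AE x in lborel. a x = b x"
  shows "admissible b"
  unfolding admissible_def
proof (intro conjI allI)
  have [measurable]: "a \<in> borel_measurable borel" using a by (simp add: admissible_def)
  fix x :: real
  have "integrable lborel (\<lambda>y. exp (- \<bar>x - y\<bar>) * norm (a y))" using a by (simp add: admissible_def)
  then show "integrable lborel (\<lambda>y. exp (- \<bar>x - y\<bar>) * norm (b y))"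
    by (rule integrable_cong_AE_imp) (use e in \<open>auto elim: eventually_mono\<close>)
qed simp

text \<open>Integrability of the operator norm makes the four maps of the abstract construction bounded; they are
defined here. Smallness, which inverts \<open>I + Q(0)\<close>, enters afterwards.\<close>

locale potential =
  fixes m :: real and V :: "real \<Rightarrow> complex^2^2"
  assumes m: "m > 0" and measV[measurable]: "V \<in> borel_measurable borel"
    and intV: "integrable lborel (\<lambda>x. opnorm (V x))"
begin

abbreviation n where "n x \<equiv> opnorm (V x)"
abbreviation A where "A x \<equiv> half_abs (V x)"
abbreviation B where "B x \<equiv> polar_half (V x)"
abbreviation K where "K \<equiv> green_norm m"

definition N1 :: real where "N1 = (LINT x|lborel. n x)"

lemma N1_nonneg: "N1 \<ge> 0" unfolding N1_def by (intro integral_nonneg_AE AE_I2 opnorm_nonneg)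

lemma measA[measurable]: "(\<lambda>x. A x) \<in> borel_measurable borel"
  and measB[measurable]: "(\<lambda>x. B x) \<in> borel_measurable borel"
  using measurable_polar_factors[OF measV] by auto

lemma K_pos: "K > 0" by (rule green_norm_pos)

lemma norm_A: "(norm (A x *v v))\<^sup>2 \<le> n x * (norm v)\<^sup>2" by (rule norm_half_abs)
lemma norm_B: "(norm (B x *v v))\<^sup>2 \<le> n x * (norm v)\<^sup>2" unfolding norm_polar_half by (rule norm_half_abs)
lemma BA: "B x *v (A x *v v) = V x *v v" by (simp add: matrix_vector_mul_assoc polar_half_mult)

lemma B_L1:
  assumes h: "sq_integrable h" and I: "(LINT x|lborel. (norm (h x))\<^sup>2) = I\<^sup>2" "I \<ge> 0"
  shows "integrable lborel (\<lambda>x. B x *v h x)" "(LINT x|lborel. norm (B x *v h x)) \<le> (N1 + 1) * I"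
proof -
  have [measurable]: "h \<in> borel_measurable borel" and h2: "integrable lborel (\<lambda>x. (norm (h x))\<^sup>2)"
    using h by (auto simp: sq_integrable_def)
  have bd: "norm (B x *v h x) \<le> t * n x + (norm (h x))\<^sup>2 / t" if t: "t > 0" for x t
  proof -
    have nn: "n x \<ge> 0" by (rule opnorm_nonneg)
    have "(norm (B x *v h x))\<^sup>2 \<le> (t * n x) * ((norm (h x))\<^sup>2 / t)" using norm_B[of x "h x"] t by simp
    also have "\<dots> \<le> (t * n x + (norm (h x))\<^sup>2 / t)\<^sup>2"
    proof -
      have ab: "a * b \<le> (a + b)\<^sup>2" if "a \<ge> 0" "b \<ge> 0" for a b :: real
        using that by (simp add: power2_eq_square algebra_simps)
      show ?thesis by (rule ab) (use nn t in simp_all)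
    qed
    finally show ?thesis by (rule power2_le_imp_le) (use nn t in simp)
  qed
  have I': "integrable lborel (\<lambda>x. t * n x + (norm (h x))\<^sup>2 / t)" for t
    using intV h2 by simp
  show Ib: "integrable lborel (\<lambda>x. B x *v h x)"
    by (rule Bochner_Integration.integrable_bound[OF I'[of 1]]) (use bd[of 1] opnorm_nonneg in \<open>auto intro!: AE_I2\<close>)
  show "(LINT x|lborel. norm (B x *v h x)) \<le> (N1 + 1) * I"
  proof (cases "I = 0")
    case False
    \<comment> \<open>The weight \<open>t = I\<close> makes both halves of the pointwise bound proportional to \<open>I\<close>.\<close>
    then have t: "I > 0" using I(2) by simp
    have "(LINT x|lborel. norm (B x *v h x)) \<le> (LINT x|lborel. I * n x + (norm (h x))\<^sup>2 / I)"
      using Ib by (intro integral_mono I' bd t) auto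
    also have "\<dots> = I * N1 + I\<^sup>2 / I" using intV h2 I(1) by (simp add: N1_def)
    also have "\<dots> = (N1 + 1) * I" using t by (simp add: power2_eq_square algebra_simps)
    finally show ?thesis .
  next
    case True
    then have "AE x in lborel. (norm (h x))\<^sup>2 = 0"
      using I(1) integral_nonneg_eq_0_iff_AE[OF h2] by simp
    then have "AE x in lborel. norm (B x *v h x) = 0"
      by eventually_elim (simp add: vec_eq_iff matrix_vector_2)
    then have "(LINT x|lborel. norm (B x *v h x)) = 0" by (rule integral_eq_zero_AE)
    then show ?thesis using True by simp
  qed
qed

lemma A_bounded:
  assumes [measurable]: "F \<in> borel_measurable borel" and F: "\<And>x. norm (F x) \<le> M" and M: "M \<ge> 0"
  shows "sq_integrable (\<lambda>x. A x *v F x)" "(LINT x|lborel. (norm (A x *v F x))\<^sup>2) \<le> (sqrt N1 * M)\<^sup>2"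
proof -
  have le: "(norm (A x *v F x))\<^sup>2 \<le> M\<^sup>2 * n x" for x
  proof -
    have "n x * (norm (F x))\<^sup>2 \<le> n x * M\<^sup>2" using F by (intro mult_left_mono power_mono opnorm_nonneg) auto
    then show ?thesis using norm_A[of x "F x"] by (simp add: mult.commute)
  qed
  have I: "integrable lborel (\<lambda>x. M\<^sup>2 * n x)" using intV by simp
  have I2: "integrable lborel (\<lambda>x. (norm (A x *v F x))\<^sup>2)"
    by (rule Bochner_Integration.integrable_bound[OF I]) (use le opnorm_nonneg in \<open>auto intro!: AE_I2\<close>)
  then show "sq_integrable (\<lambda>x. A x *v F x)" by (simp add: sq_integrable_def)
  have "(LINT x|lborel. (norm (A x *v F x))\<^sup>2) \<le> (LINT x|lborel. M\<^sup>2 * n x)" by (rule integral_mono[OF I2 I le])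
  also have "\<dots> = (sqrt N1 * M)\<^sup>2" using N1_nonneg by (simp add: N1_def power_mult_distrib)
  finally show "(LINT x|lborel. (norm (A x *v F x))\<^sup>2) \<le> (sqrt N1 * M)\<^sup>2" .
qed

lemma V_L1:
  assumes [measurable]: "F \<in> borel_measurable borel" and F: "\<And>x. norm (F x) \<le> M" and M: "M \<ge> 0"
  shows "integrable lborel (\<lambda>x. V x *v F x)" "(LINT x|lborel. norm (V x *v F x)) \<le> N1 * M"
proof -
  have le: "norm (V x *v F x) \<le> n x * M" for x
    using opnorm_bound[of "V x" "F x"] mult_left_mono[OF F[of x] opnorm_nonneg[of "V x"]] by linarith
  have I: "integrable lborel (\<lambda>x. n x * M)" using intV by simp
  show I2: "integrable lborel (\<lambda>x. V x *v F x)"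
    by (rule Bochner_Integration.integrable_bound[OF I]) (use le opnorm_nonneg M in \<open>auto intro!: AE_I2 simp: abs_mult\<close>)
  have "(LINT x|lborel. norm (V x *v F x)) \<le> (LINT x|lborel. n x * M)" using I2 by (intro integral_mono I le) auto
  then show "(LINT x|lborel. norm (V x *v F x)) \<le> N1 * M" by (simp add: N1_def)
qed

definition gB :: "L2 \<Rightarrow> real \<Rightarrow> complex^2" where "gB h = green m (\<lambda>x. B x *v fun_of h x)"
definition RB :: "L2 \<Rightarrow> L2" where "RB h = class_of (gB h)"
definition AG :: "L2 \<Rightarrow> L2" where "AG g = class_of (\<lambda>x. A x *v green m (fun_of g) x)"
definition AGB :: "L2 \<Rightarrow> L2" where "AGB h = class_of (\<lambda>x. A x *v gB h x)"

lemmas BL1 = B_L1[OF sq_fun_of norm_L2_square[symmetric] norm_ge_zero]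

lemma adm_B: "admissible (\<lambda>x. B x *v fun_of h x)"
  by (rule admissible_L1[OF BL1(1)])

lemma gB_props:
  "norm (gB h x) \<le> K * ((N1 + 1) * norm h)" "sq_integrable (gB h)"
  "(LINT x|lborel. (norm (gB h x))\<^sup>2) \<le> (K * ((N1 + 1) * norm h))\<^sup>2" "gB h \<in> borel_measurable borel"
proof -
  note g = green_L1[OF BL1(1) m, of h]
  let ?I = "(LINT x|lborel. norm (B x *v fun_of h x))"
  have I: "0 \<le> ?I" "K * ?I \<le> K * ((N1 + 1) * norm h)" using BL1(2)[of h] K_pos by (auto intro!: mult_left_mono)
  show "norm (gB h x) \<le> K * ((N1 + 1) * norm h)" using g(1)[of x] I(2) unfolding gB_def by linarith
  show "sq_integrable (gB h)" unfolding gB_def by (rule g(2))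
  have "(K * ?I)\<^sup>2 \<le> (K * ((N1 + 1) * norm h))\<^sup>2" using I K_pos by (intro power_mono) auto
  then show "(LINT x|lborel. (norm (gB h x))\<^sup>2) \<le> (K * ((N1 + 1) * norm h))\<^sup>2" using g(3) unfolding gB_def by linarith
  show "gB h \<in> borel_measurable borel" unfolding gB_def by (rule measurable_green[OF adm_B m])
qed

lemma gB_cong: 
  assumes "AE x in lborel. B x *v fun_of h x = s x" "s \<in> borel_measurable borel"
  shows "admissible s" "gB h = green m s"
proof -
  show "admissible s" by (rule admissible_cong_AE[OF adm_B assms(2,1)])
  then show "gB h = green m s" unfolding gB_def by (intro ext green_cong_AE adm_B assms)
qed

lemma gB_add: "gB (u + v) x = gB u x + gB v x"
proof -
  have "gB (u + v) = green m (\<lambda>x. B x *v fun_of u x + B x *v fun_of v x)"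
  proof (rule gB_cong)
    show "AE x in lborel. B x *v fun_of (u + v) x = B x *v fun_of u x + B x *v fun_of v x"
      using fun_of_plus[of u v] by eventually_elim (simp add: matrix_vector_right_distrib)
  qed measurable
  then show ?thesis by (simp add: gB_def green_add adm_B)
qed

lemma gB_scale: "gB (c *\<^sub>C u) x = c *s gB u x"
proof -
  have "gB (c *\<^sub>C u) = green m (\<lambda>x. c *s (B x *v fun_of u x))"
  proof (rule gB_cong)
    show "AE x in lborel. B x *v fun_of (c *\<^sub>C u) x = c *s (B x *v fun_of u x)"
      using fun_of_scaleC[of c u] by eventually_elim (simp add: matrix_vector_scale)
    show "(\<lambda>x. c *s (B x *v fun_of u x)) \<in> borel_measurable borel"
      by (rule measurable_vector_scalar_mult) measurable
  qed
  then show ?thesis by (simp add: gB_def green_scale)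
qed

lemma greenf_add: "green m (fun_of (u + v)) x = green m (fun_of u) x + green m (fun_of v) x"
proof -
  have "green m (fun_of (u + v)) x = green m (\<lambda>x. fun_of u x + fun_of v x) x"
    by (rule green_cong_AE[OF green_fun_of(1)[OF m] admissible_add[OF green_fun_of(1)[OF m] green_fun_of(1)[OF m]] fun_of_plus])
  then show ?thesis by (simp add: green_add green_fun_of(1)[OF m])
qed

lemma greenf_scale: "green m (fun_of (c *\<^sub>C u)) x = c *s green m (fun_of u) x"
proof -
  have "green m (fun_of (c *\<^sub>C u)) x = green m (\<lambda>x. c *s fun_of u x) x"
  proof (rule green_cong_AE[OF green_fun_of(1)[OF m] admissible_cong_AE[OF green_fun_of(1)[OF m]] fun_of_scaleC])
    show "(\<lambda>x. c *s fun_of u x) \<in> borel_measurable borel"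
      by (rule measurable_vector_scalar_mult) measurable
  qed (rule fun_of_scaleC)
  then show ?thesis by (simp add: green_scale)
qed

lemma class_of_add: "sq_integrable f \<Longrightarrow> sq_integrable g \<Longrightarrow> class_of (\<lambda>x. f x + g x) = class_of f + class_of g"
  by (subst plus_L2.abs_eq) (auto simp: L2_rel_refl_iff)

lemma class_of_scale: "sq_integrable f \<Longrightarrow> class_of (\<lambda>x. c *s f x) = c *\<^sub>C class_of f"
  by (subst scaleC.abs_eq) (auto simp: L2_rel_refl_iff)

lemma class_of_diff: "sq_integrable f \<Longrightarrow> sq_integrable g \<Longrightarrow> class_of (\<lambda>x. f x - g x) = class_of f - class_of g"
  by (subst minus_L2.abs_eq) (auto simp: L2_rel_refl_iff)

lemma map_G: "bounded_map (free_inverse m)"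
proof (rule bounded_mapI)
  fix u v c
  show "free_inverse m (u + v) = free_inverse m u + free_inverse m v"
    unfolding free_inverse_def greenf_add by (rule class_of_add) (rule green_fun_of[OF m])+
  show "free_inverse m (c *\<^sub>C u) = c *\<^sub>C free_inverse m u"
    unfolding free_inverse_def greenf_scale by (rule class_of_scale) (rule green_fun_of[OF m])
  show "norm (free_inverse m u) \<le> K * norm u" by (rule green_fun_of[OF m])
qed

lemma map_RB: "bounded_map RB"
proof (rule bounded_mapI)
  fix u v c
  show "RB (u + v) = RB u + RB v" unfolding RB_def
    by (subst class_of_add[symmetric]) (simp_all add: gB_props gB_add[abs_def])
  show "RB (c *\<^sub>C u) = c *\<^sub>C RB u" unfolding RB_def
    by (subst class_of_scale[symmetric]) (simp_all add: gB_props gB_scale[abs_def])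
  show "norm (RB u) \<le> (K * (N1 + 1)) * norm u" unfolding RB_def
    using norm_class_of_le[OF gB_props(2,3)] K_pos N1_nonneg by (simp add: mult.assoc)
qed

lemma sqA_green: "sq_integrable (\<lambda>x. A x *v green m (fun_of g) x)"
    "(LINT x|lborel. (norm (A x *v green m (fun_of g) x))\<^sup>2) \<le> (sqrt N1 * (K * norm g))\<^sup>2"
  by (rule A_bounded[OF measurable_green[OF green_fun_of(1)[OF m] m] green_fun_of(2)[OF m]], use K_pos in simp)+

lemma sqA_gB: "sq_integrable (\<lambda>x. A x *v gB h x)"
    "(LINT x|lborel. (norm (A x *v gB h x))\<^sup>2) \<le> (sqrt N1 * (K * ((N1 + 1) * norm h)))\<^sup>2"
  by (rule A_bounded[OF gB_props(4,1)], use K_pos N1_nonneg in simp)+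

lemma map_AG: "bounded_map AG"
proof (rule bounded_mapI)
  fix u v c
  show "AG (u + v) = AG u + AG v" unfolding AG_def
    by (subst class_of_add[symmetric]) (simp_all add: sqA_green greenf_add matrix_vector_right_distrib)
  show "AG (c *\<^sub>C u) = c *\<^sub>C AG u" unfolding AG_def
    by (subst class_of_scale[symmetric]) (simp_all add: sqA_green greenf_scale matrix_vector_scale)
  show "norm (AG u) \<le> (sqrt N1 * K) * norm u" unfolding AG_def
    using norm_class_of_le[OF sqA_green] K_pos N1_nonneg by (simp add: mult.assoc)
qed

lemma map_AGB: "bounded_map AGB"
proof (rule bounded_mapI)
  fix u v c
  show "AGB (u + v) = AGB u + AGB v" unfolding AGB_def
    by (subst class_of_add[symmetric]) (simp_all add: sqA_gB gB_add matrix_vector_right_distrib)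
  show "AGB (c *\<^sub>C u) = c *\<^sub>C AGB u" unfolding AGB_def
    by (subst class_of_scale[symmetric]) (simp_all add: sqA_gB gB_scale matrix_vector_scale)
  show "norm (AGB u) \<le> (sqrt N1 * K * (N1 + 1)) * norm u" unfolding AGB_def
    using norm_class_of_le[OF sqA_gB] K_pos N1_nonneg by (simp add: mult.assoc)
qed

lemma AG_A: "(free_inverse m g, AG g) \<in> op_A V"
  unfolding op_A_eq free_inverse_def AG_def by (rule mult_op_class_of[OF green_fun_of(3)[OF m] sqA_green(1)]) simp

lemma AGB_A: "(RB h, AGB h) \<in> op_A V"
  unfolding op_A_eq RB_def AGB_def by (rule mult_op_class_of[OF gB_props(2) sqA_gB(1)]) simp

lemma G_B: assumes "(u, v) \<in> op_B V" shows "free_inverse m v = RB u"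
proof -
  have "AE x in lborel. B x *v fun_of u x = fun_of v x"
    using assms unfolding op_B_eq mult_op_iff by eventually_elim simp
  from gB_cong(2)[OF this] show ?thesis by (simp add: free_inverse_def RB_def)
qed

text \<open>Truncating the potential at level \<open>k\<close> approximates every element by elements of the domain.\<close>

lemma dense_B: "closure (Domain (op_B V)) = UNIV"
proof -
  have "u \<in> closure (Domain (op_B V))" for u
  proof -
    define c where "c = (\<lambda>k x. (if n x \<le> real k then 1 else 0) *\<^sub>R fun_of u x)"
    have [measurable]: "c k \<in> borel_measurable borel" for k unfolding c_def by measurable
    have sqc: "sq_integrable (c k)" for k
      by (rule sq_integrable_bound[OF sq_fun_of[of u] sq_integrable_zero, of _ 1]) (auto simp: c_def)
    have sqB: "sq_integrable (\<lambda>x. B x *v c k x)" for k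
    proof (rule sq_integrable_bound[OF sq_fun_of[of u] sq_integrable_zero, of _ "sqrt (real k)"])
      fix x
      have "(norm (B x *v c k x))\<^sup>2 \<le> n x * (norm (c k x))\<^sup>2" by (rule norm_B)
      also have "\<dots> \<le> real k * (norm (fun_of u x))\<^sup>2" by (auto simp: c_def intro!: mult_right_mono)
      also have "\<dots> = (sqrt (real k) * norm (fun_of u x))\<^sup>2" by (simp add: power_mult_distrib)
      finally have "norm (B x *v c k x) \<le> sqrt (real k) * norm (fun_of u x)" by (rule power2_le_imp_le) simp
      then show "norm (B x *v c k x) \<le> sqrt (real k) * (norm (fun_of u x) + norm (0::complex^2))" by simp
    qed measurable
    have dom: "class_of (c k) \<in> Domain (op_B V)" for k
    proof -
      have "(class_of (c k), class_of (\<lambda>x. B x *v c k x)) \<in> op_B V"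
        unfolding op_B_eq by (rule mult_op_class_of[OF sqc sqB]) simp
      then show ?thesis by blast
    qed
    have "(\<lambda>k. LINT x|lborel. (norm (fun_of u x - c k x))\<^sup>2) \<longlonglongrightarrow> (LINT x::real|lborel. 0)"
    proof (rule integral_dominated_convergence[where w = "\<lambda>x. (norm (fun_of u x))\<^sup>2"])
      show "integrable lborel (\<lambda>x. (norm (fun_of u x))\<^sup>2)" using sq_fun_of by (simp add: sq_integrable_def)
      show "AE x in lborel. (\<lambda>k. (norm (fun_of u x - c k x))\<^sup>2) \<longlonglongrightarrow> 0"
      proof (intro AE_I2 tendsto_eventually)
        fix x
        obtain k0 where "n x \<le> real k0" using real_arch_simple by blast
        then have "(norm (fun_of u x - c k x))\<^sup>2 = 0" if "k \<ge> k0" for k using that by (auto simp: c_def)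
        then show "\<forall>\<^sub>F k in sequentially. (norm (fun_of u x - c k x))\<^sup>2 = 0" unfolding eventually_sequentially by blast
      qed
      show "AE x in lborel. norm ((norm (fun_of u x - c k x))\<^sup>2) \<le> (norm (fun_of u x))\<^sup>2" for k
        by (intro AE_I2) (simp add: c_def)
    qed auto
    then have "(\<lambda>k. (norm (class_of (\<lambda>x. fun_of u x - c k x)))\<^sup>2) \<longlonglongrightarrow> 0"
      by (simp add: norm_class_of[OF sq_integrable_diff[OF sq_fun_of sqc]])
    then have "(\<lambda>k. (norm (u - class_of (c k)))\<^sup>2) \<longlonglongrightarrow> 0"
      by (simp add: class_of_diff[OF sq_fun_of sqc] class_of_fun_of)
    then have "(\<lambda>k. sqrt ((norm (u - class_of (c k)))\<^sup>2)) \<longlonglongrightarrow> sqrt 0" by (rule tendsto_real_sqrt)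
    then have "(\<lambda>k. norm (class_of (c k) - u)) \<longlonglongrightarrow> 0" by (simp add: norm_minus_commute)
    then have "(\<lambda>k. class_of (c k)) \<longlonglongrightarrow> u" by (simp add: tendsto_norm_zero_iff LIM_zero_iff)
    then show ?thesis unfolding closure_sequential
      by (intro exI[of _ "\<lambda>k. class_of (c k)"] conjI allI dom)
  qed
  then show ?thesis by blast
qed

end

section \<open>Small potentials and the eigenvalue bound\<close>

text \<open>The condition makes \<open>F \<mapsto> G (V F)\<close> a contraction in the supremum norm.\<close>

locale small_potential = potential +
  assumes contraction: "green_norm m * N1 < 1"
begin

lemma fixed_point_bound:
  assumes [measurable]: "F \<in> borel_measurable borel" and F: "\<And>x. norm (F x) \<le> M"
    and s: "integrable lborel s" and eq: "\<And>x. F x = green m (\<lambda>y. s y - V y *v F y) x"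
  shows "norm (F x) \<le> K * (LINT y|lborel. norm (s y)) / (1 - K * N1)"
proof -
  \<comment> \<open>The a priori bound makes the supremum finite, so that it can be absorbed.\<close>
  define S where "S = Sup (range (\<lambda>x. norm (F x)))"
  have bdd: "bdd_above (range (\<lambda>x. norm (F x)))" using F by (auto intro!: bdd_aboveI)
  have FS: "norm (F x) \<le> S" for x unfolding S_def by (rule cSUP_upper[OF UNIV_I bdd])
  have S0: "S \<ge> 0" using FS[of 0] norm_ge_zero order_trans by blast
  note v = V_L1[OF assms(1) FS S0]
  have i: "integrable lborel (\<lambda>y. s y - V y *v F y)" using s v(1) by (rule Bochner_Integration.integrable_diff)
  have "(LINT y|lborel. norm (s y - V y *v F y)) \<le> (LINT y|lborel. norm (s y) + norm (V y *v F y))"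
    using i s v(1) by (intro integral_mono) (auto intro: norm_triangle_ineq4)
  also have "\<dots> \<le> (LINT y|lborel. norm (s y)) + N1 * S" using s v by simp
  finally have "K * (LINT y|lborel. norm (s y - V y *v F y)) \<le> K * ((LINT y|lborel. norm (s y)) + N1 * S)"
    using K_pos by (intro mult_left_mono) auto
  then have "norm (F x) \<le> K * ((LINT y|lborel. norm (s y)) + N1 * S)" for x
    using green_L1(1)[OF i m, of x] eq[of x] by simp
  then have "S \<le> K * ((LINT y|lborel. norm (s y)) + N1 * S)" unfolding S_def by (intro cSUP_least) auto
  then have "S * (1 - K * N1) \<le> K * (LINT y|lborel. norm (s y))" by (simp add: algebra_simps)
  then have "S \<le> K * (LINT y|lborel. norm (s y)) / (1 - K * N1)" using contraction by (simp add: pos_le_divide_eq)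
  then show ?thesis using FS[of x] by linarith
qed

lemma green_diff:
  assumes "admissible g" "admissible h"
  shows "green m (\<lambda>y. g y - h y) x = green m g x - green m h x"
proof -
  have n: "(\<lambda>y. (-1) *s h y) = (\<lambda>y. - h y)" by (auto simp: vec_eq_iff)
  have a: "admissible (\<lambda>y. - h y)" using assms(2) by (simp add: admissible_def)
  have "green m (\<lambda>y. - h y) x = (-1) *s green m h x" using green_scale[of m "-1" h x] unfolding n .
  then show ?thesis using green_add[OF assms(1) a, of m x] by (simp add: vec_eq_iff)
qed

text \<open>Inverting \<open>I + Q(0)\<close> amounts to solving \<open>F = G (s - V F)\<close>, which is done among the bounded continuous
functions, a complete space, rather than among square integrable classes.\<close>

lemma fixed_point_exists:
  assumes s: "integrable lborel s"
 obtains F M where "continuous_on UNIV F" "\<And>x. norm (F x) \<le> M" "\<And>x. F x = green m (\<lambda>y. s y - V y *v F y) x"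
proof -
  let ?src = "\<lambda>F :: real \<Rightarrow>\<^sub>C (complex^2). \<lambda>y. s y - V y *v apply_bcontfun F y"
  have mF: "apply_bcontfun F \<in> borel_measurable borel" for F :: "real \<Rightarrow>\<^sub>C (complex^2)"
    by (rule borel_measurable_continuous_onI[OF continuous_on_apply_bcontfun])
  have int: "integrable lborel (?src F)" for F
    by (rule Bochner_Integration.integrable_diff[OF s V_L1(1)[OF mF norm_bounded norm_ge_zero]])
  have mem: "green m (?src F) \<in> bcontfun" for F
    by (rule bcontfun_normI[OF continuous_green[OF admissible_L1[OF int] m] green_L1(1)[OF int m]])
  define \<Phi> where "\<Phi> F = Bcontfun (green m (?src F))" for F
  have app: "apply_bcontfun (\<Phi> F) = green m (?src F)" for F
    unfolding \<Phi>_def by (rule Bcontfun_inverse[OF mem])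
  have "\<exists>!F. \<Phi> F = F"
  proof (rule banach_fix_type[of "K * N1"])
    show "0 \<le> K * N1" using K_pos N1_nonneg by simp
    show "K * N1 < 1" by (rule contraction)
    show "\<forall>F F'. dist (\<Phi> F) (\<Phi> F') \<le> K * N1 * dist F F'"
    proof (intro allI dist_bound)
      fix F F' :: "real \<Rightarrow>\<^sub>C (complex^2)" and x :: real
      let ?D = "\<lambda>y. apply_bcontfun F' y - apply_bcontfun F y"
      have mD: "?D \<in> borel_measurable borel" by (rule borel_measurable_diff[OF mF mF])
      have bD: "norm (?D y) \<le> dist F F'" for y
        using dist_bounded[of F y F'] by (simp add: dist_norm norm_minus_commute)
      note v = V_L1[OF mD bD zero_le_dist]
      have e: "(\<lambda>y. ?src F y - ?src F' y) = (\<lambda>y. V y *v ?D y)"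
        by (auto simp: matrix_vector_mult_diff_distrib)
      have "dist (apply_bcontfun (\<Phi> F) x) (apply_bcontfun (\<Phi> F') x) = norm (green m (\<lambda>y. V y *v ?D y) x)"
        unfolding app dist_norm green_diff[OF admissible_L1[OF int] admissible_L1[OF int], symmetric] e ..
      also have "\<dots> \<le> K * (LINT y|lborel. norm (V y *v ?D y))" by (rule green_L1(1)[OF v(1) m])
      also have "\<dots> \<le> K * (N1 * dist F F')" using v(2) K_pos by (intro mult_left_mono) auto
      finally show "dist (apply_bcontfun (\<Phi> F) x) (apply_bcontfun (\<Phi> F') x) \<le> K * N1 * dist F F'" by (simp add: mult.assoc)
    qed
  qed
  then obtain F where F: "\<Phi> F = F" by blast
  have eq: "apply_bcontfun F x = green m (?src F) x" for x using app[of F] unfolding F by simp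
  have "norm (apply_bcontfun F x) \<le> norm F" for x by (rule norm_bounded)
  then show ?thesis by (intro that[of "apply_bcontfun F" "norm F"] eq continuous_on_apply_bcontfun)
qed

text \<open>If \<open>w = h + A G B h\<close> then \<open>F = G B h\<close> satisfies \<open>F = G (B w - V F)\<close>, so \<open>w\<close> bounds \<open>F\<close> and thereby \<open>A F = w - h\<close>.\<close>

lemma inverse_bound:
  "norm h \<le> (1 + sqrt N1 * (K * (N1 + 1) / (1 - K * N1))) * norm (h + AGB h)"
proof -
  define w where "w = h + AGB h"
  let ?s = "\<lambda>x. B x *v fun_of w x" and ?F = "gB h"
  have [measurable]: "?F \<in> borel_measurable borel" by (rule gB_props)
  have "AE x in lborel. B x *v fun_of h x = ?s x - V x *v ?F x"
    using fun_of_plus[of h "AGB h"] fun_of_class_of[OF sqA_gB(1)[of h]]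
  proof eventually_elim
    case (elim x)
    have "fun_of h x = fun_of w x - A x *v ?F x" using elim by (simp add: w_def AGB_def)
    then show ?case by (simp add: matrix_vector_mult_diff_distrib BA)
  qed
  from gB_cong(2)[OF this] have eq: "?F x = green m (\<lambda>x. ?s x - V x *v ?F x) x" for x by simp
  define M where "M = K * ((N1 + 1) * norm w) / (1 - K * N1)"
  have M0: "M \<ge> 0" unfolding M_def using K_pos N1_nonneg contraction by simp
  have "norm (?F x) \<le> M" for x
  proof -
    have "norm (?F x) \<le> K * (LINT y|lborel. norm (?s y)) / (1 - K * N1)"
      by (rule fixed_point_bound[OF gB_props(4) gB_props(1) BL1(1) eq])
    also have "\<dots> \<le> M" unfolding M_def using K_pos contraction BL1(2)[of w]
      by (intro divide_right_mono mult_left_mono) auto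
    finally show ?thesis .
  qed
  from A_bounded[OF gB_props(4) this M0] have "norm (AGB h) \<le> sqrt N1 * M"
    unfolding AGB_def using M0 N1_nonneg by (intro norm_class_of_le) auto
  moreover have "norm h \<le> norm w + norm (AGB h)"
    using norm_triangle_ineq4[of w "AGB h"] by (simp add: w_def)
  ultimately show ?thesis by (simp add: M_def w_def algebra_simps)
qed

lemma inverse_exists: "\<exists>h. w = h + AGB h"
proof -
  let ?s = "\<lambda>x. B x *v fun_of w x"
  obtain F M where F: "continuous_on UNIV F" "\<And>x. norm (F x) \<le> M" "\<And>x. F x = green m (\<lambda>y. ?s y - V y *v F y) x"
    by (rule fixed_point_exists[OF BL1(1)[of w]]) (rule that; assumption)
  have [measurable]: "F \<in> borel_measurable borel" by (rule borel_measurable_continuous_onI[OF F(1)])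
  have M0: "M \<ge> 0" using F(2)[of 0] norm_ge_zero order_trans by blast
  have sq: "sq_integrable (\<lambda>x. A x *v F x)" by (rule A_bounded[OF _ F(2) M0]) simp
  define h where "h = w - class_of (\<lambda>x. A x *v F x)"
  have "AE x in lborel. B x *v fun_of h x = ?s x - V x *v F x"
    using fun_of_minus[of w "class_of (\<lambda>x. A x *v F x)"] fun_of_class_of[OF sq]
    by eventually_elim (simp add: h_def matrix_vector_mult_diff_distrib BA)
  from gB_cong(2)[OF this] have g: "gB h = green m (\<lambda>x. ?s x - V x *v F x)" by simp
  have "gB h = F" unfolding g by (rule ext) (rule F(3)[symmetric])
  then have "w = h + AGB h" by (simp add: AGB_def h_def)
  then show ?thesis by blast
qed

sublocale perturbation m V "free_inverse m" RB AG AGB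
proof
  show "bounded_map (free_inverse m)" "bounded_map RB" "bounded_map AG" "bounded_map AGB"
    by (rule map_G map_RB map_AG map_AGB)+
  show "op_L0 m = {(free_inverse m g, g) | g. True}" by (rule op_L0_eq[OF m])
  show "\<And>g. free_inverse m g = 0 \<Longrightarrow> g = 0" by (rule free_inverse_inj[OF m])
  show "linear_op (op_A V)" unfolding op_A_eq by (rule linear_op_mult_op)
  show "\<And>g. (free_inverse m g, AG g) \<in> op_A V" by (rule AG_A)
  show "\<And>h. (RB h, AGB h) \<in> op_A V" by (rule AGB_A)
  show "\<And>u v. (u, v) \<in> op_B V \<Longrightarrow> free_inverse m v = RB u" by (rule G_B)
  show "closure (Domain (op_B V)) = UNIV" by (rule dense_B)
  show "bounded_op (resolvent (graph AGB) (- 1))"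
    by (rule bounded_op_resolvent_minus_one[OF map_AGB inverse_exists inverse_bound])
qed

text \<open>An eigenfunction has the continuous bounded representative \<open>F = G (z F - V F)\<close>. It solves the Dirac
system with spectral parameter \<open>z\<close> and source \<open>- V F\<close>, whose size is at most the potential times the
supremum \<open>M\<close> of \<open>F\<close>.\<close>

lemma eigenfunction_system:
  assumes z: "z \<in> point_spectrum (op_LV m V)"
  obtains F M where "M > 0" "\<forall>b. (\<forall>x. norm (F x) \<le> b) \<longrightarrow> M \<le> b"
    "line_system m z (\<lambda>x. F x $ 1) (\<lambda>x. F x $ 2) (\<lambda>x. - (V x *v F x) $ 2) (\<lambda>x. (V x *v F x) $ 1) (\<lambda>x. n x * M)"
proof -
  obtain f where f: "f \<noteq> 0" "(f, z *\<^sub>C f) \<in> T" using z by (auto simp: point_spectrum_def op_LV_eq)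
  obtain h where h: "(f, h) \<in> op_A V" "f = free_inverse m (z *\<^sub>C f) - RB h" using f(2) by (auto simp: T_def)
  let ?g = "green m (fun_of (z *\<^sub>C f))"
  note gf = green_fun_of[OF m, of "z *\<^sub>C f"]
  define F where "F = (\<lambda>x. ?g x - gB h x)"
  have [measurable]: "?g \<in> borel_measurable borel" "gB h \<in> borel_measurable borel"
    by (rule measurable_green[OF gf(1) m], rule gB_props)
  have mF[measurable]: "F \<in> borel_measurable borel" unfolding F_def by measurable
  have sqF: "sq_integrable F" unfolding F_def by (rule sq_integrable_diff[OF gf(3) gB_props(2)])
  have fF: "f = class_of F"
    by (subst h(2)) (simp add: F_def free_inverse_def RB_def class_of_diff gf(3) gB_props(2))
  have ae: "AE x in lborel. fun_of f x = F x" unfolding fF by (rule fun_of_class_of[OF sqF])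
  have gV: "admissible (\<lambda>x. V x *v F x)" "gB h = green m (\<lambda>x. V x *v F x)"
  proof -
    have "AE x in lborel. fun_of h x = A x *v fun_of f x" using h(1) by (simp add: op_A_eq mult_op_iff)
    then have e: "AE x in lborel. B x *v fun_of h x = V x *v F x" using ae by eventually_elim (simp add: BA)
    show "admissible (\<lambda>x. V x *v F x)" "gB h = green m (\<lambda>x. V x *v F x)" by (rule gB_cong[OF e], measurable)+
  qed
  have mz: "(\<lambda>x. z *s F x) \<in> borel_measurable borel" by (rule measurable_vector_scalar_mult[OF mF])
  have ez: "AE x in lborel. fun_of (z *\<^sub>C f) x = z *s F x" using fun_of_scaleC[of z f] ae by eventually_elim simp
  have az: "admissible (\<lambda>x. z *s F x)" by (rule admissible_cong_AE[OF gf(1) mz ez])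
  have gz: "?g x = green m (\<lambda>x. z *s F x) x" for x by (rule green_cong_AE[OF gf(1) az ez])
  define s where "s = (\<lambda>x. z *s F x - V x *v F x)"
  have adm: "admissible s"
  proof -
    have "admissible (\<lambda>x. - (V x *v F x))" using gV(1) by (simp add: admissible_def)
    from admissible_add[OF az this] show ?thesis by (simp add: s_def)
  qed
  have Fs: "F = green m s"
  proof (rule ext)
    fix x
    have Fx: "F x = ?g x - gB h x" by (simp only: F_def)
    have "green m s x = green m (\<lambda>x. z *s F x) x - green m (\<lambda>x. V x *v F x) x"
      unfolding s_def by (rule green_diff[OF az gV(1)])
    also have "\<dots> = ?g x - gB h x" by (simp only: gz gV(2))
    finally show "F x = green m s x" using Fx by (rule trans[OF _ sym, rotated])
  qed
  note ode = green_ode[OF adm m, folded Fs]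
  have bF: "norm (F x) \<le> K * norm (z *\<^sub>C f) + K * ((N1 + 1) * norm h)" for x
    unfolding F_def by (rule order_trans[OF norm_triangle_ineq4 add_mono[OF gf(2) gB_props(1)]])
  define M where "M = Sup (range (\<lambda>x. norm (F x)))"
  have bdd: "bdd_above (range (\<lambda>x. norm (F x)))" using bF by (auto intro!: bdd_aboveI)
  have FM: "norm (F x) \<le> M" for x unfolding M_def by (rule cSUP_upper[OF UNIV_I bdd])
  have least: "M \<le> b" if "\<And>x. norm (F x) \<le> b" for b unfolding M_def using that by (intro cSUP_least) auto
  have Mpos: "M > 0"
  proof (rule ccontr)
    assume "\<not> M > 0"
    then have F0: "F x = 0" for x using FM[of x] by (metis norm_le_zero_iff not_less order_trans)
    have "AE x in lborel. fun_of f x = fun_of 0 x" using ae fun_of_zero by eventually_elim (simp add: F0)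
    then have "f = 0" by (rule L2_eqI)
    then show False using f(1) by simp
  qed
  have src: "norm ((V x *v F x) $ i) \<le> n x * M" for x i
    using Finite_Cartesian_Product.norm_nth_le[of "V x *v F x" i] opnorm_bound[of "V x" "F x"]
      mult_left_mono[OF FM[of x] opnorm_nonneg[of "V x"]] by linarith
  have "line_system m z (\<lambda>x. F x $ 1) (\<lambda>x. F x $ 2) (\<lambda>x. - (V x *v F x) $ 2) (\<lambda>x. (V x *v F x) $ 1) (\<lambda>x. n x * M)"
  proof
    show "0 < m" by (rule m)
    show "primitive_on {0..} (\<lambda>x. F x $ 1) (\<lambda>x. (of_real m + (z - \<i>)) * F x $ 2 + - (V x *v F x) $ 2)"
      by (rule primitive_on_cong[OF ode(1)]) (auto simp: s_def algebra_simps)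
    show "primitive_on {0..} (\<lambda>x. F x $ 2) (\<lambda>x. (of_real m - (z - \<i>)) * F x $ 1 + (V x *v F x) $ 1)"
      by (rule primitive_on_cong[OF ode(2)]) (auto simp: s_def algebra_simps)
    show "primitive_on {..0} (\<lambda>x. F x $ 1) (\<lambda>x. (of_real m + (z + \<i>)) * F x $ 2 + - (V x *v F x) $ 2)"
      by (rule primitive_on_cong[OF ode(3)]) (auto simp: s_def algebra_simps)
    show "primitive_on {..0} (\<lambda>x. F x $ 2) (\<lambda>x. (of_real m - (z + \<i>)) * F x $ 1 + (V x *v F x) $ 1)"
      by (rule primitive_on_cong[OF ode(4)]) (auto simp: s_def algebra_simps)
    show "integrable lborel (\<lambda>x. (norm (F x $ 1))\<^sup>2 + (norm (F x $ 2))\<^sup>2)"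
      using sqF by (simp add: sq_integrable_def norm_vec2_square)
    show "integrable lborel (\<lambda>x. n x * M)" using intV by simp
    show "(\<lambda>x. - (V x *v F x) $ 2) \<in> borel_measurable borel" "(\<lambda>x. (V x *v F x) $ 1) \<in> borel_measurable borel" by measurable
  qed (use src in auto)
  then show ?thesis using that Mpos least by blast
qed

text \<open>The a priori estimates bound the supremum of an eigenfunction by itself times a multiple of the norm
of the potential; that factor cannot be less than 1.\<close>

lemma eigenvalue_necessary:
  assumes z: "z \<in> point_spectrum (op_LV m V)" and w: "integrable lborel (\<lambda>x. \<bar>x\<bar> * n x)"
  defines "r \<equiv> m + 1 + norm z" and "Nw \<equiv> (LINT x|lborel. \<bar>x\<bar> * n x)"
  shows "1 \<le> 2 * ((2 * r\<^sup>2 / m + 1) * N1 + 2 * r * Nw)"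
    and "norm z \<ge> 12 * (m + 1) \<Longrightarrow> 1 \<le> 2 * (3 + 4 * r\<^sup>2 / m) * N1"
    and "norm z \<ge> 12 * (m + 1) \<Longrightarrow> \<bar>Im z\<bar> > 1 \<Longrightarrow> 1 \<le> 34 * N1"
proof -
  obtain F M where M: "M > 0" "\<forall>b. (\<forall>x. norm (F x) \<le> b) \<longrightarrow> M \<le> b" and
    sys: "line_system m z (\<lambda>x. F x $ 1) (\<lambda>x. F x $ 2) (\<lambda>x. - (V x *v F x) $ 2) (\<lambda>x. (V x *v F x) $ 1) (\<lambda>x. n x * M)"
    by (rule eigenfunction_system[OF z]) (rule that; assumption)
  interpret L: line_system m z "\<lambda>x. F x $ 1" "\<lambda>x. F x $ 2" "\<lambda>x. - (V x *v F x) $ 2" "\<lambda>x. (V x *v F x) $ 1" "\<lambda>x. n x * M"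
    by (rule sys)
  have LT: "L.T = N1 * M" by (simp add: L.T_def N1_def)
  have r2: "L.\<rho>\<^sup>2 = r" using L.\<rho>_sq by (simp add: r_def)
  have r4: "L.\<rho> ^ 4 = r\<^sup>2" unfolding r2[symmetric] by simp
  have concl: "1 \<le> 2 * c" if "\<And>x. norm (F x $ 1) \<le> c * M" "\<And>x. norm (F x $ 2) \<le> c * M" for c
  proof -
    have "norm (F x) \<le> c * M + c * M" for x
      using norm_vec2_le[of "F x"] that[of x] by linarith
    then have "M \<le> c * M + c * M" using M(2) by blast
    then have "M * 1 \<le> M * (2 * c)" by (simp add: algebra_simps)
    then show ?thesis using M(1) by (simp only: mult_le_cancel_left_pos)
  qed
  have iw: "integrable lborel (\<lambda>y. \<bar>y\<bar> * (n y * M))" and vw: "(LINT y|lborel. \<bar>y\<bar> * (n y * M)) = Nw * M"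
    using w by (simp_all add: Nw_def mult.assoc[symmetric])
  show "1 \<le> 2 * ((2 * r\<^sup>2 / m + 1) * N1 + 2 * r * Nw)"
  proof (rule concl)
    show "norm (F x $ 1) \<le> ((2 * r\<^sup>2 / m + 1) * N1 + 2 * r * Nw) * M" "norm (F x $ 2) \<le> ((2 * r\<^sup>2 / m + 1) * N1 + 2 * r * Nw) * M" for x
      using L.weighted_apriori[OF iw, of x] unfolding LT vw r2 r4 by (simp_all add: algebra_simps)
  qed
  {
    assume far: "norm z \<ge> 12 * (m + 1)"
    have "1 \<le> 2 * ((3 + 4 * r\<^sup>2 / m) * N1)"
    proof (rule concl)
      show "norm (F x $ 1) \<le> ((3 + 4 * r\<^sup>2 / m) * N1) * M" "norm (F x $ 2) \<le> ((3 + 4 * r\<^sup>2 / m) * N1) * M" for x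
        using L.far_apriori[OF far, of x] L.origin_bound_general unfolding LT r4 by (simp_all add: algebra_simps)
    qed
    then show "1 \<le> 2 * (3 + 4 * r\<^sup>2 / m) * N1" by (simp only: mult.assoc)
    assume im: "\<bar>Im z\<bar> > 1"
    have "1 \<le> 2 * (17 * N1)"
    proof (rule concl)
      show "norm (F x $ 1) \<le> (17 * N1) * M" "norm (F x $ 2) \<le> (17 * N1) * M" for x
        using L.far_apriori[OF far, of x] L.origin_bound_outside[OF far im] unfolding LT by simp_all
    qed
    then show "1 \<le> 34 * N1" by simp
  }
qed

end

text \<open>The weight dominates both 1 and \<open>\<bar>x\<bar>\<close>, so one norm controls the mass and the first moment of the
potential.\<close>

lemma nu1_integrals:
  fixes V :: "real \<Rightarrow> complex^2^2"
  assumes V: "integrable nu1 V"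
  shows "V \<in> borel_measurable borel" "integrable lborel (\<lambda>x. opnorm (V x))" "integrable lborel (\<lambda>x. \<bar>x\<bar> * opnorm (V x))"
    "(LINT x|lborel. opnorm (V x)) \<le> L1_norm nu1 V" "(LINT x|lborel. \<bar>x\<bar> * opnorm (V x)) \<le> L1_norm nu1 V"
proof -
  have "V \<in> borel_measurable nu1" using V by simp
  then show [measurable]: "V \<in> borel_measurable borel" by (simp add: nu1_def)
  let ?w = "\<lambda>x::real. sqrt (1 + x\<^sup>2)"
  have w1: "1 \<le> ?w x" "\<bar>x\<bar> \<le> ?w x" for x
    by (simp, metis real_sqrt_abs real_sqrt_le_iff le_add_same_cancel2 zero_le_one)
  have "integrable lborel (\<lambda>x. ?w x *\<^sub>R V x)"
    using V unfolding nu1_def by (subst (asm) integrable_density) auto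
  then have iw: "integrable lborel (\<lambda>x. norm (?w x *\<^sub>R V x))" by (rule integrable_norm)
  have le: "?w x * opnorm (V x) \<le> norm (?w x *\<^sub>R V x)" for x
    using opnorm_le_norm[of "V x"] w1(1)[of x] by (simp add: mult_left_mono)
  have iwn: "integrable lborel (\<lambda>x. ?w x * opnorm (V x))"
  proof (rule Bochner_Integration.integrable_bound[OF iw])
    show "AE x in lborel. norm (?w x * opnorm (V x)) \<le> norm (norm (?w x *\<^sub>R V x))"
    proof (rule AE_I2)
      fix x show "norm (?w x * opnorm (V x)) \<le> norm (norm (?w x *\<^sub>R V x))"
        using le[of x] opnorm_nonneg[of "V x"] w1(1)[of x] by (simp add: abs_mult)
    qed
  qed measurable
  have N: "L1_norm nu1 V = (LINT x|lborel. ?w x * opnorm (V x))"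
    unfolding L1_norm_def nu1_def opnorm_def[symmetric] by (subst integral_density) auto
  have 1: "opnorm (V x) \<le> ?w x * opnorm (V x)" for x
    using mult_right_mono[OF w1(1) opnorm_nonneg[of "V x"], of x] by simp
  have 2: "\<bar>x\<bar> * opnorm (V x) \<le> ?w x * opnorm (V x)" for x
    by (rule mult_right_mono[OF w1(2) opnorm_nonneg])
  show i1: "integrable lborel (\<lambda>x. opnorm (V x))"
    by (rule Bochner_Integration.integrable_bound[OF iwn]) (use 1 opnorm_nonneg in \<open>auto intro!: AE_I2 simp: abs_mult\<close>)
  show i2: "integrable lborel (\<lambda>x. \<bar>x\<bar> * opnorm (V x))"
    by (rule Bochner_Integration.integrable_bound[OF iwn]) (use 2 opnorm_nonneg in \<open>auto intro!: AE_I2 simp: abs_mult\<close>)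
  show "(LINT x|lborel. opnorm (V x)) \<le> L1_norm nu1 V" unfolding N by (rule integral_mono[OF i1 iwn 1])
  show "(LINT x|lborel. \<bar>x\<bar> * opnorm (V x)) \<le> L1_norm nu1 V" unfolding N by (rule integral_mono[OF i2 iwn 2])
qed

theorem theorem2p5:
  fixes m :: real
  assumes "m > 0"
  shows "\<exists>C>0. \<forall>V :: real \<Rightarrow> complex^2^2.
    integrable nu1 V \<and> L1_norm nu1 V < C \<longrightarrow>
    point_spectrum (op_LV m V) \<subseteq>
      (if AE x in lborel. V x = 0 then {}
       else {z. \<bar>Im z\<bar> \<le> 1 \<and> \<bar>Re z\<bar> > C / sqrt (L1_norm lborel V)})"
proof -
  define R where "R = 13 * (m + 1)"
  define D where "D = 2 * ((2 * R\<^sup>2 / m + 1) + 2 * R)"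
  have D: "D > 0" unfolding D_def R_def using assms by (intro mult_pos_pos add_pos_pos divide_pos_pos) auto
  \<comment> \<open>The first three bounds exclude, in order, the exterior of the strip, moderate \<open>Re z\<close> inside it, and \<open>norm z < 12 * (m + 1)\<close>; the last one is the contraction condition.\<close>
  define C where "C = Min {1 / 34, m / 64, 1 / D, 1 / (2 * green_norm m)}"
  have Kp: "green_norm m > 0" by (rule green_norm_pos)
  have C0: "C > 0" unfolding C_def using D Kp assms by simp
  have C1: "C \<le> 1 / 34" and C2: "C \<le> m / 64" and C3: "C \<le> 1 / D" and C4: "C \<le> 1 / (2 * green_norm m)"
    unfolding C_def by simp_all
  have main: "z \<in> (if AE x in lborel. V x = 0 then {} else {z. \<bar>Im z\<bar> \<le> 1 \<and> \<bar>Re z\<bar> > C / sqrt (L1_norm lborel V)})"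
    if V: "integrable nu1 V" "L1_norm nu1 V < C" and z: "z \<in> point_spectrum (op_LV m V)" for V z
  proof -
    note nu = nu1_integrals[OF V(1)]
    interpret P: potential m V using assms nu by unfold_locales auto
    have N: "P.N1 < C" using nu(4) V(2) by (simp add: P.N1_def)
    have Nw: "(LINT x|lborel. \<bar>x\<bar> * opnorm (V x)) < C" using nu(5) V(2) by simp
    have N0: "P.N1 \<ge> 0" by (rule P.N1_nonneg)
    have LN: "L1_norm lborel V = P.N1" by (simp add: L1_norm_def P.N1_def opnorm_def)
    have "green_norm m * P.N1 < green_norm m * (1 / (2 * green_norm m))" using N C4 Kp by (intro mult_strict_left_mono) auto
    then have contr: "green_norm m * P.N1 < 1" using Kp by simp
    interpret S: small_potential m V by unfold_locales (rule contr)
    note nec = S.eigenvalue_necessary[OF z nu(3)]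
    define r where "r = m + 1 + norm z"
    have far: "norm z \<ge> 12 * (m + 1)"
    proof (rule ccontr)
      assume "\<not> ?thesis"
      then have r: "r \<le> R" "0 \<le> r" using assms by (auto simp: r_def R_def)
      have "2 * r\<^sup>2 / m + 1 \<le> 2 * R\<^sup>2 / m + 1" using r assms by (intro add_mono divide_right_mono mult_left_mono power_mono) auto
      then have "(2 * r\<^sup>2 / m + 1) * P.N1 + 2 * r * (LINT x|lborel. \<bar>x\<bar> * opnorm (V x))
          \<le> (2 * R\<^sup>2 / m + 1) * P.N1 + 2 * R * (LINT x|lborel. \<bar>x\<bar> * opnorm (V x))"
        using r N0 by (intro add_mono mult_right_mono integral_nonneg_AE AE_I2) (auto simp: opnorm_nonneg)
      also have "\<dots> < (2 * R\<^sup>2 / m + 1) * C + 2 * R * C"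
        using N Nw assms by (intro add_strict_mono mult_strict_left_mono) (auto simp: R_def intro!: add_nonneg_pos)
      finally have lt: "(2 * r\<^sup>2 / m + 1) * P.N1 + 2 * r * (LINT x|lborel. \<bar>x\<bar> * opnorm (V x)) < (2 * R\<^sup>2 / m + 1) * C + 2 * R * C" .
      have "1 < 2 * y" if "x < y" "1 \<le> 2 * x" for x y :: real using that by linarith
      from this[OF lt nec(1)[folded r_def]] have "1 < 2 * ((2 * R\<^sup>2 / m + 1) * C + 2 * R * C)" .
      moreover have "2 * ((2 * R\<^sup>2 / m + 1) * C + 2 * R * C) = D * C" by (simp add: D_def algebra_simps)
      ultimately have "1 < D * C" by simp
      then show False using C3 D by (simp add: field_simps)
    qed
    have im: "\<bar>Im z\<bar> \<le> 1"
    proof (rule ccontr)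
      assume "\<not> ?thesis"
      then have "1 \<le> 34 * P.N1" using nec(3)[OF far] by simp
      then show False using N C1 by simp
    qed
    have far': "1 \<le> 2 * (3 + 4 * r\<^sup>2 / m) * P.N1" using nec(2)[OF far] by (simp add: r_def)
    have Npos: "P.N1 > 0"
    proof (rule ccontr)
      assume "\<not> P.N1 > 0"
      then have "P.N1 = 0" using N0 by simp
      then show False using far' by simp
    qed
    have nz: "\<not> (AE x in lborel. V x = 0)"
    proof
      assume "AE x in lborel. V x = 0"
      then have "AE x in lborel. opnorm (V x) = 0"
        by eventually_elim (metis norm_zero opnorm_le_norm opnorm_nonneg order_antisym)
      then have "P.N1 = 0" unfolding P.N1_def by (rule integral_eq_zero_AE)
      then show False using Npos by simp
    qed
    have "\<bar>Re z\<bar> > C / sqrt P.N1"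
    proof (rule ccontr)
      assume "\<not> ?thesis"
      then have "\<bar>Re z\<bar> * sqrt P.N1 \<le> C" using Npos by (simp add: field_simps)
      then have "(\<bar>Re z\<bar> * sqrt P.N1)\<^sup>2 \<le> C\<^sup>2" using N0 by (intro power_mono) auto
      then have ReN: "(Re z)\<^sup>2 * P.N1 \<le> C\<^sup>2" using N0 by (simp add: power_mult_distrib)
      have "norm z \<le> \<bar>Re z\<bar> + \<bar>Im z\<bar>" by (rule cmod_le)
      then have r: "r \<le> 2 * \<bar>Re z\<bar>" "0 \<le> r" using far im assms by (auto simp: r_def)
      have "r\<^sup>2 \<le> (2 * \<bar>Re z\<bar>)\<^sup>2" by (rule power_mono[OF r])
      then have r2: "r\<^sup>2 \<le> 4 * (Re z)\<^sup>2" by (simp add: power_mult_distrib)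
      have "r\<^sup>2 * P.N1 \<le> 4 * (Re z)\<^sup>2 * P.N1" by (rule mult_right_mono[OF r2 N0])
      then have "r\<^sup>2 * P.N1 \<le> 4 * C\<^sup>2" using ReN by simp
      also have "\<dots> \<le> 4 * (m / 64)"
      proof -
        have "C * C \<le> 1 * (m / 64)" using C0 C1 C2 by (intro mult_mono) auto
        then show ?thesis by (simp add: power2_eq_square)
      qed
      finally have "r\<^sup>2 * P.N1 / m \<le> 1 / 16" using assms by (simp add: field_simps)
      moreover have "2 * (3 + 4 * r\<^sup>2 / m) * P.N1 = 6 * P.N1 + 8 * (r\<^sup>2 * P.N1 / m)" by (simp add: algebra_simps)
      ultimately show False using far' N C1 by simp
    qed
    then show ?thesis using im nz by (simp add: LN)
  qed
  show ?thesis
    by (intro exI[of _ C] conjI C0 allI impI subsetI) (rule main, auto)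
qed

end
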